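(* Let $\mathcal{H}$ be a Hankel matrix with $\ell^2$-columns (i.e. all its columns are square summable) and $\operatorname{rank}\mathcal{H}>1$, and let $\mathcal{J}$ be any of the Hermitian non-decomposable Jacobi matrices $\mathcal{J}^{j}$, $j\in\{\mathrm{W},\mathrm{CdH},\mathrm{CH},\mathrm{J},\mathrm{MP},\mathrm{M},\mathrm{L},\mathrm{C},\mathrm{H}\}$, from the Askey scheme, with admissible parameters. If $\mathcal{H}\mathcal{J}=\mathcal{J}\mathcal{H}$, then $\mathcal{H}$ is a scalar multiple of the Hankel matrix $\tilde{\mathcal{H}}_t$ with entries $$(\tilde{\mathcal{H}}_t)_{m,n}=\frac{(-1)^{m+n}}{m+n+t},\qquad m,n\in\mathbb{N}_0,$$ for some $t\in\mathbb{R}\setminus(-\mathbb{N}_0)$.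
   Context: $\mathbb{N}_0=\{0,1,2,\dots\}$. Matrices are semi-infinite, indexed by $m,n\in\mathbb{N}_0$. A Hankel matrix is one of the form $\mathcal{H}_{m,n}=h_{m+n}$ with $h_k\in\mathbb{R}$. A Jacobi matrix $\mathcal{J}$ is a symmetric tridiagonal matrix with $\mathcal{J}_{n,n}=\beta_n$, $\mathcal{J}_{n,n+1}=\mathcal{J}_{n+1,n}=\alpha_n$. The commutation $\mathcal{H}\mathcal{J}=\mathcal{J}\mathcal{H}$ is meant entrywise (the products are well defined since $\mathcal{J}$ is banded). For each $j$, $\mathcal{J}^{j}$ is the Jacobi matrix with entries $\alpha_n^{j}$, $\beta_n^{j}$ and admissible parameters given as follows. W (Wilson): $\alpha_n^{\mathrm{W}}=\sqrt{A_nC_{n+1}}$, $\beta_n^{\mathrm{W}}=A_n+C_n-a^2$, where with $s=a+b+c+d$ $$A_n=\frac{(n+a+b)(n+a+c)(n+a+d)(n+s-1)}{(2n+s-1)(2n+s)},\quad C_n=\frac{n(n+b+c-1)(n+b+d-1)(n+c+d-1)}{(2n+s-2)(2n+s-1)}.$$ These are symmetric functions of $a,b,c,d$. Admissible: $a,b,c,d\in\mathbb{C}$ such that either (1) $\Re a,\Re b,\Re c,\Re d>0$ and non-real parameters occur in complex conjugate pairs, or (2) up to a permutation of parameters, $a<0$ and $a+b,a+c,a+d$ are positive or a pair of complex conjugates occurs among them with positive real parts (the remaining one being positive). CdH (Continuous dual Hahn): $\alpha_n^{\mathrm{CdH}}=\sqrt{(n+1)(n+a+b)(n+a+c)(n+b+c)}$,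 $\beta_n^{\mathrm{CdH}}=2n^2+(2a+2b+2c-1)n+ab+ac+bc$. Admissible: $a,b,c\in\mathbb{C}$ such that either (1) $a,b,c$ are positive except possibly a pair of complex conjugates with positive real parts, or (2) up to a permutation, $a<0$ and $a+b,a+c$ are positive or a pair of complex conjugates with positive real parts. CH (Continuous Hahn): $\alpha_n^{\mathrm{CH}}=\sqrt{-A_nC_{n+1}}$, $\beta_n^{\mathrm{CH}}=\mathrm{i}(A_n+C_n+a)$, where with $s=a+b+c+d$ $$A_n=-\frac{(n+s-1)(n+a+c)(n+a+d)}{(2n+s-1)(2n+s)},\quad C_n=\frac{n(n+b+c-1)(n+b+d-1)}{(2n+s-2)(2n+s-1)}.$$ Admissible: $c=\bar a$, $d=\bar b$, $\Re a>0$, $\Re b>0$. J (Jacobi): $$\alpha_n^{\mathrm{J}}=\sqrt{\frac{4(n+1)(n+\alpha+1)(n+\beta+1)(n+\alpha+\beta+1)}{(2n+\alpha+\beta+1)(2n+\alpha+\beta+2)^2(2n+\alpha+\beta+3)}},\quad \beta_n^{\mathrm{J}}=\frac{\beta^2-\alpha^2}{(2n+\alpha+\beta)(2n+\alpha+\beta+2)},$$ with $\alpha,\beta>-1$. MP (Meixner–Pollaczek): $\alpha_n^{\mathrm{MP}}=\frac{\sqrt{(n+1)(n+2\lambda)}}{2\sin\phi}$, $\beta_n^{\mathrm{MP}}=-\frac{n+\lambda}{\tan\phi}$ (equal to $0$ if $\phi=\pi/2$), with $\lambda>0$, $\phi\in(0,\pi)$. M (Meixner): $\alpha_n^{\mathrm{M}}=\frac{\sqrt{c(n+1)(n+\beta)}}{1-c}$,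 $\beta_n^{\mathrm{M}}=\frac{n+(n+\beta)c}{1-c}$, with $\beta>0$, $c\in(0,1)$. L (Laguerre): $\alpha_n^{\mathrm{L}}=\sqrt{(n+1)(n+\alpha+1)}$, $\beta_n^{\mathrm{L}}=2n+\alpha+1$, with $\alpha>-1$. C (Charlier): $\alpha_n^{\mathrm{C}}=\sqrt{a(n+1)}$, $\beta_n^{\mathrm{C}}=n+a$, with $a>0$. H (Hermite): $\alpha_n^{\mathrm{H}}=\sqrt{(n+1)/2}$, $\beta_n^{\mathrm{H}}=0$. Convention: with the parameters fixed, the rational expressions (including those under the square roots) are regarded as rational functions of $n$, with common factors cancelled; this fixes the value at $n=0$ whenever the printed formula reads $0/0$ (for example $\beta_n^{\mathrm{J}}=0$ for all $n\ge 0$ if $\beta=-\alpha$). *)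

theory Defs
  imports
    Complex_Main
    "HOL-Library.Multiset"
    "HOL-Library.Extended_Nat"
    "HOL-Library.Nonpos_Ints"
    "HOL-Computational_Algebra.Computational_Algebra"
    "HOL-Computational_Algebra.Field_as_Ring"
begin

section \<open>Semi-infinite matrices\<close>

(* The products used below have only finitely many nonzero terms in each entry. *)
definition mat_mult ::
  "(nat \<Rightarrow> nat \<Rightarrow> 'a::{topological_space, semiring_0}) \<Rightarrow> (nat \<Rightarrow> nat \<Rightarrow> 'a) \<Rightarrow> nat \<Rightarrow> nat \<Rightarrow> 'a"
  where "mat_mult A B = (\<lambda>m n. \<Sum>k. A m k * B k n)"

definition hankel_matrix :: "(nat \<Rightarrow> nat \<Rightarrow> real) \<Rightarrow> bool" where
  "hankel_matrix H \<longleftrightarrow> (\<exists>h. \<forall>m n. H m n = h (m + n))"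

definition l2_columns :: "(nat \<Rightarrow> nat \<Rightarrow> real) \<Rightarrow> bool" where
  "l2_columns H \<longleftrightarrow> (\<forall>n. summable (\<lambda>m. (H m n)\<^sup>2))"

definition independent_columns :: "(nat \<Rightarrow> nat \<Rightarrow> 'a::field) \<Rightarrow> nat set \<Rightarrow> bool" where
  "independent_columns M S \<longleftrightarrow>
     finite S \<and> (\<forall>c. (\<forall>m. (\<Sum>n\<in>S. c n * M m n) = 0) \<longrightarrow> (\<forall>n\<in>S. c n = 0))"

(* Valued in enat: the library's dimension of a space is a natural number and is 0
   for infinite-dimensional spaces, whereas infinite rank has to count as rank > 1. *)
definition matrix_rank :: "(nat \<Rightarrow> nat \<Rightarrow> 'a::field) \<Rightarrow> enat" where
  "matrix_rank M = (SUP S \<in> {S. independent_columns M S}. enat (card S))"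

definition jacobi_matrix :: "(nat \<Rightarrow> 'a::zero) \<Rightarrow> (nat \<Rightarrow> 'a) \<Rightarrow> nat \<Rightarrow> nat \<Rightarrow> 'a" where
  "jacobi_matrix \<alpha> \<beta> m n =
     (if m = n then \<beta> n else if n = m + 1 then \<alpha> m else if m = n + 1 then \<alpha> n else 0)"

definition hilbert_tilde :: "real \<Rightarrow> nat \<Rightarrow> nat \<Rightarrow> real" where
  "hilbert_tilde t m n = (-1) ^ (m + n) / (real m + real n + t)"


section \<open>Rational functions of the index\<close>

(* Coefficients that are rational in n are formed in the field of rational functions and
   evaluated in lowest terms. This fixes their value where the formula reads 0/0. *)

definition rat_const :: "'a::idom \<Rightarrow> 'a poly fract" where
  "rat_const a = to_fract [:a:]"

definition rat_var :: "'a::idom poly fract" where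
  "rat_var = to_fract [:0, 1:]"

(* quot_of_fract yields a coprime pair of numerator and denominator *)
definition eval_rat :: "'a::field_gcd poly fract \<Rightarrow> 'a \<Rightarrow> 'a" where
  "eval_rat r x = poly (fst (quot_of_fract r)) x / poly (snd (quot_of_fract r)) x"

lemma eval_rat_Fract:
  fixes p q :: "'a::field_gcd poly"
  assumes "poly q x \<noteq> 0"
  shows "eval_rat (Fract p q) x = poly p x / poly q x"
proof -
  define p' where "p' = fst (quot_of_fract (Fract p q))"
  define q' where "q' = snd (quot_of_fract (Fract p q))"
  have q0: "q \<noteq> 0" using assms by auto
  have q'0: "q' \<noteq> 0" by (simp add: q'_def)
  have "Fract p' q' = Fract p q" by (simp add: p'_def q'_def)
  then have eq: "p' * q = p * q'" using q0 q'0 by (simp add: eq_fract)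
  have "coprime p' q'" unfolding p'_def q'_def by (rule coprime_quot_of_fract)
  moreover have "q' dvd p' * q" using eq by simp
  ultimately have "q' dvd q"
    by (simp add: coprime_commute coprime_dvd_mult_right_iff)
  then have "poly q' x \<noteq> 0" using assms by (auto elim!: dvdE)
  moreover have "poly p' x * poly q x = poly p x * poly q' x"
    using eq by (metis poly_mult)
  ultimately show ?thesis
    using assms by (simp add: eval_rat_def p'_def [symmetric] q'_def [symmetric] frac_eq_eq)
qed


section \<open>Jacobi matrices from the Askey scheme\<close>

(* The non-real elements occur in complex conjugate pairs and all real parts are positive. *)
definition positive_or_conj_pairs :: "complex multiset \<Rightarrow> bool" where
  "positive_or_conj_pairs M \<longleftrightarrow> image_mset cnj M = M \<and> (\<forall>z\<in>#M. 0 < Re z)"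


subsection \<open>Wilson\<close>

definition wilson_A :: "'k::field \<Rightarrow> 'k \<Rightarrow> 'k \<Rightarrow> 'k \<Rightarrow> 'k \<Rightarrow> 'k" where
  "wilson_A a b c d n = (let s = a + b + c + d in
     ((n + a + b) * (n + a + c) * (n + a + d) * (n + s - 1))
       / ((2 * n + s - 1) * (2 * n + s)))"

definition wilson_C :: "'k::field \<Rightarrow> 'k \<Rightarrow> 'k \<Rightarrow> 'k \<Rightarrow> 'k \<Rightarrow> 'k" where
  "wilson_C a b c d n = (let s = a + b + c + d in
     (n * (n + b + c - 1) * (n + b + d - 1) * (n + c + d - 1))
       / ((2 * n + s - 2) * (2 * n + s - 1)))"

definition wilson_alpha :: "complex \<Rightarrow> complex \<Rightarrow> complex \<Rightarrow> complex \<Rightarrow> nat \<Rightarrow> complex" where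
  "wilson_alpha a b c d n =
     csqrt (eval_rat
       (wilson_A (rat_const a) (rat_const b) (rat_const c) (rat_const d) rat_var
        * wilson_C (rat_const a) (rat_const b) (rat_const c) (rat_const d) (rat_var + 1))
       (of_nat n))"

definition wilson_beta :: "complex \<Rightarrow> complex \<Rightarrow> complex \<Rightarrow> complex \<Rightarrow> nat \<Rightarrow> complex" where
  "wilson_beta a b c d n =
     eval_rat
       (wilson_A (rat_const a) (rat_const b) (rat_const c) (rat_const d) rat_var
        + wilson_C (rat_const a) (rat_const b) (rat_const c) (rat_const d) rat_var
        - (rat_const a)\<^sup>2)
       (of_nat n)"

definition wilson_admissible :: "complex \<Rightarrow> complex \<Rightarrow> complex \<Rightarrow> complex \<Rightarrow> bool" where
  "wilson_admissible a b c d \<longleftrightarrow>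
     positive_or_conj_pairs {#a, b, c, d#} \<or>
     (\<exists>a' b' c' d'. {#a', b', c', d'#} = {#a, b, c, d#} \<and> a' \<in> \<real> \<and> Re a' < 0 \<and>
        positive_or_conj_pairs {#a' + b', a' + c', a' + d'#})"


subsection \<open>Continuous dual Hahn\<close>

definition cdhahn_alpha :: "complex \<Rightarrow> complex \<Rightarrow> complex \<Rightarrow> nat \<Rightarrow> complex" where
  "cdhahn_alpha a b c n =
     csqrt ((of_nat n + 1) * (of_nat n + a + b) * (of_nat n + a + c) * (of_nat n + b + c))"

definition cdhahn_beta :: "complex \<Rightarrow> complex \<Rightarrow> complex \<Rightarrow> nat \<Rightarrow> complex" where
  "cdhahn_beta a b c n =
     2 * (of_nat n)\<^sup>2 + (2 * a + 2 * b + 2 * c - 1) * of_nat n + a * b + a * c + b * c"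

definition cdhahn_admissible :: "complex \<Rightarrow> complex \<Rightarrow> complex \<Rightarrow> bool" where
  "cdhahn_admissible a b c \<longleftrightarrow>
     positive_or_conj_pairs {#a, b, c#} \<or>
     (\<exists>a' b' c'. {#a', b', c'#} = {#a, b, c#} \<and> a' \<in> \<real> \<and> Re a' < 0 \<and>
        positive_or_conj_pairs {#a' + b', a' + c'#})"


subsection \<open>Continuous Hahn\<close>

definition chahn_A :: "'k::field \<Rightarrow> 'k \<Rightarrow> 'k \<Rightarrow> 'k \<Rightarrow> 'k \<Rightarrow> 'k" where
  "chahn_A a b c d n = (let s = a + b + c + d in
     - (((n + s - 1) * (n + a + c) * (n + a + d)) / ((2 * n + s - 1) * (2 * n + s))))"

definition chahn_C :: "'k::field \<Rightarrow> 'k \<Rightarrow> 'k \<Rightarrow> 'k \<Rightarrow> 'k \<Rightarrow> 'k" where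
  "chahn_C a b c d n = (let s = a + b + c + d in
     (n * (n + b + c - 1) * (n + b + d - 1)) / ((2 * n + s - 2) * (2 * n + s - 1)))"

definition chahn_alpha :: "complex \<Rightarrow> complex \<Rightarrow> complex \<Rightarrow> complex \<Rightarrow> nat \<Rightarrow> complex" where
  "chahn_alpha a b c d n =
     csqrt (eval_rat
       (- (chahn_A (rat_const a) (rat_const b) (rat_const c) (rat_const d) rat_var
           * chahn_C (rat_const a) (rat_const b) (rat_const c) (rat_const d) (rat_var + 1)))
       (of_nat n))"

definition chahn_beta :: "complex \<Rightarrow> complex \<Rightarrow> complex \<Rightarrow> complex \<Rightarrow> nat \<Rightarrow> complex" where
  "chahn_beta a b c d n =
     \<i> * eval_rat
       (chahn_A (rat_const a) (rat_const b) (rat_const c) (rat_const d) rat_var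
        + chahn_C (rat_const a) (rat_const b) (rat_const c) (rat_const d) rat_var
        + rat_const a)
       (of_nat n)"

definition chahn_admissible :: "complex \<Rightarrow> complex \<Rightarrow> complex \<Rightarrow> complex \<Rightarrow> bool" where
  "chahn_admissible a b c d \<longleftrightarrow> c = cnj a \<and> d = cnj b \<and> 0 < Re a \<and> 0 < Re b"


subsection \<open>Jacobi\<close>

definition jacobi_alpha :: "real \<Rightarrow> real \<Rightarrow> nat \<Rightarrow> real" where
  "jacobi_alpha \<alpha> \<beta> n =
     (let N = rat_var; a = rat_const \<alpha>; b = rat_const \<beta> in
      sqrt (eval_rat
        ((4 * (N + 1) * (N + a + 1) * (N + b + 1) * (N + a + b + 1))
          / ((2 * N + a + b + 1) * (2 * N + a + b + 2)\<^sup>2 * (2 * N + a + b + 3)))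
        (real n)))"

definition jacobi_beta :: "real \<Rightarrow> real \<Rightarrow> nat \<Rightarrow> real" where
  "jacobi_beta \<alpha> \<beta> n =
     (let N = rat_var; a = rat_const \<alpha>; b = rat_const \<beta> in
      eval_rat ((b\<^sup>2 - a\<^sup>2) / ((2 * N + a + b) * (2 * N + a + b + 2))) (real n))"


subsection \<open>Meixner-Pollaczek\<close>

definition meixner_pollaczek_alpha :: "real \<Rightarrow> real \<Rightarrow> nat \<Rightarrow> real" where
  "meixner_pollaczek_alpha l \<phi> n = sqrt ((real n + 1) * (real n + 2 * l)) / (2 * sin \<phi>)"

definition meixner_pollaczek_beta :: "real \<Rightarrow> real \<Rightarrow> nat \<Rightarrow> real" where
  "meixner_pollaczek_beta l \<phi> n = (if \<phi> = pi / 2 then 0 else - ((real n + l) / tan \<phi>))"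


subsection \<open>Meixner\<close>

definition meixner_alpha :: "real \<Rightarrow> real \<Rightarrow> nat \<Rightarrow> real" where
  "meixner_alpha \<beta> c n = sqrt (c * (real n + 1) * (real n + \<beta>)) / (1 - c)"

definition meixner_beta :: "real \<Rightarrow> real \<Rightarrow> nat \<Rightarrow> real" where
  "meixner_beta \<beta> c n = (real n + (real n + \<beta>) * c) / (1 - c)"


subsection \<open>Laguerre\<close>

definition laguerre_alpha :: "real \<Rightarrow> nat \<Rightarrow> real" where
  "laguerre_alpha \<alpha> n = sqrt ((real n + 1) * (real n + \<alpha> + 1))"

definition laguerre_beta :: "real \<Rightarrow> nat \<Rightarrow> real" where
  "laguerre_beta \<alpha> n = 2 * real n + \<alpha> + 1"


subsection \<open>Charlier\<close>

definition charlier_alpha :: "real \<Rightarrow> nat \<Rightarrow> real" where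
  "charlier_alpha a n = sqrt (a * (real n + 1))"

definition charlier_beta :: "real \<Rightarrow> nat \<Rightarrow> real" where
  "charlier_beta a n = real n + a"


subsection \<open>Hermite\<close>

definition hermite_alpha :: "nat \<Rightarrow> real" where
  "hermite_alpha n = sqrt ((real n + 1) / 2)"

definition hermite_beta :: "nat \<Rightarrow> real" where
  "hermite_beta n = 0"


subsection \<open>The nine families\<close>

definition complex_matrix :: "(nat \<Rightarrow> nat \<Rightarrow> real) \<Rightarrow> nat \<Rightarrow> nat \<Rightarrow> complex" where
  "complex_matrix M = (\<lambda>m n. complex_of_real (M m n))"

(* Complex entries, as the first three families have complex parameters; for admissible
   parameters all entries are real and the off-diagonal ones are positive. *)
inductive askey_jacobi_matrix :: "(nat \<Rightarrow> nat \<Rightarrow> complex) \<Rightarrow> bool" where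
  Wilson: "wilson_admissible a b c d \<Longrightarrow>
    askey_jacobi_matrix (jacobi_matrix (wilson_alpha a b c d) (wilson_beta a b c d))"
| Continuous_dual_Hahn: "cdhahn_admissible a b c \<Longrightarrow>
    askey_jacobi_matrix (jacobi_matrix (cdhahn_alpha a b c) (cdhahn_beta a b c))"
| Continuous_Hahn: "chahn_admissible a b c d \<Longrightarrow>
    askey_jacobi_matrix (jacobi_matrix (chahn_alpha a b c d) (chahn_beta a b c d))"
| Jacobi: "\<alpha> > -1 \<Longrightarrow> \<beta> > -1 \<Longrightarrow>
    askey_jacobi_matrix (complex_matrix (jacobi_matrix (jacobi_alpha \<alpha> \<beta>) (jacobi_beta \<alpha> \<beta>)))"
| Meixner_Pollaczek: "l > 0 \<Longrightarrow> 0 < \<phi> \<Longrightarrow> \<phi> < pi \<Longrightarrow>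
    askey_jacobi_matrix (complex_matrix
      (jacobi_matrix (meixner_pollaczek_alpha l \<phi>) (meixner_pollaczek_beta l \<phi>)))"
| Meixner: "\<beta> > 0 \<Longrightarrow> 0 < c \<Longrightarrow> c < 1 \<Longrightarrow>
    askey_jacobi_matrix (complex_matrix (jacobi_matrix (meixner_alpha \<beta> c) (meixner_beta \<beta> c)))"
| Laguerre: "\<alpha> > -1 \<Longrightarrow>
    askey_jacobi_matrix (complex_matrix (jacobi_matrix (laguerre_alpha \<alpha>) (laguerre_beta \<alpha>)))"
| Charlier: "a > 0 \<Longrightarrow>
    askey_jacobi_matrix (complex_matrix (jacobi_matrix (charlier_alpha a) (charlier_beta a)))"
| Hermite:
    "askey_jacobi_matrix (complex_matrix (jacobi_matrix hermite_alpha hermite_beta))"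

end

theory Submission
  imports Defs "HOL-Analysis.Analysis" "HOL-Real_Asymp.Real_Asymp"
begin

text \<open>
  Write h_k for the entries of the Hankel matrix, b_n for the diagonal of the Jacobi matrix and
  y_0 = 0, y_{n+1} = \<alpha>_n for its shifted off-diagonal. Commutation is the system
  (y_n - y_m) h_k + (b_n - b_m) h_{k+1} + (y_{n+1} - y_{m+1}) h_{k+2} = 0 for all m + n = k + 1.
  For each k these are about k / 2 equations for three unknowns, so they are solvable only
  for exceptional y and b. The proof extracts this by letting k tend to infinity with m fixed,
  after taking differences in m until the contribution of the far index n converges.

  Two limiting devices are used. A limit direction of four consecutive entries satisfies all limit
  relations together with their shifted copies (\<open>limit_window_exists\<close>). And when the relations
  involve only two unknowns, the 2 \<times> 2 minors of the limiting coefficients vanish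
  (\<open>limit_minor_eq_zero\<close>), so that a suitable difference of y is geometric. As y_n^2 is a rational
  function of n, a genuinely geometric term is impossible
  (\<open>poly_plus_geometric_not_rational\<close>), and y is a polynomial.

  The nine families fall into four groups. For Laguerre, Meixner, Meixner-Pollaczek, Charlier and
  Hermite the diagonal is affine and disappears in the second difference; the conclusion is
  y_n = p n, which leaves a recurrence with constant coefficients whose null solutions have
  rank one (\<open>affine_diagonal\<close>). For continuous Hahn the diagonal converges and the limit
  direction forces the recurrence h_{k+2} = - h_k (\<open>bounded_diagonal\<close>). For Jacobi both sequences
  converge, y is constant, and then h = 0 (\<open>convergent_offdiagonal\<close>). For Wilson and continuous
  dual Hahn the limit direction shows that y_n + y_{n+1} - b_n is constant, which
  expresses everything by f_k = h_k + h_{k+1}. Then y_n = \<kappa> n (n + t - 1), the recurrence is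
  (k + t) h_k + 2 (k + 1 + t) h_{k+1} + (k + 2 + t) h_{k+2} = 0, and its null solutions are the multiples
  of (-1)^k / (k + t) (\<open>quadratic_offdiagonal\<close>).
\<close>

section \<open>Rank one and the entrywise form of commutation\<close>

text \<open>
  The sequences whose Hankel matrix has rank at most one. With 0^0 = 1 the ratio r = 0
  covers the sequences that vanish from index one on.
\<close>

definition geometric :: "(nat \<Rightarrow> complex) \<Rightarrow> bool" where
  "geometric h \<longleftrightarrow> (\<exists>r. \<forall>k. h k = h 0 * r ^ k)"

text \<open>
  All 2 \<times> 2 minors of the Hankel matrix of a geometric sequence vanish, so any two
  columns are proportional. The ratio may be complex, which lets the recurrence arguments
  below run over the complex numbers.
\<close>

lemma geometric_hankel_rank:
  assumes H: "\<And>m n. H m n = h (m + n)" and rank: "matrix_rank H > 1"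
  shows "\<not> geometric (\<lambda>k. complex_of_real (h k))"
proof
  assume "geometric (\<lambda>k. complex_of_real (h k))"
  then obtain r where r: "complex_of_real (h k) = of_real (h 0) * r ^ k" for k
    unfolding geometric_def by auto
  from rank obtain S where S: "independent_columns H S" "1 < enat (card S)"
    unfolding matrix_rank_def less_SUP_iff by auto
  from S have fin: "finite S" by (simp add: independent_columns_def)
  have "\<not> card S \<le> Suc 0" using S(2) by (simp add: one_enat_def)
  with fin obtain p q where pq: "p \<in> S" "q \<in> S" "p \<noteq> q"
    by (auto simp: card_le_Suc0_iff_eq)
  have cross: "h q * h (m + p) - h p * h (m + q) = 0" for m
  proof -
    have "complex_of_real (h q * h (m + p) - h p * h (m + q)) = 0"
      unfolding of_real_diff of_real_mult r[of q] r[of "m+p"] r[of p] r[of "m+q"]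
      by (simp add: power_add)
    then show ?thesis by (simp only: of_real_eq_0_iff)
  qed
  have indep: "(\<forall>n\<in>S. c n = 0)" if "\<And>m. (\<Sum>n\<in>S. c n * H m n) = 0" for c
    using S(1) that by (auto simp: independent_columns_def)
  \<comment> \<open>The coefficients of a vanishing 2 \<times> 2 minor.\<close>
  define c where "c n = (if n = p then h q else 0) + (if n = q then - h p else 0)" for n
  have "(\<Sum>n\<in>S. c n * H m n) = h q * h (m + p) - h p * h (m + q)" for m
  proof -
    have "(\<Sum>n\<in>S. c n * H m n) = (\<Sum>n\<in>S. (if n = p then h q * h (m + p) else 0) + (if n = q then - h p * h (m + q) else 0))"
      by (intro sum.cong refl) (auto simp: c_def H pq)
    also have "\<dots> = h q * h (m + p) - h p * h (m + q)"
      using fin pq by (simp add: sum.distrib)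
    finally show ?thesis .
  qed
  with cross have "(\<Sum>n\<in>S. c n * H m n) = 0" for m by simp
  from indep[OF this] pq have "c q = 0" by blast
  then have hp: "h p = 0" using pq by (simp add: c_def)
  have "h (m + p) = 0" for m
  proof -
    have "complex_of_real (h (m + p)) = complex_of_real (h p) * r ^ m"
      unfolding r[of "m+p"] r[of p] by (simp add: power_add)
    then show ?thesis using hp by simp
  qed
  moreover have "(\<Sum>n\<in>S. (if n = p then 1 else 0) * H m n) = h (m + p)" for m
  proof -
    have "(\<Sum>n\<in>S. (if n = p then 1 else 0) * H m n) = (\<Sum>n\<in>S. if n = p then h (m + p) else 0)"
      by (intro sum.cong refl) (auto simp: H)
    then show ?thesis using fin pq by simp
  qed
  ultimately have "(\<Sum>n\<in>S. (if n = p then 1 else 0) * H m n) = 0" for m by simp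
  from indep[OF this] pq show False by auto
qed

text \<open>
  The entry (m,n) of HJ = JH for the Hankel matrix of h. The off-diagonal of J is
  shifted by one: y_0 = 0 and y_{n+1} = \<alpha>_n. Both sides involve only
  h_k, h_{k+1}, h_{k+2} with k = m + n - 1; the diagonal entry m = n = 0 is trivial.
\<close>

definition commuting :: "(nat \<Rightarrow> complex) \<Rightarrow> (nat \<Rightarrow> complex) \<Rightarrow> (nat \<Rightarrow> complex) \<Rightarrow> bool" where
  "commuting h y b \<longleftrightarrow> (\<forall>m n k. m + n = Suc k \<longrightarrow>
     (y n - y m) * h k + (b n - b m) * h (Suc k) + (y (Suc n) - y (Suc m)) * h (Suc (Suc k)) = 0)"

lemma commutingD:
  assumes "commuting h y b" "m + n = Suc k"
  shows "(y n - y m) * h k + (b n - b m) * h (Suc k) + (y (Suc n) - y (Suc m)) * h (Suc (Suc k)) = 0"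
  using assms unfolding commuting_def by blast

lemma mat_mult_jacobi_right:
  fixes M :: "nat \<Rightarrow> nat \<Rightarrow> complex"
  shows "mat_mult M (jacobi_matrix a b) m n =
     case_nat 0 (\<lambda>j. M m j * a j) n + M m n * b n + M m (Suc n) * a n"
proof -
  have "mat_mult M (jacobi_matrix a b) m n = (\<Sum>k\<in>{n-1, n, Suc n}. M m k * jacobi_matrix a b k n)"
    unfolding mat_mult_def by (intro suminf_finite) (auto simp: jacobi_matrix_def)
  then show ?thesis by (cases n) (simp_all add: jacobi_matrix_def)
qed

lemma mat_mult_jacobi_left:
  fixes M :: "nat \<Rightarrow> nat \<Rightarrow> complex"
  shows "mat_mult (jacobi_matrix a b) M m n =
     case_nat 0 (\<lambda>j. a j * M j n) m + b m * M m n + a m * M (Suc m) n"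
proof -
  have "mat_mult (jacobi_matrix a b) M m n = (\<Sum>k\<in>{m-1, m, Suc m}. jacobi_matrix a b m k * M k n)"
    unfolding mat_mult_def by (intro suminf_finite) (auto simp: jacobi_matrix_def)
  then show ?thesis by (cases m) (simp_all add: jacobi_matrix_def)
qed

lemma commuting_from_matrices:
  assumes H: "\<And>m n. H m n = h (m + n)"
    and comm: "mat_mult (complex_matrix H) (jacobi_matrix a b) =
               mat_mult (jacobi_matrix a b) (complex_matrix H)"
  shows "commuting (\<lambda>k. complex_of_real (h k)) (case_nat 0 a) b"
  unfolding commuting_def
proof (intro allI impI)
  fix m n k :: nat
  assume k: "m + n = Suc k"
  have "mat_mult (complex_matrix H) (jacobi_matrix a b) m n =
        mat_mult (jacobi_matrix a b) (complex_matrix H) m n"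
    by (simp add: comm)
  then show "(case_nat 0 a n - case_nat 0 a m) * complex_of_real (h k) +
       (b n - b m) * complex_of_real (h (Suc k)) +
       (case_nat 0 a (Suc n) - case_nat 0 a (Suc m)) * complex_of_real (h (Suc (Suc k))) = 0"
    unfolding mat_mult_jacobi_right mat_mult_jacobi_left complex_matrix_def H using k
    by (cases m; cases n) (auto simp: algebra_simps)
qed

text \<open>
  The relation with m = 0 reads y_{k+1} h_k = ... with a right-hand side in
  h_{k+1} and h_{k+2}, so two consecutive zeros propagate backwards, down to index one.
  Hence two consecutive zeros at arbitrarily large indices would leave only h_0. The value
  y_1 is exempted because the first off-diagonal entry comes from a formula that may
  read 0/0.
\<close>

lemma no_consecutive_zeros:
  assumes comm: "commuting h y b" and y0: "y 0 = 0" and ynz: "\<And>n. n \<ge> 2 \<Longrightarrow> y n \<noteq> 0"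
    and ng: "\<not> geometric h"
  shows "\<exists>K. \<forall>k\<ge>K. h k \<noteq> 0 \<or> h (Suc k) \<noteq> 0"
proof -
  have down: "h j = 0" if "1 \<le> j" "j \<le> k" "h k = 0" "h (Suc k) = 0" for j k
    using that
  proof (induction k)
    case 0
    then show ?case by simp
  next
    case (Suc k)
    show ?case
    proof (cases "j = Suc k")
      case True
      then show ?thesis using Suc.prems by simp
    next
      case False
      with Suc.prems have j: "j \<le> k" "k \<ge> 1" by auto
      have "y (Suc k) * h k = 0"
        using commutingD[OF comm, of 0 "Suc k" k] Suc.prems y0 by simp
      then have "h k = 0" using ynz[of "Suc k"] j by simp
      then show ?thesis using Suc.IH j Suc.prems by simp
    qed
  qed
  show ?thesis
  proof (rule ccontr)
    assume "\<not> ?thesis"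
    then have inf: "\<exists>k\<ge>K. h k = 0 \<and> h (Suc k) = 0" for K by blast
    have "h k = h 0 * 0 ^ k" for k
    proof (cases "k = 0")
      case False
      with inf[of k] down[of k] show ?thesis by auto
    qed simp
    with ng show False unfolding geometric_def by blast
  qed
qed

section \<open>Limits of normalised windows and vanishing minors\<close>

text \<open>
  A direction in which four consecutive entries h_k, ..., h_{k+3} accumulate. It satisfies
  the limit of every three-term relation, and, since a relation may be shifted by one index,
  also on its last three coordinates. The second copy replaces any
  Poincare-Perron type argument.
\<close>

definition limit_window :: "(nat \<Rightarrow> complex) \<Rightarrow> complex \<Rightarrow> complex \<Rightarrow> complex \<Rightarrow> complex \<Rightarrow> bool" where
  "limit_window h w0 w1 w2 w3 \<longleftrightarrow> \<not> (w0 = 0 \<and> w1 = 0 \<and> w2 = 0 \<and> w3 = 0) \<and>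
     (\<forall>c0 c1 c2 C0 C1 C2. c0 \<longlonglongrightarrow> C0 \<longrightarrow> c1 \<longlonglongrightarrow> C1 \<longrightarrow> c2 \<longlonglongrightarrow> C2 \<longrightarrow>
       (\<forall>\<^sub>F k in sequentially. c0 k * h k + c1 k * h (Suc k) + c2 k * h (Suc (Suc k)) = 0) \<longrightarrow>
       C0 * w0 + C1 * w1 + C2 * w2 = 0 \<and> C0 * w1 + C1 * w2 + C2 * w3 = 0)"

lemma limit_window_nonzero:
  "limit_window h w0 w1 w2 w3 \<Longrightarrow> \<not> (w0 = 0 \<and> w1 = 0 \<and> w2 = 0 \<and> w3 = 0)"
  unfolding limit_window_def by (rule conjunct1)

lemma limit_windowD:
  assumes "limit_window h w0 w1 w2 w3" "c0 \<longlonglongrightarrow> C0" "c1 \<longlonglongrightarrow> C1" "c2 \<longlonglongrightarrow> C2"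
    "\<forall>\<^sub>F k in sequentially. c0 k * h k + c1 k * h (Suc k) + c2 k * h (Suc (Suc k)) = 0"
  shows "C0 * w0 + C1 * w1 + C2 * w2 = 0 \<and> C0 * w1 + C1 * w2 + C2 * w3 = 0"
  using assms unfolding limit_window_def by blast

text \<open>
  Compactness of the unit sphere of complex 4-space, applied to the normalised windows.
\<close>

lemma limit_window_exists:
  fixes h :: "nat \<Rightarrow> complex"
  assumes nz: "\<And>k. k \<ge> K \<Longrightarrow> h k \<noteq> 0 \<or> h (Suc k) \<noteq> 0"
  shows "\<exists>w0 w1 w2 w3. limit_window h w0 w1 w2 w3"
proof -
  define v where "v k = (h k, h (Suc k), h (Suc (Suc k)), h (Suc (Suc (Suc k))))" for k
  define N where "N k = norm (v (k + K))" for k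
  have N: "N k \<noteq> 0" for k using nz[of "k + K"] by (auto simp: N_def v_def zero_prod_def)
  define u where "u k = v (k + K) /\<^sub>R N k" for k
  have "u k \<in> sphere 0 1" for k using N[of k] by (simp add: u_def N_def)
  then obtain w r where w: "w \<in> sphere 0 1" and r: "strict_mono (r :: nat \<Rightarrow> nat)"
    and lim: "(u \<circ> r) \<longlonglongrightarrow> w"
    using compact_sphere[of "0 :: complex \<times> complex \<times> complex \<times> complex" 1]
    unfolding compact_def by meson
  obtain w0 w1 w2 w3 where w_eq: "w = (w0, w1, w2, w3)" by (cases w rule: prod_cases4)
  define s where "s j = r j + K" for j
  have s: "filterlim s sequentially sequentially"
    unfolding s_def
    by (rule filterlim_compose[OF filterlim_add_const_nat_at_top filterlim_subseq[OF r]])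
  have u_eq: "u (r j) = (h (s j) /\<^sub>R N (r j), h (Suc (s j)) /\<^sub>R N (r j),
        h (Suc (Suc (s j))) /\<^sub>R N (r j), h (Suc (Suc (Suc (s j)))) /\<^sub>R N (r j))" for j
    by (simp add: u_def v_def s_def)
  have l0: "(\<lambda>j. h (s j) /\<^sub>R N (r j)) \<longlonglongrightarrow> w0"
    using tendsto_fst[OF lim] by (simp add: w_eq u_eq o_def)
  have l1: "(\<lambda>j. h (Suc (s j)) /\<^sub>R N (r j)) \<longlonglongrightarrow> w1"
    using tendsto_fst[OF tendsto_snd[OF lim]] by (simp add: w_eq u_eq o_def)
  have l2: "(\<lambda>j. h (Suc (Suc (s j))) /\<^sub>R N (r j)) \<longlonglongrightarrow> w2"
    using tendsto_fst[OF tendsto_snd[OF tendsto_snd[OF lim]]] by (simp add: w_eq u_eq o_def)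
  have l3: "(\<lambda>j. h (Suc (Suc (Suc (s j)))) /\<^sub>R N (r j)) \<longlonglongrightarrow> w3"
    using tendsto_snd[OF tendsto_snd[OF tendsto_snd[OF lim]]] by (simp add: w_eq u_eq o_def)
  have "limit_window h w0 w1 w2 w3"
    unfolding limit_window_def
  proof (intro conjI[of "\<not> _"] allI impI)
    show "\<not> (w0 = 0 \<and> w1 = 0 \<and> w2 = 0 \<and> w3 = 0)"
      using w by (auto simp: w_eq zero_prod_def[symmetric])
  next
    fix c0 c1 c2 :: "nat \<Rightarrow> complex" and C0 C1 C2
    assume c: "c0 \<longlonglongrightarrow> C0" "c1 \<longlonglongrightarrow> C1" "c2 \<longlonglongrightarrow> C2"
      and rel: "\<forall>\<^sub>F k in sequentially. c0 k * h k + c1 k * h (Suc k) + c2 k * h (Suc (Suc k)) = 0"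
    have s': "filterlim (\<lambda>j. Suc (s j)) sequentially sequentially"
      by (rule filterlim_compose[OF filterlim_Suc s])
    have "(\<lambda>j. c0 (s j) * (h (s j) /\<^sub>R N (r j)) + c1 (s j) * (h (Suc (s j)) /\<^sub>R N (r j))
            + c2 (s j) * (h (Suc (Suc (s j))) /\<^sub>R N (r j))) \<longlonglongrightarrow> C0 * w0 + C1 * w1 + C2 * w2"
      by (intro tendsto_add tendsto_mult l0 l1 l2 filterlim_compose[OF c(1) s]
          filterlim_compose[OF c(2) s] filterlim_compose[OF c(3) s])
    moreover have "\<forall>\<^sub>F j in sequentially. c0 (s j) * (h (s j) /\<^sub>R N (r j)) + c1 (s j) * (h (Suc (s j)) /\<^sub>R N (r j))
            + c2 (s j) * (h (Suc (Suc (s j))) /\<^sub>R N (r j)) = 0"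
      using eventually_compose_filterlim[OF rel s]
      by eventually_elim (simp only: mult_scaleR_right scaleR_add_right[symmetric] scaleR_zero_right)
    ultimately have 1: "C0 * w0 + C1 * w1 + C2 * w2 = 0"
      by (rule LIMSEQ_unique[OF _ tendsto_eventually])
    have "(\<lambda>j. c0 (Suc (s j)) * (h (Suc (s j)) /\<^sub>R N (r j)) + c1 (Suc (s j)) * (h (Suc (Suc (s j))) /\<^sub>R N (r j))
            + c2 (Suc (s j)) * (h (Suc (Suc (Suc (s j)))) /\<^sub>R N (r j))) \<longlonglongrightarrow> C0 * w1 + C1 * w2 + C2 * w3"
      by (intro tendsto_add tendsto_mult l3 l1 l2 filterlim_compose[OF c(1) s']
          filterlim_compose[OF c(2) s'] filterlim_compose[OF c(3) s'])
    moreover have "\<forall>\<^sub>F j in sequentially. c0 (Suc (s j)) * (h (Suc (s j)) /\<^sub>R N (r j)) + c1 (Suc (s j)) * (h (Suc (Suc (s j))) /\<^sub>R N (r j))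
            + c2 (Suc (s j)) * (h (Suc (Suc (Suc (s j)))) /\<^sub>R N (r j)) = 0"
      using eventually_compose_filterlim[OF rel s']
      by eventually_elim (simp only: mult_scaleR_right scaleR_add_right[symmetric] scaleR_zero_right)
    ultimately have 2: "C0 * w1 + C1 * w2 + C2 * w3 = 0"
      by (rule LIMSEQ_unique[OF _ tendsto_eventually])
    from 1 2 show "C0 * w0 + C1 * w1 + C2 * w2 = 0 \<and> C0 * w1 + C1 * w2 + C2 * w3 = 0" ..
  qed
  then show ?thesis by blast
qed

text \<open>
  A nonzero vector solving two homogeneous equations makes their determinant vanish. This
  holds exactly for infinitely many k, hence in the limit, with no knowledge of how
  the vector itself behaves.
\<close>

lemma limit_minor_eq_zero:
  fixes X Z :: "nat \<Rightarrow> complex"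
  assumes nz: "\<exists>\<^sub>F k in sequentially. X k \<noteq> 0 \<or> Z k \<noteq> 0"
    and P: "P \<longlonglongrightarrow> p" "P' \<longlonglongrightarrow> p'" and R: "R \<longlonglongrightarrow> r" "R' \<longlonglongrightarrow> r'"
    and eq: "\<forall>\<^sub>F k in sequentially. P k * X k + R k * Z k = 0"
    and eq': "\<forall>\<^sub>F k in sequentially. P' k * X k + R' k * Z k = 0"
  shows "p * r' = p' * r"
proof (rule ccontr)
  assume ne: "p * r' \<noteq> p' * r"
  have "(\<lambda>k. P k * R' k - P' k * R k) \<longlonglongrightarrow> p * r' - p' * r"
    by (intro tendsto_intros P R)
  then have "\<forall>\<^sub>F k in sequentially. P k * R' k - P' k * R k \<noteq> 0"
    using ne by (intro tendsto_imp_eventually_ne) auto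
  with eq eq' have "\<forall>\<^sub>F k in sequentially. \<not> (X k \<noteq> 0 \<or> Z k \<noteq> 0)"
  proof eventually_elim
    case (elim k)
    have "(P k * R' k - P' k * R k) * X k =
        R' k * (P k * X k + R k * Z k) - R k * (P' k * X k + R' k * Z k)"
      "(P k * R' k - P' k * R k) * Z k =
        P k * (P' k * X k + R' k * Z k) - P' k * (P k * X k + R k * Z k)"
      by (simp_all add: algebra_simps)
    then have "(P k * R' k - P' k * R k) * X k = 0 \<and> (P k * R' k - P' k * R k) * Z k = 0"
      unfolding elim(1,2) by simp
    with elim(3) show ?case unfolding mult_eq_0_iff by blast
  qed
  with nz show False by (simp add: frequently_def)
qed

section \<open>Sequences whose square is rational\<close>

lemma poly_times_geometric_tendsto_0:
  fixes p :: "complex poly"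
  assumes "norm \<theta> < 1"
  shows "(\<lambda>n. poly p (of_nat n) * \<theta> ^ n) \<longlonglongrightarrow> 0"
  using assms
proof (induction p arbitrary: \<theta>)
  case 0
  then show ?case by simp
next
  case (pCons a p)
  define \<psi> where "\<psi> = csqrt \<theta>"
  have psi: "\<psi> ^ 2 = \<theta>" by (simp add: \<psi>_def)
  have "norm \<psi> ^ 2 < 1" using pCons.prems psi by (metis norm_power)
  then have n: "norm \<psi> < 1" by (simp add: power_less_one_iff abs_square_less_1)
  have "(\<lambda>n. a * \<theta> ^ n + (of_nat n * \<psi> ^ n) * (poly p (of_nat n) * \<psi> ^ n)) \<longlonglongrightarrow> a * 0 + 0 * 0"
    by (intro tendsto_intros LIMSEQ_power_zero pCons.prems powser_times_n_limit_0 n pCons.IH)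
  moreover have "\<theta> ^ n = \<psi> ^ n * \<psi> ^ n" for n
    by (simp add: psi[symmetric] power_mult[symmetric] mult_2 power_add)
  ultimately show ?case by (simp add: algebra_simps)
qed

lemma poly_of_nat_tendsto_0:
  fixes p :: "complex poly"
  assumes "(\<lambda>n. poly p (of_nat n)) \<longlonglongrightarrow> 0"
  shows "p = 0"
  using assms
proof (induction p)
  case (pCons a p)
  have "(\<lambda>n. (poly (pCons a p) (of_nat n) - a) * inverse (of_nat n)) \<longlonglongrightarrow> (0 - a) * 0"
    by (intro tendsto_intros pCons.prems tendsto_inverse_0_at_top lim_inverse_n)
  moreover have "\<forall>\<^sub>F n in sequentially. (poly (pCons a p) (of_nat n) - a) * inverse (of_nat n) = poly p (of_nat n)"
    using eventually_gt_at_top[of 0] by eventually_elim (simp add: field_simps)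
  ultimately have "(\<lambda>n. poly p (of_nat n)) \<longlonglongrightarrow> (0 - a) * 0"
    by (rule Lim_transform_eventually)
  then have "(\<lambda>n. poly p (of_nat n)) \<longlonglongrightarrow> 0" by simp
  then have p: "p = 0" by (rule pCons.IH)
  with pCons.prems have "a = 0" by (simp add: LIMSEQ_const_iff)
  with p show ?case by simp
qed simp

text \<open>
  Rational functions of the index; the finitely many roots of the denominator are left out
  by the quantifier "eventually".
\<close>

definition rational_seq :: "(nat \<Rightarrow> complex) \<Rightarrow> bool" where
  "rational_seq x \<longleftrightarrow> (\<exists>N D. D \<noteq> 0 \<and>
     (\<forall>\<^sub>F n in sequentially. poly D (of_nat n) * x n = poly N (of_nat n)))"

lemma eventually_poly_neq_0:
  fixes D :: "complex poly"
  assumes "D \<noteq> 0"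
  shows "\<forall>\<^sub>F n in sequentially. poly D (of_nat n) \<noteq> 0"
proof -
  have "finite {n::nat. poly D (of_nat n) = 0}"
    using finite_vimageI[OF poly_roots_finite[OF assms] inj_of_nat]
    by (simp add: vimage_def)
  then obtain K where "\<forall>n\<in>{n::nat. poly D (of_nat n) = 0}. n \<le> K"
    using finite_nat_set_iff_bounded_le by blast
  then have "\<forall>n>K. poly D (of_nat n) \<noteq> 0" by force
  then show ?thesis unfolding eventually_at_top_dense by blast
qed

text \<open>
  If x = p + c \<theta>^n and D x^2 = N, then N - D p^2 = D (2 c p \<theta>^n + c^2 \<theta>^{2n})
  is a polynomial that decays exponentially, so it is zero; but then 2 p = - c \<theta>^n, and p
  itself is a decaying polynomial, which is impossible.
\<close>

lemma poly_plus_geometric_not_rational: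
  assumes rat: "rational_seq (\<lambda>n. (x n)\<^sup>2)"
    and x: "\<And>n. x n = poly p (of_nat n) + c * \<theta> ^ n"
    and c: "c \<noteq> 0" "\<theta> \<noteq> 0" "norm \<theta> < 1"
  shows False
proof -
  from rat obtain N D where D: "D \<noteq> 0"
    and ND: "\<forall>\<^sub>F n in sequentially. poly D (of_nat n) * (x n)\<^sup>2 = poly N (of_nat n)"
    unfolding rational_seq_def by blast
  have n2: "norm (\<theta>\<^sup>2) < 1" using c by (simp add: norm_power power_less_one_iff abs_square_less_1)
  have "(\<lambda>n. poly (smult (2 * c) (D * p)) (of_nat n) * \<theta> ^ n +
             poly (smult (c\<^sup>2) D) (of_nat n) * (\<theta>\<^sup>2) ^ n) \<longlonglongrightarrow> 0 + 0"
    by (intro tendsto_add poly_times_geometric_tendsto_0 c n2)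
  moreover have ev: "\<forall>\<^sub>F n in sequentially. poly (smult (2 * c) (D * p)) (of_nat n) * \<theta> ^ n +
             poly (smult (c\<^sup>2) D) (of_nat n) * (\<theta>\<^sup>2) ^ n = poly (N - D * p\<^sup>2) (of_nat n)"
    using ND
  proof eventually_elim
    case (elim n)
    have "(\<theta>\<^sup>2) ^ n = (\<theta> ^ n)\<^sup>2" by (simp add: power_mult[symmetric] mult.commute)
    then show ?case
      using elim[symmetric] by (simp add: x power2_eq_square algebra_simps)
  qed
  ultimately have "(\<lambda>n. poly (N - D * p\<^sup>2) (of_nat n)) \<longlonglongrightarrow> 0"
    by (simp add: tendsto_cong)
  then have z: "N - D * p\<^sup>2 = 0" by (rule poly_of_nat_tendsto_0)
  have p_eq: "\<forall>\<^sub>F n in sequentially. poly p (of_nat n) = - (c / 2) * \<theta> ^ n"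
    using ND eventually_poly_neq_0[OF D]
  proof eventually_elim
    case (elim n)
    have "poly D (of_nat n) * (x n)\<^sup>2 = poly D (of_nat n) * (poly p (of_nat n))\<^sup>2"
      using elim z by (simp add: algebra_simps)
    then have "(poly p (of_nat n) + c * \<theta> ^ n)\<^sup>2 = (poly p (of_nat n))\<^sup>2"
      using elim by (simp add: x)
    then have "(c * \<theta> ^ n) * (2 * poly p (of_nat n) + c * \<theta> ^ n) = 0"
      by (simp add: power2_eq_square algebra_simps)
    then have "2 * poly p (of_nat n) + c * \<theta> ^ n = 0" using c by simp
    then show ?case by (simp add: field_simps eq_neg_iff_add_eq_0)
  qed
  have "(\<lambda>n. - (c / 2) * \<theta> ^ n) \<longlonglongrightarrow> - (c / 2) * 0"
    by (intro tendsto_intros LIMSEQ_power_zero c)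
  then have "(\<lambda>n. poly p (of_nat n)) \<longlonglongrightarrow> 0"
    using p_eq by (simp add: tendsto_cong)
  then have "p = 0" by (rule poly_of_nat_tendsto_0)
  with p_eq c have "\<forall>\<^sub>F n in sequentially. False" by simp
  then show False by simp
qed

text \<open>
  Vanishing of all minors makes the sequence geometric, up to the case of ratio zero
  in which only the initial term survives.
\<close>

lemma vanishing_minors_cases:
  fixes \<eta> :: "nat \<Rightarrow> complex"
  assumes lim: "\<eta> \<longlonglongrightarrow> 0" and minors: "\<And>i j. \<eta> i * \<eta> (Suc j) = \<eta> j * \<eta> (Suc i)"
  shows "(\<forall>j\<ge>1. \<eta> j = 0) \<or> (\<exists>c \<theta>. c \<noteq> 0 \<and> \<theta> \<noteq> 0 \<and> norm \<theta> < 1 \<and> (\<forall>j. \<eta> j = c * \<theta> ^ j))"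
proof (cases "\<eta> 0 = 0")
  case True
  have "\<eta> j = 0" for j
  proof (induction j)
    case (Suc j)
    have "\<eta> (Suc j) * \<eta> (Suc j) = \<eta> j * \<eta> (Suc (Suc j))"
      using minors[of "Suc j" j] by simp
    then show ?case using Suc by simp
  qed (simp add: True)
  then show ?thesis by simp
next
  case False
  define \<theta> where "\<theta> = \<eta> 1 / \<eta> 0"
  have step: "\<eta> (Suc j) = \<eta> j * \<theta>" for j
    using minors[of 0 j] False by (simp add: \<theta>_def field_simps)
  have geo: "\<eta> j = \<eta> 0 * \<theta> ^ j" for j
    by (induction j) (simp_all add: step)
  show ?thesis
  proof (cases "\<theta> = 0")
    case True
    have "\<eta> j = 0" if "j \<ge> 1" for j
      using geo[of j] True that by simp
    then show ?thesis by blast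
  next
    case t0: False
    have "norm \<theta> < 1"
    proof (rule ccontr)
      assume "\<not> norm \<theta> < 1"
      then have "norm (\<eta> 0) \<le> norm (\<eta> j)" for j
      proof -
        have "1 \<le> norm \<theta> ^ j" using \<open>\<not> norm \<theta> < 1\<close> by (simp add: one_le_power)
        then have "norm (\<eta> 0) * 1 \<le> norm (\<eta> 0) * norm \<theta> ^ j" by (intro mult_left_mono) auto
        then show ?thesis by (simp add: geo[of j] norm_mult norm_power)
      qed
      with tendsto_lowerbound[OF tendsto_norm[OF lim], of "norm (\<eta> 0)"] False
      show False by simp
    qed
    with geo False t0 show ?thesis by blast
  qed
qed

lemma constant_second_difference:
  fixes x :: "nat \<Rightarrow> complex"
  assumes "\<And>n. x (Suc (Suc n)) - 2 * x (Suc n) + x n = 2 * l"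
  shows "x n = poly [:x 0, x 1 - x 0 - l, l:] (of_nat n)"
proof -
  define x0 where "x0 = x 0"
  define x1 where "x1 = x 1"
  have d: "x (Suc n) = x n + (x1 - x0 + 2 * l * of_nat n)" for n
  proof (induction n)
    case (Suc n)
    have "x (Suc (Suc n)) = x (Suc n) + (x (Suc n) - x n) + 2 * l"
      unfolding assms[of n, symmetric] by (simp add: algebra_simps)
    also have "x (Suc n) - x n = x1 - x0 + 2 * l * of_nat n"
      by (simp add: Suc)
    finally show ?case by (simp add: algebra_simps)
  qed (simp add: x0_def x1_def)
  have "x n = poly [:x0, x1 - x0 - l, l:] (of_nat n)"
  proof (induction n)
    case (Suc n)
    then show ?case by (subst d) (simp add: algebra_simps)
  qed (simp add: x0_def)
  then show ?thesis by (simp only: x0_def x1_def)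
qed

text \<open>
  A geometric second difference (up to a constant) integrates to a quadratic
  polynomial plus a geometric sequence, and the square of that is not rational. The index n = 0
  is excluded since the initial term of the second difference is not controlled.
\<close>

lemma second_difference_rigid:
  fixes y :: "nat \<Rightarrow> complex" and l
  defines "\<eta> \<equiv> \<lambda>j. y (Suc (Suc j)) - 2 * y (Suc j) + y j - 2 * l"
  assumes rat: "rational_seq (\<lambda>n. (y n)\<^sup>2)"
    and lim: "\<eta> \<longlonglongrightarrow> 0" and minors: "\<And>i j. \<eta> i * \<eta> (Suc j) = \<eta> j * \<eta> (Suc i)"
  shows "\<exists>u v. \<forall>n\<ge>1. y n = l * (of_nat n)\<^sup>2 + u * of_nat n + v"
  using vanishing_minors_cases[OF lim minors]
proof
  assume z: "\<forall>j\<ge>1. \<eta> j = 0"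
  define x where "x n = y (Suc n)" for n
  have "x (Suc (Suc n)) - 2 * x (Suc n) + x n = 2 * l" for n
    using z[rule_format, of "Suc n"] by (simp add: \<eta>_def x_def)
  from constant_second_difference[of x l, OF this]
  have x: "x n = poly [:x 0, x 1 - x 0 - l, l:] (of_nat n)" for n .
  have "y n = l * (of_nat n)\<^sup>2 + (x 1 - x 0 - 3 * l) * of_nat n + (2 * x 0 - x 1 + 2 * l)"
    if "n \<ge> 1" for n
  proof -
    have "y n = x (n - 1)" using that by (simp add: x_def)
    also have "\<dots> = poly [:x 0, x 1 - x 0 - l, l:] (of_nat n - 1)"
      using that by (subst x) (simp add: of_nat_diff)
    finally show ?thesis by (simp add: power2_eq_square algebra_simps)
  qed
  then show ?thesis by blast
next
  assume "\<exists>c \<theta>. c \<noteq> 0 \<and> \<theta> \<noteq> 0 \<and> norm \<theta> < 1 \<and> (\<forall>j. \<eta> j = c * \<theta> ^ j)"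
  then obtain c \<theta> where c: "c \<noteq> 0" "\<theta> \<noteq> 0" "norm \<theta> < 1" and eta: "\<And>j. \<eta> j = c * \<theta> ^ j"
    by blast
  from c have t1: "\<theta> \<noteq> 1" by auto
  \<comment> \<open>The second difference of \<theta>^n is (\<theta> - 1)^2 \<theta>^n.\<close>
  define c' where "c' = c / (\<theta> - 1)\<^sup>2"
  have c': "c' * (\<theta> - 1)\<^sup>2 = c" "c' \<noteq> 0" using t1 c by (simp_all add: c'_def)
  define x where "x n = y n - c' * \<theta> ^ n" for n
  have "x (Suc (Suc n)) - 2 * x (Suc n) + x n = 2 * l" for n
  proof -
    have "x (Suc (Suc n)) - 2 * x (Suc n) + x n = \<eta> n + 2 * l - (c' * (\<theta> - 1)\<^sup>2) * \<theta> ^ n"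
      by (simp add: x_def \<eta>_def power2_eq_square algebra_simps)
    then show ?thesis by (simp add: eta c')
  qed
  note x = constant_second_difference[of x l, OF this]
  have "y n = poly [:x 0, x 1 - x 0 - l, l:] (of_nat n) + c' * \<theta> ^ n" for n
  proof -
    have "y n = x n + c' * \<theta> ^ n" by (simp add: x_def)
    also have "x n = poly [:x 0, x 1 - x 0 - l, l:] (of_nat n)" by (rule x)
    finally show ?thesis .
  qed
  from poly_plus_geometric_not_rational[OF rat this c'(2) c(2,3)] show ?thesis ..
qed

section \<open>Exchange relations\<close>

text \<open>
  The combination h_{k+1} - r h_k is multiplied by s in each step. It tends to zero and
  does not shrink, so it vanishes.
\<close>

lemma two_term_recurrence_geometric:
  fixes h :: "nat \<Rightarrow> complex"
  assumes rec: "\<And>k. h (Suc (Suc k)) = (r + s) * h (Suc k) - r * s * h k"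
    and s: "norm s \<ge> 1" and lim: "h \<longlonglongrightarrow> 0"
  shows "geometric h"
proof -
  define g where "g k = h (Suc k) - r * h k" for k
  have "g (Suc k) = s * g k" for k
    by (simp add: g_def rec algebra_simps)
  then have g: "g k = s ^ k * g 0" for k
    by (induction k) simp_all
  have "(\<lambda>k. h (Suc k) - r * h k) \<longlonglongrightarrow> 0 - r * 0"
    by (intro tendsto_intros lim LIMSEQ_Suc)
  then have g0: "g \<longlonglongrightarrow> 0" by (simp add: g_def[abs_def])
  have "norm (g 0) \<le> norm (g k)" for k
  proof -
    have "1 * norm (g 0) \<le> norm s ^ k * norm (g 0)"
      by (intro mult_right_mono one_le_power s) auto
    then show ?thesis by (subst (2) g) (simp add: norm_mult norm_power)
  qed
  then have "norm (g 0) \<le> 0"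
    using tendsto_lowerbound[OF tendsto_norm_zero[OF g0], of "norm (g 0)"] by simp
  then have gz: "g k = 0" for k by (subst g) simp
  have "h k = h 0 * r ^ k" for k
  proof (induction k)
    case (Suc k)
    then show ?case using gz[of k] by (simp add: g_def)
  qed simp
  then show ?thesis unfolding geometric_def by blast
qed

definition second_diff :: "(nat \<Rightarrow> complex) \<Rightarrow> nat \<Rightarrow> complex" where
  "second_diff g j = g (Suc (Suc j)) - 2 * g (Suc j) + g j"

text \<open>
  The two indices enter a relation only through differences g_n - g_m with m + n fixed.
  Along such an antidiagonal the second difference in m acts on both indices with the
  same sign.
\<close>

lemma exchange_second_difference:
  assumes ex: "\<And>m n k. m + n = Suc k \<Longrightarrow>
      (g n - g m) * X k + (b n - b m) * Y k + (g (Suc n) - g (Suc m)) * Z k = 0"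
    and "m < k"
  shows "(second_diff g (k - Suc m) - second_diff g m) * X k + (second_diff b (k - Suc m) - second_diff b m) * Y k
    + (second_diff g (k - m) - second_diff g (Suc m)) * Z k = 0"
proof -
  from \<open>m < k\<close> obtain n where k: "k = Suc (m + n)" using less_iff_Suc_add by auto
  have "(second_diff g n - second_diff g m) * X k + (second_diff b n - second_diff b m) * Y k + (second_diff g (Suc n) - second_diff g (Suc m)) * Z k =
     ((g (Suc (Suc n)) - g m) * X k + (b (Suc (Suc n)) - b m) * Y k + (g (Suc (Suc (Suc n))) - g (Suc m)) * Z k)
   - 2 * ((g (Suc n) - g (Suc m)) * X k + (b (Suc n) - b (Suc m)) * Y k + (g (Suc (Suc n)) - g (Suc (Suc m))) * Z k)
   + ((g n - g (Suc (Suc m))) * X k + (b n - b (Suc (Suc m))) * Y k + (g (Suc n) - g (Suc (Suc (Suc m)))) * Z k)"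
    by (simp add: second_diff_def algebra_simps)
  also have "\<dots> = 0"
    using ex[of m "Suc (Suc n)" k] ex[of "Suc m" "Suc n" k] ex[of "Suc (Suc m)" n k] by (simp add: k)
  finally show ?thesis by (simp add: k)
qed

text \<open>
  As k grows with m fixed, the terms at the far index tend to their limits, and only the
  deviations of the second differences at m and m + 1 remain. The minors of these deviations
  vanish, since the same pair (X_k, Z_k) serves every m.
\<close>

lemma exchange_rigid:
  assumes ex: "\<And>m n k. m + n = Suc k \<Longrightarrow>
      (g n - g m) * X k + (b n - b m) * Y k + (g (Suc n) - g (Suc m)) * Z k = 0"
    and b: "\<And>j. second_diff b j = 0"
    and nz: "\<exists>\<^sub>F k in sequentially. X k \<noteq> 0 \<or> Z k \<noteq> 0"
    and rat: "rational_seq (\<lambda>n. (g n)\<^sup>2)"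
    and lim: "second_diff g \<longlonglongrightarrow> 2 * l"
  shows "\<exists>u v. \<forall>n\<ge>1. g n = l * (of_nat n)\<^sup>2 + u * of_nat n + v"
proof (rule second_difference_rigid[OF rat])
  have eq: "\<forall>\<^sub>F k in sequentially. (second_diff g (k - Suc m) - second_diff g m) * X k + (second_diff g (k - m) - second_diff g (Suc m)) * Z k = 0" for m
    using eventually_gt_at_top[of m]
  proof eventually_elim
    case (elim k)
    from exchange_second_difference[of g X b Y Z, OF ex elim] show ?case by (simp add: b)
  qed
  have lim': "(\<lambda>k. second_diff g (k - m) - c) \<longlonglongrightarrow> 2 * l - c" for m c
    by (intro tendsto_intros filterlim_compose[OF lim filterlim_minus_const_nat_at_top])
  have minor: "(2 * l - second_diff g i) * (2 * l - second_diff g (Suc j)) = (2 * l - second_diff g j) * (2 * l - second_diff g (Suc i))" for i j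
    by (rule limit_minor_eq_zero[OF nz lim' lim' lim' lim' eq eq])
  show "(g (Suc (Suc i)) - 2 * g (Suc i) + g i - 2 * l) * (g (Suc (Suc (Suc j))) - 2 * g (Suc (Suc j)) + g (Suc j) - 2 * l) =
      (g (Suc (Suc j)) - 2 * g (Suc j) + g j - 2 * l) * (g (Suc (Suc (Suc i))) - 2 * g (Suc (Suc i)) + g (Suc i) - 2 * l)" for i j
    unfolding second_diff_def[symmetric] using minor[of i j] by (simp add: algebra_simps)
  have "(\<lambda>j. second_diff g j - 2 * l) \<longlonglongrightarrow> 2 * l - 2 * l" by (intro tendsto_intros lim)
  then show "(\<lambda>j. g (Suc (Suc j)) - 2 * g (Suc j) + g j - 2 * l) \<longlonglongrightarrow> 0"
    by (simp add: second_diff_def[abs_def])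
qed

lemma convergent_rigid:
  assumes rat: "rational_seq (\<lambda>n. (g n)\<^sup>2)" and lim: "g \<longlonglongrightarrow> l"
    and minors: "\<And>i j. (g i - l) * (g (Suc j) - l) = (g j - l) * (g (Suc i) - l)"
    and n: "n \<ge> 1"
  shows "g n = l"
proof -
  have "(\<lambda>j. g j - l) \<longlonglongrightarrow> l - l" by (intro tendsto_intros lim)
  then have "(\<lambda>j. g j - l) \<longlonglongrightarrow> 0" by simp
  from vanishing_minors_cases[OF this minors]
  show ?thesis
  proof
    assume "\<forall>j\<ge>1. g j - l = 0"
    then show ?thesis using n by simp
  next
    assume "\<exists>c \<theta>. c \<noteq> 0 \<and> \<theta> \<noteq> 0 \<and> norm \<theta> < 1 \<and> (\<forall>j. g j - l = c * \<theta> ^ j)"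
    then obtain c \<theta> where c: "c \<noteq> 0" "\<theta> \<noteq> 0" "norm \<theta> < 1" and eq: "\<And>j. g j - l = c * \<theta> ^ j"
      by blast
    have "g j = poly [:l:] (of_nat j) + c * \<theta> ^ j" for j
      using eq[of j] by (simp add: algebra_simps)
    from poly_plus_geometric_not_rational[OF rat this c] show ?thesis ..
  qed
qed

lemma rational_seq_quadratic:
  assumes "\<And>n. x n = A * (of_nat n)\<^sup>2 + B * of_nat n"
  shows "rational_seq x"
  unfolding rational_seq_def
  by (rule exI[of _ "[:0, B, A:]"], rule exI[of _ 1])
    (simp add: assms power2_eq_square algebra_simps)

lemma frequently_nonzero:
  assumes nz: "\<And>k. k \<ge> K \<Longrightarrow> h k \<noteq> 0 \<or> h (Suc k) \<noteq> (0::complex)"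
  shows "\<exists>\<^sub>F k in sequentially. h k \<noteq> 0 \<or> h (Suc (Suc k)) \<noteq> 0"
  unfolding frequently_sequentially
proof
  fix m
  show "\<exists>k\<ge>m. h k \<noteq> 0 \<or> h (Suc (Suc k)) \<noteq> 0"
  proof (rule ccontr)
    assume "\<not> ?thesis"
    then have "h (m + K) = 0" "h (Suc (m + K)) = 0" by auto
    with nz[of "m + K"] show False by simp
  qed
qed

section \<open>Affine and bounded diagonals\<close>

text \<open>
  The second difference removes an affine diagonal, so the off-diagonal is rigid: it is
  affine from index one on. Comparing squares at three indices then leaves y_n = p n.
\<close>

lemma affine_diagonal:
  assumes comm: "commuting h y b" and y0: "y 0 = 0" and ynz: "\<And>n. n \<ge> 2 \<Longrightarrow> y n \<noteq> 0"
    and ng: "\<not> geometric h"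
    and b: "\<And>n. b n = \<mu> * of_nat n + c"
    and y2: "\<And>n. (y n)\<^sup>2 = A * (of_nat n)\<^sup>2 + B * of_nat n"
    and lim: "second_diff y \<longlonglongrightarrow> 0"
  shows "B = 0" "\<exists>p. p\<^sup>2 = A \<and> (\<forall>n. y n = p * of_nat n)"
proof -
  from no_consecutive_zeros[of h y b, OF comm y0 ynz ng]
  obtain K where K: "\<And>k. k \<ge> K \<Longrightarrow> h k \<noteq> 0 \<or> h (Suc k) \<noteq> 0" by blast
  have "\<exists>u v. \<forall>n\<ge>1. y n = 0 * (of_nat n)\<^sup>2 + u * of_nat n + v"
  proof (rule exchange_rigid[where X = h and Y = "\<lambda>k. h (Suc k)" and Z = "\<lambda>k. h (Suc (Suc k))" and b = b])
    show "(y n - y m) * h k + (b n - b m) * h (Suc k) + (y (Suc n) - y (Suc m)) * h (Suc (Suc k)) = 0"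
      if "m + n = Suc k" for m n k using commutingD[OF comm that] .
    show "second_diff b j = 0" for j by (simp add: second_diff_def b algebra_simps)
    show "\<exists>\<^sub>F k in sequentially. h k \<noteq> 0 \<or> h (Suc (Suc k)) \<noteq> 0"
      using K by (rule frequently_nonzero)
    show "rational_seq (\<lambda>n. (y n)\<^sup>2)" using y2 by (rule rational_seq_quadratic)
    show "second_diff y \<longlonglongrightarrow> 2 * 0" using lim by simp
  qed
  then obtain u v where uv: "\<And>n. n \<ge> 1 \<Longrightarrow> y n = u * of_nat n + v" by auto
  have 1: "(u + v)\<^sup>2 = A + B" using y2[of 1] uv[of 1] by simp
  have 2: "(2 * u + v)\<^sup>2 = 4 * A + 2 * B" using y2[of 2] uv[of 2] by (simp add: algebra_simps)
  have 3: "(3 * u + v)\<^sup>2 = 9 * A + 3 * B" using y2[of 3] uv[of 3] by (simp add: algebra_simps)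
  \<comment> \<open>The square is a quadratic polynomial for n \<ge> 1; extrapolation from three values to n = 0.\<close>
  have "v\<^sup>2 = 3 * (u + v)\<^sup>2 - 3 * (2 * u + v)\<^sup>2 + (3 * u + v)\<^sup>2"
    by (simp add: power2_eq_square algebra_simps)
  also have "\<dots> = 0" unfolding 1 2 3 by simp
  finally have v: "v = 0" by simp
  have "2 * B = 4 * (u + v)\<^sup>2 - (2 * u + v)\<^sup>2" unfolding 1 2 by simp
  then show B: "B = 0" using v by (simp add: power2_eq_square)
  have "y n = u * of_nat n" for n using uv[of n] v y0 by (cases n) auto
  then show "\<exists>p. p\<^sup>2 = A \<and> (\<forall>n. y n = p * of_nat n)"
    using 1 v B by auto
qed

lemma linear_offdiagonal_recurrence:
  assumes comm: "commuting h y b" and y: "\<And>n. y n = p * of_nat n"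
    and b: "\<And>n. b n = \<mu> * of_nat n + c"
  shows "p * h (Suc (Suc k)) = - \<mu> * h (Suc k) - p * h k"
proof -
  have "of_nat (Suc k) * (p * h (Suc (Suc k)) + \<mu> * h (Suc k) + p * h k) = 0"
    using commutingD[OF comm, of 0 "Suc k" k] by (simp add: y b algebra_simps)
  then have "p * h (Suc (Suc k)) + \<mu> * h (Suc k) + p * h k = 0"
    by (simp only: mult_eq_0_iff of_nat_eq_0_iff) simp
  then show ?thesis by (simp add: algebra_simps eq_neg_iff_add_eq_0)
qed

text \<open>
  For off-diagonal entries of linear growth and a convergent diagonal the limit window has the
  form (w_0, w_1, -w_0, -w_1). Substituting it into the first differences of the relations gives a
  2 \<times> 2 system with determinant (\<Delta>^2 y)^2 + (\<Delta> b)^2. For real entries this forces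
  constant coefficients, and the recurrence h_{k+2} = - h_k has no nonzero null solution.
\<close>

lemma bounded_diagonal:
  fixes Y \<beta> H :: "nat \<Rightarrow> real"
  defines "h \<equiv> \<lambda>k. complex_of_real (H k)"
    and "y \<equiv> \<lambda>k. complex_of_real (Y k)" and "b \<equiv> \<lambda>k. complex_of_real (\<beta> k)"
  assumes comm: "commuting h y b" and y0: "Y 0 = 0"
    and nz: "\<And>k. k \<ge> K \<Longrightarrow> h k \<noteq> 0 \<or> h (Suc k) \<noteq> 0"
    and ng: "\<not> geometric h" and h0: "h \<longlonglongrightarrow> 0"
    and Y: "(\<lambda>n. Y n - l * real n) \<longlonglongrightarrow> q" and l: "l \<noteq> 0" and \<beta>: "\<beta> \<longlonglongrightarrow> \<beta>'"
  shows False
proof -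
  obtain w0 w1 w2 w3 where win: "limit_window h w0 w1 w2 w3"
    using limit_window_exists[of K h, OF nz] by blast
  note wnz = limit_window_nonzero[OF win] and w = limit_windowD[OF win]
  have y: "(\<lambda>n. y n - of_real l * of_nat n) \<longlonglongrightarrow> of_real q"
    using tendsto_of_real[OF Y, where 'a = complex] by (simp add: y_def)
  have b: "b \<longlonglongrightarrow> of_real \<beta>'" unfolding b_def by (intro tendsto_of_real \<beta>)
  have inv: "(\<lambda>n. inverse (of_nat (Suc n)) :: complex) \<longlonglongrightarrow> 0"
    by (rule LIMSEQ_Suc[OF lim_inverse_n])
  have yn: "(\<lambda>k. y (Suc k) * inverse (of_nat (Suc k))) \<longlonglongrightarrow> of_real l"
  proof -
    have "(\<lambda>k. (y (Suc k) - of_real l * of_nat (Suc k)) * inverse (of_nat (Suc k)) + of_real l)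
        \<longlonglongrightarrow> of_real q * 0 + of_real l"
      by (intro tendsto_add tendsto_mult tendsto_const inv LIMSEQ_Suc[OF y])
    moreover have "(y (Suc k) - of_real l * of_nat (Suc k)) * inverse (of_nat (Suc k)) + of_real l
        = y (Suc k) * inverse (of_nat (Suc k))" for k
      by (simp add: left_diff_distrib del: of_nat_Suc)
    ultimately show ?thesis by simp
  qed
  have dy: "(\<lambda>n. y (Suc n) - y n) \<longlonglongrightarrow> of_real l"
  proof -
    have "(\<lambda>n. (y (Suc n) - of_real l * of_nat (Suc n)) - (y n - of_real l * of_nat n) + of_real l)
      \<longlonglongrightarrow> of_real q - of_real q + of_real l"
      by (rule tendsto_add[OF tendsto_diff[OF LIMSEQ_Suc[OF y] y] tendsto_const])
    then show ?thesis by (simp add: algebra_simps)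
  qed
  have yn2: "(\<lambda>k. y (Suc (Suc k)) * inverse (of_nat (Suc k))) \<longlonglongrightarrow> of_real l"
    using tendsto_add[OF tendsto_mult[OF LIMSEQ_Suc[OF dy] inv] yn]
    by (simp add: left_diff_distrib del: of_nat_Suc)
  have u: "w0 + w2 = 0 \<and> w1 + w3 = 0"
  proof -
    have "of_real l * w0 + 0 * w1 + of_real l * w2 = 0 \<and> of_real l * w1 + 0 * w2 + of_real l * w3 = 0"
    proof (rule w[where ?c0.0 = "\<lambda>k. y (Suc k) * inverse (of_nat (Suc k))"
          and ?c1.0 = "\<lambda>k. (b (Suc k) - b 0) * inverse (of_nat (Suc k))"
          and ?c2.0 = "\<lambda>k. y (Suc (Suc k)) * inverse (of_nat (Suc k)) - y 1 * inverse (of_nat (Suc k))"])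
      show "(\<lambda>k. (b (Suc k) - b 0) * inverse (of_nat (Suc k))) \<longlonglongrightarrow> 0"
        using tendsto_mult[OF tendsto_diff[OF LIMSEQ_Suc[OF b] tendsto_const] inv] by simp
      show "(\<lambda>k. y (Suc (Suc k)) * inverse (of_nat (Suc k)) - y 1 * inverse (of_nat (Suc k))) \<longlonglongrightarrow> of_real l"
        using tendsto_diff[OF yn2 tendsto_mult[OF tendsto_const inv, of "y 1"]] by simp
      show "\<forall>\<^sub>F k in sequentially. y (Suc k) * inverse (of_nat (Suc k)) * h k
          + (b (Suc k) - b 0) * inverse (of_nat (Suc k)) * h (Suc k)
          + (y (Suc (Suc k)) * inverse (of_nat (Suc k)) - y 1 * inverse (of_nat (Suc k))) * h (Suc (Suc k)) = 0"
      proof (rule always_eventually, rule allI)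
        fix k
        have "inverse (of_nat (Suc k)) * ((y (Suc k) - y 0) * h k + (b (Suc k) - b 0) * h (Suc k)
            + (y (Suc (Suc k)) - y (Suc 0)) * h (Suc (Suc k))) = 0"
          using commutingD[OF comm, of 0 "Suc k" k] by simp
        then show "y (Suc k) * inverse (of_nat (Suc k)) * h k
          + (b (Suc k) - b 0) * inverse (of_nat (Suc k)) * h (Suc k)
          + (y (Suc (Suc k)) * inverse (of_nat (Suc k)) - y 1 * inverse (of_nat (Suc k))) * h (Suc (Suc k)) = 0"
          by (simp add: y_def y0 algebra_simps del: of_nat_Suc)
      qed
    qed (rule yn)
    then show ?thesis using l by (simp flip: distrib_left)
  qed
  have db: "(\<lambda>n. b (Suc n) - b n) \<longlonglongrightarrow> 0"
    using tendsto_diff[OF LIMSEQ_Suc[OF b] b] by simp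
  have key: "second_diff y m = 0 \<and> b (Suc m) = b m" for m
  proof -
    have "(of_real l + (y (Suc m) - y m)) * w0 + (0 + (b (Suc m) - b m)) * w1
        + (of_real l + (y (Suc (Suc m)) - y (Suc m))) * w2 = 0 \<and>
       (of_real l + (y (Suc m) - y m)) * w1 + (0 + (b (Suc m) - b m)) * w2
        + (of_real l + (y (Suc (Suc m)) - y (Suc m))) * w3 = 0"
    proof (rule w[where ?c0.0 = "\<lambda>k. (y (Suc (k - m)) - y (k - m)) + (y (Suc m) - y m)"
          and ?c1.0 = "\<lambda>k. (b (Suc (k - m)) - b (k - m)) + (b (Suc m) - b m)"
          and ?c2.0 = "\<lambda>k. (y (Suc (Suc (k - m))) - y (Suc (k - m))) + (y (Suc (Suc m)) - y (Suc m))"])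
      show "\<forall>\<^sub>F k in sequentially.
         (y (Suc (k - m)) - y (k - m) + (y (Suc m) - y m)) * h k +
         (b (Suc (k - m)) - b (k - m) + (b (Suc m) - b m)) * h (Suc k) +
         (y (Suc (Suc (k - m))) - y (Suc (k - m)) + (y (Suc (Suc m)) - y (Suc m))) * h (Suc (Suc k)) = 0"
        using eventually_ge_at_top[of m]
      proof eventually_elim
        case (elim k)
        then have 1: "m + Suc (k - m) = Suc k" "Suc m + (k - m) = Suc k" by simp_all
        from commutingD[OF comm 1(1)] commutingD[OF comm 1(2)]
        show ?case by (simp add: algebra_simps)
      qed
    qed (intro tendsto_add tendsto_const filterlim_compose[OF dy filterlim_minus_const_nat_at_top]
        filterlim_compose[OF db filterlim_minus_const_nat_at_top]
        filterlim_compose[OF LIMSEQ_Suc[OF dy] filterlim_minus_const_nat_at_top])+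
    moreover from u have "w0 = - w2" "w3 = - w1" by (simp_all add: eq_neg_iff_add_eq_0 add.commute)
    ultimately have e1: "second_diff y m * w2 + (b (Suc m) - b m) * w1 = 0"
      and e2: "- second_diff y m * w1 + (b (Suc m) - b m) * w2 = 0"
      by (simp_all add: second_diff_def algebra_simps)
    define P where "P = Y (Suc (Suc m)) - 2 * Y (Suc m) + Y m"
    define Q where "Q = \<beta> (Suc m) - \<beta> m"
    have PQ: "second_diff y m = of_real P" "b (Suc m) - b m = of_real Q"
      by (simp_all add: second_diff_def y_def b_def P_def Q_def)
    have "(second_diff y m * second_diff y m + (b (Suc m) - b m) * (b (Suc m) - b m)) * w1 =
       (b (Suc m) - b m) * (second_diff y m * w2 + (b (Suc m) - b m) * w1)
       - second_diff y m * (- second_diff y m * w1 + (b (Suc m) - b m) * w2)"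
      "(second_diff y m * second_diff y m + (b (Suc m) - b m) * (b (Suc m) - b m)) * w2 =
       second_diff y m * (second_diff y m * w2 + (b (Suc m) - b m) * w1)
       + (b (Suc m) - b m) * (- second_diff y m * w1 + (b (Suc m) - b m) * w2)"
      by (simp_all add: algebra_simps)
    then have "(of_real (P * P + Q * Q) :: complex) * w1 = 0" "(of_real (P * P + Q * Q) :: complex) * w2 = 0"
      unfolding e1 e2 unfolding PQ by simp_all
    moreover have "w1 \<noteq> 0 \<or> w2 \<noteq> 0"
      using wnz \<open>w0 = - w2\<close> \<open>w3 = - w1\<close> by auto
    ultimately have "(of_real (P * P + Q * Q) :: complex) = 0" by (auto simp only: mult_eq_0_iff)
    then have "P * P + Q * Q = 0" by (simp only: of_real_eq_0_iff)
    then have "P = 0" "Q = 0" by (simp_all add: sum_squares_eq_zero_iff)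
    then show ?thesis using PQ by simp
  qed
  have y_lin: "y n = poly [:y 0, y 1 - y 0 - 0, 0:] (of_nat n)" for n
    using key by (intro constant_second_difference) (simp add: second_diff_def)
  have y_lin: "y n = y 1 * of_nat n" for n
    using y_lin[of n] y0 by (simp add: y_def mult.commute)
  have b_const: "b n = 0 * of_nat n + b 0" for n
    by (induction n) (simp_all add: key)
  have "y 1 \<noteq> 0"
  proof
    assume "y 1 = 0"
    then have "y n = 0" for n using y_lin[of n] by simp
    with dy have "(\<lambda>n::nat. 0 :: complex) \<longlonglongrightarrow> of_real l" by simp
    then show False using l by (simp add: LIMSEQ_const_iff)
  qed
  have rec: "h (Suc (Suc k)) = - h k" for k
  proof -
    have "y 1 * (h (Suc (Suc k)) + h k) = 0"
      using linear_offdiagonal_recurrence[OF comm y_lin b_const, of k] by (simp add: distrib_left)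
    with \<open>y 1 \<noteq> 0\<close> show ?thesis by (simp add: eq_neg_iff_add_eq_0)
  qed
  have "geometric h"
    by (rule two_term_recurrence_geometric[where r = "\<i>" and s = "-\<i>"]) (simp_all add: rec h0)
  with ng show False ..
qed

section \<open>Off-diagonal entries of quadratic growth\<close>

lemma tendsto_second_diff:
  assumes "g \<longlonglongrightarrow> l"
  shows "second_diff g \<longlonglongrightarrow> 0"
proof -
  note 1 = LIMSEQ_Suc[OF assms]
  note 2 = LIMSEQ_Suc[OF 1]
  have "(\<lambda>j. g (Suc (Suc j)) - 2 * g (Suc j) + g j) \<longlonglongrightarrow> l - 2 * l + l"
    by (rule tendsto_add[OF tendsto_diff[OF 2 tendsto_mult[OF tendsto_const 1]] assms])
  then show ?thesis by (simp add: second_diff_def[abs_def])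
qed

lemma affine_convergent_constant:
  fixes e :: "nat \<Rightarrow> complex"
  assumes "\<And>n. second_diff e n = 0" and lim: "e \<longlonglongrightarrow> s"
  shows "e n = s"
proof -
  have "e (Suc (Suc n)) - 2 * e (Suc n) + e n = 2 * 0" for n
    using assms(1)[of n] by (simp add: second_diff_def)
  note e = constant_second_difference[of e 0, OF this]
  have "(\<lambda>n. e n - s) \<longlonglongrightarrow> s - s" by (intro tendsto_intros lim)
  moreover have "e n - s = poly ([:e 0, e 1 - e 0 - 0, 0:] - [:s:]) (of_nat n)" for n
    unfolding poly_diff e[of n, symmetric] by simp
  ultimately have "(\<lambda>n. poly ([:e 0, e 1 - e 0 - 0, 0:] - [:s:]) (of_nat n)) \<longlonglongrightarrow> 0"
    by (simp only: diff_self)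
  then have "[:e 0, e 1 - e 0 - 0, 0:] - [:s:] = 0" by (rule poly_of_nat_tendsto_0)
  then have "e 0 = s" "e 1 = e 0" by (simp_all del: One_nat_def)
  then show ?thesis using e[of n] by simp
qed

lemma backward_zeros:
  fixes f :: "nat \<Rightarrow> complex"
  assumes down: "\<And>k. k \<ge> 1 \<Longrightarrow> f (Suc k) = 0 \<Longrightarrow> f k = 0"
    and nz: "j \<ge> 1" "f j \<noteq> 0"
  shows "k \<ge> j \<Longrightarrow> f k \<noteq> 0"
proof (induction k rule: dec_induct)
  case base
  show ?case using nz by simp
next
  case (step n)
  then show ?case using down[of n] nz by auto
qed

lemma inverse_of_nat_Suc_tendsto_0: "(\<lambda>n. inverse (of_nat (Suc n)) :: complex) \<longlonglongrightarrow> 0"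
  by (rule LIMSEQ_Suc[OF lim_inverse_n])

text \<open>
  The relation with m = 0, divided by k^2, gives w_0 + 2 w_1 + w_2 = 0 for the limit window,
  that is, the characteristic polynomial (x + 1)^2. The second difference gives
  \<Delta>^2 y_m w_0 + \<Delta>^2 b_m w_1 + \<Delta>^2 y_{m+1} w_2 = 0. Together with the shifted copies, the resultant of
  both polynomials must vanish; it is the square of \<Delta>^2 y_m + \<Delta>^2 y_{m+1} - \<Delta>^2 b_m. So
  y_n + y_{n+1} - b_n is affine, and being convergent it is constant.
\<close>

lemma quadratic_growth_reduction:
  assumes comm: "commuting h y b" and y0: "y 0 = 0"
    and nz: "\<And>k. k \<ge> K \<Longrightarrow> h k \<noteq> 0 \<or> h (Suc k) \<noteq> 0"
    and \<kappa>: "\<kappa> \<noteq> 0" and Y: "(\<lambda>n. y n - \<kappa> * (of_nat n)\<^sup>2 - p * of_nat n) \<longlonglongrightarrow> q"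
    and E: "(\<lambda>n. y n + y (Suc n) - b n) \<longlonglongrightarrow> s"
  shows "second_diff y \<longlonglongrightarrow> 2 * \<kappa>" "y n + y (Suc n) - b n = s"
proof -
  obtain w0 w1 w2 w3 where win: "limit_window h w0 w1 w2 w3"
    using limit_window_exists[of K h, OF nz] by blast
  note wnz = limit_window_nonzero[OF win] and w = limit_windowD[OF win]
  define r where "r n = y n - \<kappa> * (of_nat n)\<^sup>2 - p * of_nat n" for n
  define e where "e n = y n + y (Suc n) - b n" for n
  have r: "r \<longlonglongrightarrow> q" using Y by (simp add: r_def[abs_def])
  have e: "e \<longlonglongrightarrow> s" using E by (simp add: e_def[abs_def])
  have y_eq: "y n = \<kappa> * (of_nat n)\<^sup>2 + p * of_nat n + r n" for n by (simp add: r_def)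
  have b_eq: "b n = y n + y (Suc n) - e n" for n by (simp add: e_def)
  have "second_diff y n = second_diff r n + 2 * \<kappa>" for n
    by (simp add: second_diff_def y_eq power2_eq_square algebra_simps)
  then have "second_diff y = (\<lambda>n. second_diff r n + 2 * \<kappa>)" by blast
  with tendsto_add[OF tendsto_second_diff[OF r] tendsto_const, of "2 * \<kappa>"]
  show D2y: "second_diff y \<longlonglongrightarrow> 2 * \<kappa>" by simp
  have "second_diff b n = second_diff y n + second_diff y (Suc n) - second_diff e n" for n
    by (simp add: second_diff_def b_eq algebra_simps)
  then have "second_diff b = (\<lambda>n. second_diff y n + second_diff y (Suc n) - second_diff e n)" by blast
  with tendsto_diff[OF tendsto_add[OF D2y LIMSEQ_Suc[OF D2y]] tendsto_second_diff[OF e]]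
  have D2b: "second_diff b \<longlonglongrightarrow> 4 * \<kappa>" by simp
  define z where "z k = inverse (of_nat (Suc k)) * inverse (of_nat (Suc k) :: complex)" for k
  note inv = inverse_of_nat_Suc_tendsto_0
  have z: "z \<longlonglongrightarrow> 0" using tendsto_mult[OF inv inv] by (simp add: z_def[abs_def])
  have c0: "(\<lambda>k. z k * y (Suc k)) \<longlonglongrightarrow> \<kappa>"
  proof -
    have gen: "i * i * (a * x\<^sup>2 + c * x + d) = a + c * i + i * i * d"
      if "x * i = 1" for x i a c d :: complex
    proof -
      have "i * i * (a * x\<^sup>2 + c * x + d) = a * (x * i)\<^sup>2 + c * (x * i) * i + i * i * d"
        by (simp add: power2_eq_square algebra_simps)
      then show ?thesis by (simp add: that)
    qed
    have "z k * y (Suc k) = \<kappa> + p * inverse (of_nat (Suc k)) + z k * r (Suc k)" for k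
      unfolding z_def y_eq by (rule gen) (simp del: of_nat_Suc)
    moreover have "(\<lambda>k. \<kappa> + p * inverse (of_nat (Suc k)) + z k * r (Suc k)) \<longlonglongrightarrow> \<kappa> + p * 0 + 0 * q"
      by (rule tendsto_add[OF tendsto_add[OF tendsto_const tendsto_mult[OF tendsto_const inv]]
            tendsto_mult[OF z LIMSEQ_Suc[OF r]]])
    ultimately show ?thesis by simp
  qed
  have c2: "(\<lambda>k. z k * y (Suc (Suc k))) \<longlonglongrightarrow> \<kappa>"
  proof -
    have gen: "i * i * (a * (x + 1)\<^sup>2 + c * (x + 1) + d) = a * (1 + i)\<^sup>2 + c * (i + i * i) + i * i * d"
      if "x * i = 1" for x i a c d :: complex
    proof -
      have "i * i * (a * (x + 1)\<^sup>2 + c * (x + 1) + d)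
          = a * (x * i + i)\<^sup>2 + c * ((x * i) * i + i * i) + i * i * d"
        by (simp add: power2_eq_square algebra_simps)
      then show ?thesis by (simp add: that)
    qed
    have "z k * y (Suc (Suc k)) = \<kappa> * (1 + inverse (of_nat (Suc k)))\<^sup>2
        + p * (inverse (of_nat (Suc k)) + z k) + z k * r (Suc (Suc k))" for k
    proof -
      have "of_nat (Suc (Suc k)) = of_nat (Suc k) + (1 :: complex)" by simp
      then show ?thesis unfolding z_def y_eq[of "Suc (Suc k)"]
        by (simp only:) (rule gen, simp del: of_nat_Suc)
    qed
    moreover have "(\<lambda>k. \<kappa> * (1 + inverse (of_nat (Suc k)))\<^sup>2
        + p * (inverse (of_nat (Suc k)) + z k) + z k * r (Suc (Suc k)))
      \<longlonglongrightarrow> \<kappa> * (1 + 0)\<^sup>2 + p * (0 + 0) + 0 * q"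
      by (rule tendsto_add[OF tendsto_add[OF
            tendsto_mult[OF tendsto_const tendsto_power[OF tendsto_add[OF tendsto_const inv]]]
            tendsto_mult[OF tendsto_const tendsto_add[OF inv z]]]
            tendsto_mult[OF z LIMSEQ_Suc[OF LIMSEQ_Suc[OF r]]]])
    ultimately show ?thesis by simp
  qed
  have u: "\<kappa> * w0 + 2 * \<kappa> * w1 + \<kappa> * w2 = 0 \<and> \<kappa> * w1 + 2 * \<kappa> * w2 + \<kappa> * w3 = 0"
  proof (rule w[where ?c0.0 = "\<lambda>k. z k * y (Suc k)"
        and ?c1.0 = "\<lambda>k. z k * y (Suc k) + z k * y (Suc (Suc k)) - z k * e (Suc k) - z k * b 0"
        and ?c2.0 = "\<lambda>k. z k * y (Suc (Suc k)) - z k * y 1"])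
    have "(\<lambda>k. z k * y (Suc k) + z k * y (Suc (Suc k)) - z k * e (Suc k) - z k * b 0)
      \<longlonglongrightarrow> \<kappa> + \<kappa> - 0 * s - 0 * b 0"
      by (rule tendsto_diff[OF tendsto_diff[OF tendsto_add[OF c0 c2]
            tendsto_mult[OF z LIMSEQ_Suc[OF e]]] tendsto_mult[OF z tendsto_const]])
    then show "(\<lambda>k. z k * y (Suc k) + z k * y (Suc (Suc k)) - z k * e (Suc k) - z k * b 0) \<longlonglongrightarrow> 2 * \<kappa>"
      by simp
    show "(\<lambda>k. z k * y (Suc (Suc k)) - z k * y 1) \<longlonglongrightarrow> \<kappa>"
      using tendsto_diff[OF c2 tendsto_mult[OF z tendsto_const, of "y 1"]] by simp
    show "\<forall>\<^sub>F k in sequentially. z k * y (Suc k) * h k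
        + (z k * y (Suc k) + z k * y (Suc (Suc k)) - z k * e (Suc k) - z k * b 0) * h (Suc k)
        + (z k * y (Suc (Suc k)) - z k * y 1) * h (Suc (Suc k)) = 0"
    proof (rule always_eventually, rule allI)
      fix k
      have "z k * ((y (Suc k) - y 0) * h k + (b (Suc k) - b 0) * h (Suc k)
          + (y (Suc (Suc k)) - y (Suc 0)) * h (Suc (Suc k))) = 0"
        using commutingD[OF comm, of 0 "Suc k" k] by simp
      then show "z k * y (Suc k) * h k
        + (z k * y (Suc k) + z k * y (Suc (Suc k)) - z k * e (Suc k) - z k * b 0) * h (Suc k)
        + (z k * y (Suc (Suc k)) - z k * y 1) * h (Suc (Suc k)) = 0"
        unfolding b_eq[of "Suc k"] by (simp add: y0 algebra_simps del: of_nat_Suc)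
    qed
  qed (rule c0)
  have "\<kappa> * (w0 + 2 * w1 + w2) = 0" "\<kappa> * (w1 + 2 * w2 + w3) = 0"
    using u by (simp_all add: algebra_simps)
  then have "w0 + 2 * w1 + w2 = 0" "w1 + 2 * w2 + w3 = 0" using \<kappa> by simp_all
  then have w2: "w2 = - w0 - 2 * w1" and w3: "w3 = - w1 - 2 * w2"
    by (simp_all add: algebra_simps eq_neg_iff_add_eq_0)
  have "second_diff e m = 0" for m
  proof -
    have "(2 * \<kappa> - second_diff y m) * w0 + (4 * \<kappa> - second_diff b m) * w1 + (2 * \<kappa> - second_diff y (Suc m)) * w2 = 0 \<and>
      (2 * \<kappa> - second_diff y m) * w1 + (4 * \<kappa> - second_diff b m) * w2 + (2 * \<kappa> - second_diff y (Suc m)) * w3 = 0"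
    proof (rule w[where ?c0.0 = "\<lambda>k. second_diff y (k - Suc m) - second_diff y m"
          and ?c1.0 = "\<lambda>k. second_diff b (k - Suc m) - second_diff b m"
          and ?c2.0 = "\<lambda>k. second_diff y (k - m) - second_diff y (Suc m)"])
      show "\<forall>\<^sub>F k in sequentially. (second_diff y (k - Suc m) - second_diff y m) * h k +
          (second_diff b (k - Suc m) - second_diff b m) * h (Suc k) + (second_diff y (k - m) - second_diff y (Suc m)) * h (Suc (Suc k)) = 0"
        using eventually_gt_at_top[of m]
      proof eventually_elim
        case (elim k)
        show ?case
          using exchange_second_difference[of y h b "\<lambda>k. h (Suc k)" "\<lambda>k. h (Suc (Suc k))" m k,
              OF commutingD[OF comm] elim] .
      qed
    qed (rule tendsto_diff[OF filterlim_compose[OF D2y filterlim_minus_const_nat_at_top] tendsto_const]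
        tendsto_diff[OF filterlim_compose[OF D2b filterlim_minus_const_nat_at_top] tendsto_const])+
    note r12 = conjunct1[OF this] conjunct2[OF this]
    have "(second_diff y m - second_diff y (Suc m)) * w0 + (second_diff b m - 2 * second_diff y (Suc m)) * w1 =
        - ((2 * \<kappa> - second_diff y m) * w0 + (4 * \<kappa> - second_diff b m) * w1 + (2 * \<kappa> - second_diff y (Suc m)) * w2)"
      unfolding w2 by (simp add: algebra_simps)
    then have e1: "(second_diff y m - second_diff y (Suc m)) * w0 + (second_diff b m - 2 * second_diff y (Suc m)) * w1 = 0"
      unfolding r12 by simp
    have "(second_diff y m - second_diff y (Suc m)) * w1 - (second_diff b m - 2 * second_diff y (Suc m)) * (w0 + 2 * w1) =
        - ((2 * \<kappa> - second_diff y m) * w1 + (4 * \<kappa> - second_diff b m) * w2 + (2 * \<kappa> - second_diff y (Suc m)) * w3)"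
      unfolding w3 w2 by (simp add: algebra_simps)
    then have e2: "(second_diff y m - second_diff y (Suc m)) * w1 - (second_diff b m - 2 * second_diff y (Suc m)) * (w0 + 2 * w1) = 0"
      unfolding r12 by simp
    define P where "P = second_diff y m - second_diff y (Suc m)"
    define Q where "Q = second_diff b m - 2 * second_diff y (Suc m)"
    note e12 = e1[folded P_def Q_def] e2[folded P_def Q_def]
    \<comment> \<open>Cramer's rule for the system with determinant (P - Q)^2.\<close>
    have "(P - Q)\<^sup>2 * w0 = (P - 2 * Q) * (P * w0 + Q * w1) - Q * (P * w1 - Q * (w0 + 2 * w1))"
      "(P - Q)\<^sup>2 * w1 = Q * (P * w0 + Q * w1) + P * (P * w1 - Q * (w0 + 2 * w1))"
      by (simp_all add: power2_eq_square algebra_simps)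
    then have "(P - Q)\<^sup>2 * w0 = 0" "(P - Q)\<^sup>2 * w1 = 0" unfolding e12 by simp_all
    moreover have "w0 \<noteq> 0 \<or> w1 \<noteq> 0"
    proof (rule ccontr)
      assume "\<not> ?thesis"
      then have "w0 = 0" "w1 = 0" by simp_all
      moreover from this have "w2 = 0" unfolding w2 by simp
      moreover from this \<open>w1 = 0\<close> have "w3 = 0" unfolding w3 by simp
      ultimately show False using wnz by blast
    qed
    ultimately have PQ: "P - Q = 0" by auto
    have "second_diff e m = P - Q"
      by (simp add: P_def Q_def second_diff_def e_def algebra_simps)
    with PQ show ?thesis by simp
  qed
  from affine_convergent_constant[of e s n, OF this e] show "y n + y (Suc n) - b n = s"
    unfolding e_def .
qed

text \<open>
  With b_n = y_n + y_{n+1} - s the relations involve only f_k = h_k + h_{k+1} and f_{k+1}. Rigidity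
  then makes y quadratic from index one on; comparing m = 0 with m = 1 extends this to
  y_0 = 0, whence y_n = \<kappa> n (n + t - 1). The relations become
  (k + t) f_k + (k + 2 + t) f_{k+1} = 0, which says that (-1)^k (k + t) h_k is affine in k, and the
  linear part is excluded by h_k \<longlonglongrightarrow> 0.
\<close>

lemma quadratic_offdiagonal:
  fixes H :: "nat \<Rightarrow> real"
  defines "h \<equiv> \<lambda>k. complex_of_real (H k)"
  assumes comm: "commuting h y b" and y0: "y 0 = 0" and ynz: "\<And>n. n \<ge> 2 \<Longrightarrow> y n \<noteq> 0"
    and ng: "\<not> geometric h" and h0: "h \<longlonglongrightarrow> 0"
    and rat: "rational_seq (\<lambda>n. (y n)\<^sup>2)"
    and \<kappa>: "\<kappa> \<noteq> 0" and Y: "(\<lambda>n. y n - \<kappa> * (of_nat n)\<^sup>2 - p * of_nat n) \<longlonglongrightarrow> q"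
    and E: "(\<lambda>n. y n + y (Suc n) - b n) \<longlonglongrightarrow> s"
  shows "\<exists>t c. t \<notin> \<int>\<^sub>\<le>\<^sub>0 \<and> (\<forall>k. H k = c * (-1) ^ k / (real k + t))"
proof -
  from no_consecutive_zeros[of h y b, OF comm y0 ynz ng]
  obtain K where K: "\<And>k. k \<ge> K \<Longrightarrow> h k \<noteq> 0 \<or> h (Suc k) \<noteq> 0" by blast
  note red = quadratic_growth_reduction[of h y b K \<kappa> p q s, OF comm y0 K \<kappa> Y E]
  have b_eq: "b n = y n + y (Suc n) - s" for n using red(2)[of n] by (simp add: algebra_simps)
  define f where "f k = h k + h (Suc k)" for k
  have ex: "(y n - y m) * f k + (y (Suc n) - y (Suc m)) * f (Suc k) = 0" if "m + n = Suc k" for m n k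
    using commutingD[OF comm that] by (simp add: b_eq f_def algebra_simps)
  have down: "f k = 0" if "k \<ge> 1" "f (Suc k) = 0" for k
    using ex[of 0 "Suc k" k] ynz[of "Suc k"] that y0 by simp
  have "\<exists>j\<ge>1. f j \<noteq> 0"
  proof (rule ccontr)
    assume "\<not> ?thesis"
    then have f0: "f j = 0" if "j \<ge> 1" for j using that by blast
    have step: "h (Suc (Suc k)) = - h (Suc k)" for k
      using f0[of "Suc k"] by (simp add: f_def eq_neg_iff_add_eq_0 add.commute)
    have nrm: "norm (h (Suc k)) = norm (h 1)" for k
      by (induction k) (simp_all add: step)
    have "(\<lambda>k. norm (h (Suc k))) \<longlonglongrightarrow> 0"
      by (rule tendsto_norm_zero[OF LIMSEQ_Suc[OF h0]])
    then have "h 1 = 0" unfolding nrm by (simp add: LIMSEQ_const_iff)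
    with nrm have hz: "h (Suc k) = 0" for k by (metis norm_eq_zero)
    have "h k = h 0 * 0 ^ k" for k by (cases k) (simp_all add: hz)
    with ng show False unfolding geometric_def by blast
  qed
  then obtain j where j: "j \<ge> 1" "f j \<noteq> 0" by blast
  have fnz: "f k \<noteq> 0" if "k \<ge> j" for k
    using backward_zeros[of f, OF down j that] .
  have freq: "\<exists>\<^sub>F k in sequentially. f k \<noteq> 0 \<or> f (Suc k) \<noteq> 0"
    unfolding frequently_sequentially using fnz by (metis nat_le_linear)
  have "\<exists>u v. \<forall>n\<ge>1. y n = \<kappa> * (of_nat n)\<^sup>2 + u * of_nat n + v"
  proof (rule exchange_rigid[where X = f and Z = "\<lambda>k. f (Suc k)" and b = "\<lambda>_. 0" and Y = "\<lambda>_. 0"])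
    show "(y n - y m) * f k + (0 - 0) * 0 + (y (Suc n) - y (Suc m)) * f (Suc k) = 0"
      if "m + n = Suc k" for m n k using ex[OF that] by simp
    show "second_diff (\<lambda>_. 0) j = 0" for j by (simp add: second_diff_def)
  qed (rule freq rat red(1))+
  then obtain u v where uv: "\<And>n. n \<ge> 1 \<Longrightarrow> y n = \<kappa> * (of_nat n)\<^sup>2 + u * of_nat n + v" by blast
  have "v = 0"
  proof -
    define k where "k = j + 2"
    have k: "k \<ge> 2" by (simp add: k_def)
    have e0: "y (Suc k) * f k + (y (Suc (Suc k)) - y 1) * f (Suc k) = 0"
      using ex[of 0 "Suc k" k] y0 by simp
    have e1: "(y k - y 1) * f k + (y (Suc k) - y 2) * f (Suc k) = 0"
      using ex[of 1 k k] by (simp add: numeral_2_eq_2)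
    \<comment> \<open>Eliminates f_{k+1} between the relations for m = 0 and m = 1.\<close>
    have "(of_nat k - 1) * v * f k =
       (of_nat k - 1) * (y (Suc k) * f k + (y (Suc (Suc k)) - y 1) * f (Suc k))
       - (of_nat k + 1) * ((y k - y 1) * f k + (y (Suc k) - y 2) * f (Suc k))"
      using uv[of k] uv[of "Suc k"] uv[of "Suc (Suc k)"] uv[of 1] uv[of 2] k
      by (simp add: power2_eq_square algebra_simps)
    also have "\<dots> = 0" unfolding e0 e1 by simp
    finally have "(of_nat k - 1) * v * f k = 0" .
    moreover have "of_nat k - 1 \<noteq> (0 :: complex)"
      using k of_nat_eq_1_iff[of k, where 'a = complex] by auto
    moreover have "f k \<noteq> 0" by (rule fnz) (simp add: k_def)
    ultimately show ?thesis by simp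
  qed
  \<comment> \<open>Chosen such that y_n = \<kappa> n (n + t - 1).\<close>
  define t where "t = u / \<kappa> + 1"
  have u: "u = \<kappa> * (t - 1)" using \<kappa> by (simp add: t_def)
  have y_eq: "y n = \<kappa> * of_nat n * (of_nat n + t - 1)" for n
  proof (cases "n = 0")
    case False
    then show ?thesis using uv[of n] \<open>v = 0\<close> by (simp add: u power2_eq_square algebra_simps)
  qed (simp add: y0)
  \<comment> \<open>Turns the recurrence with double root -1 into a vanishing second difference.\<close>
  define G where "G k = (-1) ^ k * ((of_nat k + t) * h k)" for k
  have "second_diff G k = 0" for k
  proof -
    have "\<kappa> * of_nat (Suc k) * ((of_nat k + t) * f k + (of_nat k + 2 + t) * f (Suc k)) = 0"
      using ex[of 0 "Suc k" k] by (simp add: y_eq y0 algebra_simps)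
    moreover have "\<kappa> * of_nat (Suc k) \<noteq> 0" using \<kappa> by (simp del: of_nat_Suc)
    ultimately have rec: "(of_nat k + t) * f k + (of_nat k + 2 + t) * f (Suc k) = 0"
      by (simp only: mult_eq_0_iff) simp
    have "second_diff G k = (-1) ^ k * ((of_nat k + t) * f k + (of_nat k + 2 + t) * f (Suc k))"
      by (simp add: second_diff_def G_def f_def algebra_simps)
    then show ?thesis unfolding rec by simp
  qed
  then have "G (Suc (Suc k)) - 2 * G (Suc k) + G k = 2 * 0" for k by (simp add: second_diff_def)
  note G_poly = constant_second_difference[of G 0, OF this]
  have G: "G k = G 0 + of_nat k * (G 1 - G 0)" for k using G_poly[of k] by simp
  have "G 1 - G 0 = 0"
  proof -
    note inv = inverse_of_nat_Suc_tendsto_0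
    have gen: "x * inverse (1 + x) = 1 - inverse (1 + x)" if "1 + x \<noteq> 0" for x :: complex
      using that by (simp add: field_simps)
    have "(\<lambda>k. (-1) ^ k * h k) \<longlonglongrightarrow> 0"
      using tendsto_norm_zero[OF h0]
      by - (rule tendsto_norm_zero_cancel, simp add: norm_mult norm_power)
    moreover have lim1: "(\<lambda>k. of_nat k * inverse (of_nat (Suc k)) :: complex) \<longlonglongrightarrow> 1"
    proof -
      have "of_nat k * inverse (of_nat (Suc k)) = 1 - inverse (of_nat (Suc k) :: complex)" for k
        unfolding of_nat_Suc
        by (rule gen) (use of_nat_neq_0[of k, where 'a = complex] in \<open>simp only: of_nat_Suc not_False_eq_True\<close>)
      then show ?thesis using tendsto_diff[OF tendsto_const inv, of 1] by simp
    qed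
    ultimately have "(\<lambda>k. ((-1) ^ k * h k) * (of_nat k * inverse (of_nat (Suc k)) + t * inverse (of_nat (Suc k))))
       \<longlonglongrightarrow> 0 * (1 + t * 0)"
      by (intro tendsto_mult tendsto_add tendsto_const inv)
    moreover have "((-1) ^ k * h k) * (of_nat k * inverse (of_nat (Suc k)) + t * inverse (of_nat (Suc k)))
       = G k * inverse (of_nat (Suc k))" for k
      by (simp add: G_def algebra_simps del: of_nat_Suc)
    ultimately have 1: "(\<lambda>k. G k * inverse (of_nat (Suc k))) \<longlonglongrightarrow> 0" by simp
    have "(\<lambda>k. G 0 * inverse (of_nat (Suc k)) + (of_nat k * inverse (of_nat (Suc k))) * (G 1 - G 0))
       \<longlonglongrightarrow> G 0 * 0 + 1 * (G 1 - G 0)"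
      by (intro tendsto_mult tendsto_add tendsto_const inv lim1)
    moreover have "G 0 * inverse (of_nat (Suc k)) + (of_nat k * inverse (of_nat (Suc k))) * (G 1 - G 0)
        = G k * inverse (of_nat (Suc k))" for k
      by (subst G[of k]) (simp add: algebra_simps del: of_nat_Suc)
    ultimately have "(\<lambda>k. G k * inverse (of_nat (Suc k))) \<longlonglongrightarrow> G 1 - G 0" by simp
    with 1 show ?thesis using LIMSEQ_unique by blast
  qed
  then have G: "G k = G 0" for k using G[of k] by simp
  have h_eq: "(of_nat k + t) * h k = (-1) ^ k * G 0" for k
  proof -
    have "(-1) ^ k * G k = ((-1) ^ k * (-1) ^ k) * ((of_nat k + t) * h k)" by (simp add: G_def)
    also have "(-1) ^ k * (-1) ^ k = (1 :: complex)"
      by (simp flip: power_mult_distrib)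
    finally show ?thesis using G[of k] by simp
  qed
  have tnz: "of_nat k + t \<noteq> 0" if "k \<ge> 1" for k
    using ynz[of "Suc k"] that by (simp add: y_eq)
  have "G 0 \<noteq> 0"
  proof
    assume "G 0 = 0"
    then have hz: "h k = 0" if "k \<ge> 1" for k using h_eq[of k] tnz[OF that] by simp
    have "h k = h 0 * 0 ^ k" for k
      by (cases "k = 0") (use hz[of k] in auto)
    with ng show False unfolding geometric_def by blast
  qed
  have t0: "h 0 * t = G 0" using h_eq[of 0] by (simp add: mult.commute)
  have t1: "h 1 * t = - G 0 - h 1" using h_eq[of 1] by (simp add: algebra_simps eq_neg_iff_add_eq_0)
  \<comment> \<open>The entries are real, so two of them show that t is real.\<close>
  have "(h 0 + h 1) * t = - h 1" using t0 t1 by (simp add: distrib_right)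
  moreover have "h 0 + h 1 \<noteq> 0"
  proof
    assume "h 0 + h 1 = 0"
    with \<open>(h 0 + h 1) * t = - h 1\<close> have "h 1 = 0" by simp
    with \<open>h 0 + h 1 = 0\<close> t0 \<open>G 0 \<noteq> 0\<close> show False by simp
  qed
  ultimately have "t = - h 1 / (h 0 + h 1)" by (simp add: field_simps)
  then obtain \<tau> where \<tau>: "t = complex_of_real \<tau>" unfolding h_def
    by (metis of_real_add of_real_divide of_real_minus)
  have G_real: "G 0 = complex_of_real (H 0 * \<tau>)" using t0 by (simp add: h_def \<tau>)
  have H_eq: "(real k + \<tau>) * H k = (-1) ^ k * (H 0 * \<tau>)" for k
  proof -
    have "complex_of_real ((real k + \<tau>) * H k) = complex_of_real ((-1) ^ k * (H 0 * \<tau>))"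
      using h_eq[of k] unfolding G_real by (simp add: h_def \<tau>)
    then show ?thesis by (simp only: of_real_eq_iff)
  qed
  have H0: "H 0 * \<tau> \<noteq> 0" using \<open>G 0 \<noteq> 0\<close> unfolding G_real by (simp only: of_real_eq_0_iff not_False_eq_True)
  have k\<tau>: "real k + \<tau> \<noteq> 0" for k using H_eq[of k] H0 by auto
  have "\<tau> \<notin> \<int>\<^sub>\<le>\<^sub>0"
  proof
    assume "\<tau> \<in> \<int>\<^sub>\<le>\<^sub>0"
    then obtain n where "\<tau> = - of_nat n" by (elim nonpos_Ints_cases')
    with k\<tau>[of n] show False by simp
  qed
  moreover have "H k = (H 0 * \<tau>) * (-1) ^ k / (real k + \<tau>)" for k
    using H_eq[of k] k\<tau>[of k] by (simp add: field_simps)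
  ultimately show ?thesis by blast
qed

section \<open>Convergent off-diagonal entries\<close>

text \<open>
  The analogue of the rigidity for second differences, with the relations themselves
  in place of their second differences.
\<close>

lemma convergent_exchange_rigid:
  assumes ex: "\<And>m n k. m + n = Suc k \<Longrightarrow>
      (y n - y m) * X k + (y (Suc n) - y (Suc m)) * Z k = 0"
    and nz: "\<exists>\<^sub>F k in sequentially. X k \<noteq> 0 \<or> Z k \<noteq> 0"
    and rat: "rational_seq (\<lambda>n. (y n)\<^sup>2)" and lim: "y \<longlonglongrightarrow> l" and n: "n \<ge> 1"
  shows "y n = l"
proof (rule convergent_rigid[OF rat lim _ n])
  have eq: "\<forall>\<^sub>F k in sequentially. (y (Suc (k - m)) - y m) * X k + (y (Suc (Suc (k - m))) - y (Suc m)) * Z k = 0" for m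
    using eventually_ge_at_top[of m]
  proof eventually_elim
    case (elim k)
    then show ?case using ex[of m "Suc (k - m)" k] by simp
  qed
  have l1: "(\<lambda>k. y (Suc (k - m)) - c) \<longlonglongrightarrow> l - c" for m c
    by (rule tendsto_diff[OF filterlim_compose[OF LIMSEQ_Suc[OF lim] filterlim_minus_const_nat_at_top] tendsto_const])
  have l2: "(\<lambda>k. y (Suc (Suc (k - m))) - c) \<longlonglongrightarrow> l - c" for m c
    by (rule tendsto_diff[OF filterlim_compose[OF LIMSEQ_Suc[OF LIMSEQ_Suc[OF lim]]
          filterlim_minus_const_nat_at_top] tendsto_const])
  show "(y i - l) * (y (Suc j) - l) = (y j - l) * (y (Suc i) - l)" for i j
  proof -
    have "(l - y i) * (l - y (Suc j)) = (l - y j) * (l - y (Suc i))"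
      by (rule limit_minor_eq_zero[OF nz l1 l1 l2 l2 eq eq])
    then show ?thesis by (simp add: algebra_simps)
  qed
qed

text \<open>
  Let \<eta> = l - y and c = b' - b. The rows (\<eta>_m, c_m, \<eta>_{m+1}) annihilate both (w_0, w_1, w_2) and
  (w_1, w_2, w_3). If these vectors are independent, all rows are proportional and \<eta> has
  vanishing minors. If they are dependent, either only w_3 is nonzero and
  \<eta>_m = 0 for m \<ge> 1, or the window is geometric with some ratio r, which determines b in terms of y; the relations then involve only f_k = h_{k+1} - r h_k and
  f_{k+1}, and rigidity applies to them.
\<close>

lemma convergent_offdiagonal:
  assumes comm: "commuting h y b" and y0: "y 0 = 0" and ynz: "\<And>n. n \<ge> 1 \<Longrightarrow> y n \<noteq> 0"
    and ng: "\<not> geometric h"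
    and rat: "rational_seq (\<lambda>n. (y n)\<^sup>2)"
    and lim: "y \<longlonglongrightarrow> l" and l: "l \<noteq> 0" and b: "b \<longlonglongrightarrow> b'" and n: "n \<ge> 1"
  shows "y n = l"
proof -
  have "\<exists>K. \<forall>k\<ge>K. h k \<noteq> 0 \<or> h (Suc k) \<noteq> 0"
    by (rule no_consecutive_zeros[OF comm y0 _ ng]) (rule ynz, simp)
  then obtain K where K: "\<And>k. k \<ge> K \<Longrightarrow> h k \<noteq> 0 \<or> h (Suc k) \<noteq> 0" by blast
  obtain w0 w1 w2 w3 where win: "limit_window h w0 w1 w2 w3"
    using limit_window_exists[of K h, OF K] by blast
  note wnz = limit_window_nonzero[OF win] and w = limit_windowD[OF win]
  define \<eta> where "\<eta> j = l - y j" for j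
  define c where "c j = b' - b j" for j
  have rel: "\<eta> m * w0 + c m * w1 + \<eta> (Suc m) * w2 = 0 \<and> \<eta> m * w1 + c m * w2 + \<eta> (Suc m) * w3 = 0" for m
    unfolding \<eta>_def c_def
  proof (rule w[where ?c0.0 = "\<lambda>k. y (Suc (k - m)) - y m" and ?c1.0 = "\<lambda>k. b (Suc (k - m)) - b m"
        and ?c2.0 = "\<lambda>k. y (Suc (Suc (k - m))) - y (Suc m)"])
    show "\<forall>\<^sub>F k in sequentially. (y (Suc (k - m)) - y m) * h k + (b (Suc (k - m)) - b m) * h (Suc k)
        + (y (Suc (Suc (k - m))) - y (Suc m)) * h (Suc (Suc k)) = 0"
      using eventually_ge_at_top[of m]
    proof eventually_elim
      case (elim k)
      then show ?case using commutingD[OF comm, of m "Suc (k - m)" k] by simp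
    qed
  qed (rule tendsto_diff[OF filterlim_compose[OF LIMSEQ_Suc[OF lim] filterlim_minus_const_nat_at_top] tendsto_const]
      tendsto_diff[OF filterlim_compose[OF LIMSEQ_Suc[OF b] filterlim_minus_const_nat_at_top] tendsto_const]
      tendsto_diff[OF filterlim_compose[OF LIMSEQ_Suc[OF LIMSEQ_Suc[OF lim]] filterlim_minus_const_nat_at_top] tendsto_const])+
  have \<eta>0: "\<eta> 0 \<noteq> 0" using l by (simp add: \<eta>_def y0)
  \<comment> \<open>The two components of the cross product of (w_0,w_1,w_2) and (w_1,w_2,w_3) that survive the elimination of c_m.\<close>
  define P where "P = w0 * w2 - w1 * w1"
  define Q where "Q = w2 * w2 - w1 * w3"
  have PQ: "\<eta> m * P + \<eta> (Suc m) * Q = 0" for m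
  proof -
    have "\<eta> m * P + \<eta> (Suc m) * Q = w2 * (\<eta> m * w0 + c m * w1 + \<eta> (Suc m) * w2)
        - w1 * (\<eta> m * w1 + c m * w2 + \<eta> (Suc m) * w3)"
      by (simp add: P_def Q_def algebra_simps)
    then show ?thesis by (simp only: rel mult_zero_right diff_self)
  qed
  show ?thesis
  proof (cases "P = 0 \<and> Q = 0")
    case False
    show ?thesis
    proof (rule convergent_rigid[OF rat lim _ n])
      fix i j
      have "\<eta> i * \<eta> (Suc j) = \<eta> j * \<eta> (Suc i)"
        by (rule limit_minor_eq_zero[of "\<lambda>_. P" "\<lambda>_. Q" "\<lambda>_. \<eta> i" _ "\<lambda>_. \<eta> j" _ "\<lambda>_. \<eta> (Suc i)" _ "\<lambda>_. \<eta> (Suc j)"])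
          (use False PQ in auto)
      then show "(y i - l) * (y (Suc j) - l) = (y j - l) * (y (Suc i) - l)"
        by (simp add: \<eta>_def algebra_simps)
    qed
  next
    case True
    then have PQ0: "w0 * w2 = w1 * w1" "w2 * w2 = w1 * w3" by (simp_all add: P_def Q_def)
    show ?thesis
    proof (cases "w1 = 0")
      case True
      with PQ0 have w2: "w2 = 0" by simp
      with rel[of 0] True \<eta>0 have w0: "w0 = 0" by simp
      with wnz True w2 have "w3 \<noteq> 0" by blast
      with rel[of "n - 1"] True w2 have "\<eta> (Suc (n - 1)) = 0" by simp
      then show ?thesis using n by (simp add: \<eta>_def)
    next
      case w1: False
      with PQ0 have w02: "w0 \<noteq> 0" "w2 \<noteq> 0" by auto
      define r where "r = w1 / w0"
      have r: "r \<noteq> 0" "w1 = r * w0" using w1 w02 by (simp_all add: r_def)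
      have "w0 * w2 = w0 * (r * r * w0)" using PQ0(1) unfolding r(2) by (simp add: mult_ac)
      then have w2: "w2 = r * r * w0" using w02 by simp
      have c: "c m = - (\<eta> m + r * r * \<eta> (Suc m)) / r" for m
      proof -
        have "w0 * (\<eta> m + c m * r + \<eta> (Suc m) * (r * r)) = 0"
          using conjunct1[OF rel[of m]] unfolding w2 r(2) by (simp add: algebra_simps)
        then have "\<eta> m + c m * r + \<eta> (Suc m) * (r * r) = 0" using w02 by simp
        then have "c m * r = - (\<eta> m + r * r * \<eta> (Suc m))"
          by (simp add: eq_neg_iff_add_eq_0 algebra_simps)
        then show ?thesis using r(1) by (simp add: eq_divide_eq)
      qed
      define f where "f k = h (Suc k) - r * h k" for k
      have ex: "(y n - y m) * (- f k / r) + (y (Suc n) - y (Suc m)) * f (Suc k) = 0"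
        if "m + n = Suc k" for m n k
      proof -
        have "(b n - b m) * r = (\<eta> n - \<eta> m) + r * r * (\<eta> (Suc n) - \<eta> (Suc m))"
        proof -
          have "(b n - b m) * r = (c m - c n) * r" by (simp add: c_def)
          also have "\<dots> = (\<eta> n + r * r * \<eta> (Suc n)) - (\<eta> m + r * r * \<eta> (Suc m))"
            unfolding c using r(1) by (simp add: left_diff_distrib)
          finally show ?thesis by (simp add: algebra_simps)
        qed
        then have bb: "(b n - b m) * r = - (y n - y m) - r * r * (y (Suc n) - y (Suc m))"
          by (simp add: \<eta>_def algebra_simps)
        have "r * ((y n - y m) * (- f k / r) + (y (Suc n) - y (Suc m)) * f (Suc k)) =
          - (y n - y m) * f k + r * (y (Suc n) - y (Suc m)) * f (Suc k)"
          using r(1) by (simp add: field_simps)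
        also have "\<dots> = r * ((y n - y m) * h k + (y (Suc n) - y (Suc m)) * h (Suc (Suc k)))
            + (- (y n - y m) - r * r * (y (Suc n) - y (Suc m))) * h (Suc k)"
          by (simp add: f_def algebra_simps)
        also have "\<dots> = r * ((y n - y m) * h k + (b n - b m) * h (Suc k) + (y (Suc n) - y (Suc m)) * h (Suc (Suc k)))"
          unfolding bb[symmetric] by (simp add: algebra_simps)
        also have "\<dots> = 0" using commutingD[OF comm that] by simp
        finally show ?thesis using r(1) by simp
      qed
      have down: "f k = 0" if "f (Suc k) = 0" for k
        using ex[of 0 "Suc k" k] ynz[of "Suc k"] that y0 r(1) by simp
      have "\<exists>j. f j \<noteq> 0"
      proof (rule ccontr)
        assume "\<not> ?thesis"
        then have step: "h (Suc k) = r * h k" for k by (simp add: f_def)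
        have "h k = h 0 * r ^ k" for k
        proof (induction k)
          case (Suc k)
          then show ?case using step[of k] by simp
        qed simp
        with ng show False unfolding geometric_def by blast
      qed
      then obtain j where j: "f j \<noteq> 0" by blast
      have fnz: "f k \<noteq> 0" if "k \<ge> j" for k
        using that
      proof (induction k rule: dec_induct)
        case (step k)
        then show ?case using down[of k] by blast
      qed (rule j)
      show ?thesis
      proof (rule convergent_exchange_rigid[of y "\<lambda>k. - f k / r" "\<lambda>k. f (Suc k)"])
        show "\<exists>\<^sub>F k in sequentially. - f k / r \<noteq> 0 \<or> f (Suc k) \<noteq> 0"
          unfolding frequently_sequentially
        proof
          fix m
          have "f (Suc (m + j)) \<noteq> 0" by (rule fnz) simp
          then show "\<exists>k\<ge>m. - f k / r \<noteq> 0 \<or> f (Suc k) \<noteq> 0"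
            by (intro exI[of _ "m + j"]) simp
        qed
      qed (rule ex rat lim n, assumption?)+
    qed
  qed
qed

section \<open>Second-order asymptotics\<close>

text \<open>
  G(n) = c_0 + c_1 / n + c_2 / n^2 + o(1 / n^2), scaled so that no division occurs.
\<close>

definition expands :: "(nat \<Rightarrow> complex) \<Rightarrow> complex \<Rightarrow> complex \<Rightarrow> bool" where
  "expands G c0 c1 \<longleftrightarrow> (\<exists>c2. (\<lambda>n. (of_nat n)\<^sup>2 * (G n - c0) - c1 * of_nat n) \<longlonglongrightarrow> c2)"

text \<open>
  F(n) = \<kappa> n^2 + p n + q + o(1), which is the previous expansion for F(n) / n^2.
\<close>

definition quad_asymp :: "(nat \<Rightarrow> complex) \<Rightarrow> complex \<Rightarrow> complex \<Rightarrow> bool" where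
  "quad_asymp F \<kappa> p \<longleftrightarrow> (\<exists>q. (\<lambda>n. F n - \<kappa> * (of_nat n)\<^sup>2 - p * of_nat n) \<longlonglongrightarrow> q)"

lemma inverse_of_nat_plus_tendsto_0: "(\<lambda>n. inverse (of_nat n + w) :: complex) \<longlonglongrightarrow> 0"
  by (rule filterlim_compose[OF tendsto_inverse_0])
    (rule tendsto_add_filterlim_at_infinity'[OF tendsto_of_nat tendsto_const])

lemma eventually_of_nat_plus_neq_0: "\<forall>\<^sub>F n in sequentially. of_nat n + w \<noteq> (0 :: complex)"
  using eventually_poly_neq_0[of "[:w, 1:]"] by (simp add: add.commute)

lemma expands_linear: "expands (\<lambda>n. (of_nat n + u) / of_nat n) 1 u"
proof -
  have "\<forall>\<^sub>F n in sequentially. (of_nat n)\<^sup>2 * ((of_nat n + u) / of_nat n - 1) - u * of_nat n = 0"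
    using eventually_gt_at_top[of 0]
    by eventually_elim (simp add: field_simps power2_eq_square)
  then show ?thesis unfolding expands_def by (blast intro: tendsto_eventually)
qed

lemma expands_inverse_linear: "expands (\<lambda>n. of_nat n / (of_nat n + w)) 1 (- w)"
proof -
  have "\<forall>\<^sub>F n in sequentially. w\<^sup>2 - w ^ 3 * inverse (of_nat n + w) =
      (of_nat n)\<^sup>2 * (of_nat n / (of_nat n + w) - 1) - (- w) * of_nat n"
    using eventually_of_nat_plus_neq_0[of w]
    by eventually_elim (simp add: field_simps power2_eq_square power3_eq_cube)
  moreover have "(\<lambda>n. w\<^sup>2 - w ^ 3 * inverse (of_nat n + w)) \<longlonglongrightarrow> w\<^sup>2 - w ^ 3 * 0"
    by (rule tendsto_diff[OF tendsto_const tendsto_mult[OF tendsto_const inverse_of_nat_plus_tendsto_0]])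
  ultimately show ?thesis unfolding expands_def by (blast intro: Lim_transform_eventually)
qed

lemma expands_const: "expands (\<lambda>_. c) c 0"
  unfolding expands_def by (rule exI[of _ 0]) simp

lemma expandsD:
  assumes "expands G c0 c1"
  shows "(\<lambda>n. of_nat n * (G n - c0)) \<longlonglongrightarrow> c1" "G \<longlonglongrightarrow> c0"
proof -
  from assms obtain c2 where c2: "(\<lambda>n. (of_nat n)\<^sup>2 * (G n - c0) - c1 * of_nat n) \<longlonglongrightarrow> c2"
    unfolding expands_def by blast
  have "(\<lambda>n. ((of_nat n)\<^sup>2 * (G n - c0) - c1 * of_nat n) * inverse (of_nat n) + c1) \<longlonglongrightarrow> c2 * 0 + c1"
    by (rule tendsto_add[OF tendsto_mult[OF c2 lim_inverse_n] tendsto_const])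
  moreover have "\<forall>\<^sub>F n in sequentially. ((of_nat n)\<^sup>2 * (G n - c0) - c1 * of_nat n) * inverse (of_nat n) + c1
      = of_nat n * (G n - c0)"
    using eventually_gt_at_top[of 0]
    by eventually_elim (simp add: field_simps power2_eq_square)
  ultimately have "(\<lambda>n. of_nat n * (G n - c0)) \<longlonglongrightarrow> c2 * 0 + c1"
    by (rule Lim_transform_eventually)
  then show 1: "(\<lambda>n. of_nat n * (G n - c0)) \<longlonglongrightarrow> c1" by simp
  have "(\<lambda>n. (of_nat n * (G n - c0)) * inverse (of_nat n) + c0) \<longlonglongrightarrow> c1 * 0 + c0"
    by (rule tendsto_add[OF tendsto_mult[OF 1 lim_inverse_n] tendsto_const])
  moreover have "\<forall>\<^sub>F n in sequentially. (of_nat n * (G n - c0)) * inverse (of_nat n) + c0 = G n"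
    using eventually_gt_at_top[of 0] by eventually_elim (simp add: field_simps)
  ultimately have "G \<longlonglongrightarrow> c1 * 0 + c0" by (rule Lim_transform_eventually)
  then show "G \<longlonglongrightarrow> c0" by simp
qed

lemma expands_mult:
  assumes G: "expands G c0 c1" and G': "expands G' d0 d1"
  shows "expands (\<lambda>n. G n * G' n) (c0 * d0) (c0 * d1 + c1 * d0)"
proof -
  from G obtain c2 where c2: "(\<lambda>n. (of_nat n)\<^sup>2 * (G n - c0) - c1 * of_nat n) \<longlonglongrightarrow> c2"
    unfolding expands_def by blast
  from G' obtain d2 where d2: "(\<lambda>n. (of_nat n)\<^sup>2 * (G' n - d0) - d1 * of_nat n) \<longlonglongrightarrow> d2"
    unfolding expands_def by blast
  have "(\<lambda>n. G n * ((of_nat n)\<^sup>2 * (G' n - d0) - d1 * of_nat n)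
      + d0 * ((of_nat n)\<^sup>2 * (G n - c0) - c1 * of_nat n) + d1 * (of_nat n * (G n - c0)))
    \<longlonglongrightarrow> c0 * d2 + d0 * c2 + d1 * c1"
    by (rule tendsto_add[OF tendsto_add[OF tendsto_mult[OF expandsD(2)[OF G] d2]
          tendsto_mult[OF tendsto_const c2]] tendsto_mult[OF tendsto_const expandsD(1)[OF G]]])
  then have "(\<lambda>n. (of_nat n)\<^sup>2 * (G n * G' n - c0 * d0) - (c0 * d1 + c1 * d0) * of_nat n)
    \<longlonglongrightarrow> c0 * d2 + d0 * c2 + d1 * c1"
    by (simp add: algebra_simps)
  then show ?thesis unfolding expands_def by blast
qed

text \<open>
  From sqrt G - k = (G - k^2) / (sqrt G + k), used twice. The principal branch is continuous at
  k^2 > 0, so the values G(n) need not be real.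
\<close>

lemma expands_csqrt:
  assumes G: "expands G ((of_real k)\<^sup>2) c1" and k: "k > 0"
  shows "expands (\<lambda>n. csqrt (G n)) (of_real k) (c1 / (2 * of_real k))"
proof -
  define K where "K = complex_of_real k"
  have K0: "K \<noteq> 0" using k by (simp add: K_def)
  define S where "S n = csqrt (G n)" for n
  from G obtain c2 where c2: "(\<lambda>n. (of_nat n)\<^sup>2 * (G n - K\<^sup>2) - c1 * of_nat n) \<longlonglongrightarrow> c2"
    unfolding expands_def K_def by blast
  have "K\<^sup>2 = complex_of_real (k\<^sup>2)" by (simp add: K_def)
  then have nonpos: "K\<^sup>2 \<notin> \<real>\<^sub>\<le>\<^sub>0" using k by (simp only: nonpos_Reals_of_real_iff) simp
  have "csqrt (K\<^sup>2) = K"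
    using k by (intro csqrt_unique) (simp_all add: K_def)
  then have S: "S \<longlonglongrightarrow> K"
    using isCont_tendsto_compose[OF continuous_at_csqrt[OF nonpos], of G sequentially] expandsD(2)[OF G]
    by (simp add: S_def[abs_def] K_def)
  have SK: "(\<lambda>n. S n + K) \<longlonglongrightarrow> 2 * K"
    using tendsto_add[OF S tendsto_const[of K]] by simp
  have SK0: "\<forall>\<^sub>F n in sequentially. S n + K \<noteq> 0"
    using tendsto_imp_eventually_ne[OF SK, of 0] K0 by simp
  have G_eq: "G n - K\<^sup>2 = (S n - K) * (S n + K)" for n
  proof -
    have "G n = (S n)\<^sup>2" by (simp add: S_def)
    then show ?thesis by (simp add: power2_eq_square algebra_simps)
  qed
  have "(\<lambda>n. of_nat n * (G n - K\<^sup>2) / (S n + K)) \<longlonglongrightarrow> c1 / (2 * K)"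
    using expandsD(1)[OF G] K0 by (intro tendsto_divide SK) (simp_all add: K_def)
  moreover have "\<forall>\<^sub>F n in sequentially. of_nat n * (G n - K\<^sup>2) / (S n + K) = of_nat n * (S n - K)"
    using SK0 by eventually_elim (simp add: G_eq)
  ultimately have nS: "(\<lambda>n. of_nat n * (S n - K)) \<longlonglongrightarrow> c1 / (2 * K)"
    by (rule Lim_transform_eventually)
  have "(\<lambda>n. ((of_nat n)\<^sup>2 * (G n - K\<^sup>2) - c1 * of_nat n) / (S n + K)
      - c1 / (2 * K) * (of_nat n * (S n - K)) / (S n + K)) \<longlonglongrightarrow>
      c2 / (2 * K) - c1 / (2 * K) * (c1 / (2 * K)) / (2 * K)"
    using K0 by (intro tendsto_diff tendsto_divide tendsto_mult tendsto_const c2 SK nS) simp_all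
  moreover have "\<forall>\<^sub>F n in sequentially. ((of_nat n)\<^sup>2 * (G n - K\<^sup>2) - c1 * of_nat n) / (S n + K)
      - c1 / (2 * K) * (of_nat n * (S n - K)) / (S n + K)
     = (of_nat n)\<^sup>2 * (S n - K) - c1 / (2 * K) * of_nat n"
    using SK0
  proof eventually_elim
    case (elim n)
    define d where "d = c1 / (2 * K)"
    have c1: "c1 = d * (2 * K)" using K0 by (simp add: d_def)
    have "((of_nat n)\<^sup>2 * (G n - K\<^sup>2) - c1 * of_nat n) - d * (of_nat n * (S n - K))
       = ((of_nat n)\<^sup>2 * (S n - K) - d * of_nat n) * (S n + K)"
      unfolding G_eq c1 by (simp add: algebra_simps)
    then show ?case
      unfolding d_def[symmetric] diff_divide_distrib[symmetric] using elim by simp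
  qed
  ultimately have "(\<lambda>n. (of_nat n)\<^sup>2 * (S n - K) - c1 / (2 * K) * of_nat n) \<longlonglongrightarrow>
      c2 / (2 * K) - c1 / (2 * K) * (c1 / (2 * K)) / (2 * K)"
    by (rule Lim_transform_eventually)
  then show ?thesis unfolding expands_def S_def K_def by blast
qed

lemma quad_asymp_from_expands:
  assumes "expands G \<kappa> p" "\<And>n. n \<ge> 1 \<Longrightarrow> F n = (of_nat n)\<^sup>2 * G n"
  shows "quad_asymp F \<kappa> p"
proof -
  from assms(1) obtain q where q: "(\<lambda>n. (of_nat n)\<^sup>2 * (G n - \<kappa>) - p * of_nat n) \<longlonglongrightarrow> q"
    unfolding expands_def by blast
  have "\<forall>\<^sub>F n in sequentially. (of_nat n)\<^sup>2 * (G n - \<kappa>) - p * of_nat n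
      = F n - \<kappa> * (of_nat n)\<^sup>2 - p * of_nat n"
    using eventually_ge_at_top[of 1] by eventually_elim (simp add: assms(2) algebra_simps)
  with q show ?thesis unfolding quad_asymp_def by (blast intro: Lim_transform_eventually)
qed

lemma expands_from_quad_asymp:
  assumes "quad_asymp F \<kappa> p"
  shows "expands (\<lambda>n. F n / (of_nat n)\<^sup>2) \<kappa> p"
proof -
  from assms obtain q where q: "(\<lambda>n. F n - \<kappa> * (of_nat n)\<^sup>2 - p * of_nat n) \<longlonglongrightarrow> q"
    unfolding quad_asymp_def by blast
  have "\<forall>\<^sub>F n in sequentially. F n - \<kappa> * (of_nat n)\<^sup>2 - p * of_nat n =
     (of_nat n)\<^sup>2 * (F n / (of_nat n)\<^sup>2 - \<kappa>) - p * of_nat n"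
    using eventually_ge_at_top[of 1] by eventually_elim (simp add: field_simps)
  with q show ?thesis unfolding expands_def by (blast intro: Lim_transform_eventually)
qed

lemma quad_asymp_add:
  assumes "quad_asymp F \<kappa> p" "quad_asymp F' \<kappa>' p'"
  shows "quad_asymp (\<lambda>n. F n + F' n) (\<kappa> + \<kappa>') (p + p')"
proof -
  from assms obtain q q' where "(\<lambda>n. F n - \<kappa> * (of_nat n)\<^sup>2 - p * of_nat n) \<longlonglongrightarrow> q"
    "(\<lambda>n. F' n - \<kappa>' * (of_nat n)\<^sup>2 - p' * of_nat n) \<longlonglongrightarrow> q'"
    unfolding quad_asymp_def by blast
  from tendsto_add[OF this] show ?thesis unfolding quad_asymp_def
    by (intro exI[of _ "q + q'"]) (simp add: algebra_simps)
qed

lemma quad_asymp_uminus: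
  assumes "quad_asymp F \<kappa> p"
  shows "quad_asymp (\<lambda>n. - F n) (- \<kappa>) (- p)"
proof -
  from assms obtain q where "(\<lambda>n. F n - \<kappa> * (of_nat n)\<^sup>2 - p * of_nat n) \<longlonglongrightarrow> q"
    unfolding quad_asymp_def by blast
  from tendsto_minus[OF this] show ?thesis unfolding quad_asymp_def
    by (intro exI[of _ "- q"]) (simp add: algebra_simps)
qed

lemma quad_asymp_Suc:
  assumes "quad_asymp F \<kappa> p"
  shows "quad_asymp (\<lambda>n. F (Suc n)) \<kappa> (p + 2 * \<kappa>)"
proof -
  from assms obtain q where q: "(\<lambda>n. F n - \<kappa> * (of_nat n)\<^sup>2 - p * of_nat n) \<longlonglongrightarrow> q"
    unfolding quad_asymp_def by blast
  from tendsto_add[OF LIMSEQ_Suc[OF q] tendsto_const[of "\<kappa> + p"]] show ?thesis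
    unfolding quad_asymp_def
    by (intro exI[of _ "q + (\<kappa> + p)"]) (simp add: power2_eq_square algebra_simps)
qed

lemma quad_asymp_cong:
  assumes "quad_asymp F \<kappa> p" "\<And>n. n \<ge> 1 \<Longrightarrow> F n = F' n"
  shows "quad_asymp F' \<kappa> p"
proof -
  from assms obtain q where q: "(\<lambda>n. F n - \<kappa> * (of_nat n)\<^sup>2 - p * of_nat n) \<longlonglongrightarrow> q"
    unfolding quad_asymp_def by blast
  have "\<forall>\<^sub>F n in sequentially. F n - \<kappa> * (of_nat n)\<^sup>2 - p * of_nat n =
     F' n - \<kappa> * (of_nat n)\<^sup>2 - p * of_nat n"
    using eventually_ge_at_top[of 1] by eventually_elim (simp add: assms(2))
  with q show ?thesis unfolding quad_asymp_def by (blast intro: Lim_transform_eventually)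
qed

lemma csqrt_of_nat_square_mult:
  assumes "n \<ge> 1"
  shows "csqrt ((of_nat n)\<^sup>2 * z) = of_nat n * csqrt z"
proof (rule csqrt_unique)
  show "(of_nat n * csqrt z)\<^sup>2 = (of_nat n)\<^sup>2 * z" by (simp add: power_mult_distrib)
  show "0 < Re (of_nat n * csqrt z) \<or> Re (of_nat n * csqrt z) = 0 \<and> 0 \<le> Im (of_nat n * csqrt z)"
    using csqrt_principal[of z] assms by (auto simp: zero_less_mult_iff)
qed

lemma quad_asymp_csqrt:
  assumes A: "quad_asymp A (of_real k) a" and B: "quad_asymp B (of_real k) b" and k: "k > 0"
  shows "quad_asymp (\<lambda>n. csqrt (A n * B n)) (of_real k) ((a + b) / 2)"
proof -
  have "expands (\<lambda>n. (A n / (of_nat n)\<^sup>2) * (B n / (of_nat n)\<^sup>2)) ((of_real k)\<^sup>2) (of_real k * b + a * of_real k)"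
    using expands_mult[OF expands_from_quad_asymp[OF A] expands_from_quad_asymp[OF B]]
    by (simp add: power2_eq_square)
  note root = expands_csqrt[OF this k]
  have "(of_real k * b + a * of_real k) / (2 * of_real k) = (a + b) / 2"
    using k by (simp add: divide_simps)
  with root have
    "expands (\<lambda>n. csqrt ((A n / (of_nat n)\<^sup>2) * (B n / (of_nat n)\<^sup>2))) (of_real k) ((a + b) / 2)"
    by (simp only:)
  then show ?thesis
  proof (rule quad_asymp_from_expands)
    fix n :: nat
    assume n: "n \<ge> 1"
    have "A n * B n = (of_nat (n\<^sup>2))\<^sup>2 * ((A n / (of_nat n)\<^sup>2) * (B n / (of_nat n)\<^sup>2))"
      using n by (simp add: field_simps power2_eq_square)
    then have "csqrt (A n * B n) = csqrt ((of_nat (n\<^sup>2))\<^sup>2 * ((A n / (of_nat n)\<^sup>2) * (B n / (of_nat n)\<^sup>2)))"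
      by (rule arg_cong)
    also have "\<dots> = of_nat (n\<^sup>2) * csqrt ((A n / (of_nat n)\<^sup>2) * (B n / (of_nat n)\<^sup>2))"
      by (rule csqrt_of_nat_square_mult) (rule one_le_power[OF n])
    finally show "csqrt (A n * B n) = (of_nat n)\<^sup>2 * csqrt ((A n / (of_nat n)\<^sup>2) * (B n / (of_nat n)\<^sup>2))"
      by (simp only: of_nat_power)
  qed
qed

lemma quad_asymp_linear_tendsto:
  assumes "quad_asymp (\<lambda>n. of_nat n * F n) \<kappa> p"
  shows "(\<lambda>n. F n - \<kappa> * of_nat n) \<longlonglongrightarrow> p"
proof -
  from assms obtain q where q: "(\<lambda>n. of_nat n * F n - \<kappa> * (of_nat n)\<^sup>2 - p * of_nat n) \<longlonglongrightarrow> q"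
    unfolding quad_asymp_def by blast
  have "(\<lambda>n. (of_nat n * F n - \<kappa> * (of_nat n)\<^sup>2 - p * of_nat n) * inverse (of_nat n) + p) \<longlonglongrightarrow> q * 0 + p"
    by (rule tendsto_add[OF tendsto_mult[OF q lim_inverse_n] tendsto_const])
  moreover have "\<forall>\<^sub>F n in sequentially. (of_nat n * F n - \<kappa> * (of_nat n)\<^sup>2 - p * of_nat n) * inverse (of_nat n) + p
      = F n - \<kappa> * of_nat n"
    using eventually_gt_at_top[of 0]
    by eventually_elim (simp add: field_simps power2_eq_square)
  ultimately have "(\<lambda>n. F n - \<kappa> * of_nat n) \<longlonglongrightarrow> q * 0 + p"
    by (rule Lim_transform_eventually)
  then show ?thesis by simp
qed

lemma rational_seq_linear: "rational_seq (\<lambda>n. of_nat n + u)"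
  unfolding rational_seq_def by (rule exI[of _ "[:u, 1:]"], rule exI[of _ 1]) (simp add: add.commute)

lemma rational_seq_const: "rational_seq (\<lambda>n. c)"
  unfolding rational_seq_def by (rule exI[of _ "[:c:]"], rule exI[of _ 1]) simp

lemma rational_seq_inverse_linear: "rational_seq (\<lambda>n. inverse (of_nat n + w))"
proof -
  have "\<forall>\<^sub>F n in sequentially. poly [:w, 1:] (of_nat n) * inverse (of_nat n + w) = poly 1 (of_nat n)"
    using eventually_of_nat_plus_neq_0[of w]
    by eventually_elim (simp add: field_simps)
  moreover have "[:w, 1:] \<noteq> 0" by simp
  ultimately show ?thesis unfolding rational_seq_def by blast
qed

lemma rational_seq_mult:
  assumes "rational_seq x" "rational_seq y"
  shows "rational_seq (\<lambda>n. x n * y n)"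
proof -
  from assms obtain N D N' D' where D: "D \<noteq> 0" "D' \<noteq> 0"
    and 1: "\<forall>\<^sub>F n in sequentially. poly D (of_nat n) * x n = poly N (of_nat n)"
    and 2: "\<forall>\<^sub>F n in sequentially. poly D' (of_nat n) * y n = poly N' (of_nat n)"
    unfolding rational_seq_def by blast
  from 1 2 have "\<forall>\<^sub>F n in sequentially. poly (D * D') (of_nat n) * (x n * y n) = poly (N * N') (of_nat n)"
  proof eventually_elim
    case (elim n)
    have "poly (D * D') (of_nat n) * (x n * y n) = (poly D (of_nat n) * x n) * (poly D' (of_nat n) * y n)"
      by (simp only: poly_mult mult_ac)
    then show ?case by (simp only: elim poly_mult)
  qed
  moreover have "D * D' \<noteq> 0" using D by simp
  ultimately show ?thesis unfolding rational_seq_def by blast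
qed

lemma rational_seq_cong:
  assumes "rational_seq x" "\<And>n. n \<ge> 1 \<Longrightarrow> x n = y n"
  shows "rational_seq y"
proof -
  from assms obtain N D where D: "D \<noteq> 0"
    and 1: "\<forall>\<^sub>F n in sequentially. poly D (of_nat n) * x n = poly N (of_nat n)"
    unfolding rational_seq_def by blast
  from 1 eventually_ge_at_top[of 1]
  have "\<forall>\<^sub>F n in sequentially. poly D (of_nat n) * y n = poly N (of_nat n)"
    by eventually_elim (simp add: assms(2))
  with D show ?thesis unfolding rational_seq_def by blast
qed

lemma rational_seq_from_Suc:
  assumes "rational_seq (\<lambda>n. x (Suc n))"
  shows "rational_seq x"
proof -
  from assms obtain N D where D: "D \<noteq> 0"
    and 1: "\<forall>\<^sub>F n in sequentially. poly D (of_nat n) * x (Suc n) = poly N (of_nat n)"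
    unfolding rational_seq_def by blast
  have "\<forall>\<^sub>F n in sequentially. poly (pcompose D [:- 1, 1:]) (of_nat n) * x n
      = poly (pcompose N [:- 1, 1:]) (of_nat n)"
    unfolding eventually_sequentially_Suc[symmetric, where P = "\<lambda>n. poly (pcompose D [:- 1, 1:]) (of_nat n) * x n
      = poly (pcompose N [:- 1, 1:]) (of_nat n)"]
    using 1 by eventually_elim (simp add: poly_pcompose)
  moreover have "pcompose D [:- 1, 1:] \<noteq> 0"
    using D by (subst pcompose_eq_0_iff) auto
  ultimately show ?thesis unfolding rational_seq_def by blast
qed

section \<open>Evaluating rational coefficients\<close>

text \<open>
  The rational function has a representation, not necessarily in lowest terms, whose
  denominator does not vanish at the point. This is stable under arithmetic, unlike the
  reduced representation.
\<close>

definition rat_value :: "'a::field_gcd poly fract \<Rightarrow> 'a \<Rightarrow> 'a \<Rightarrow> bool" where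
  "rat_value r x v \<longleftrightarrow> (\<exists>p q. r = Fract p q \<and> poly q x \<noteq> 0 \<and> v = poly p x / poly q x)"

lemma eval_rat_eq: "rat_value r x v \<Longrightarrow> eval_rat r x = v"
  unfolding rat_value_def using eval_rat_Fract by blast

lemma rat_value_const: "rat_value (rat_const a) x a"
  unfolding rat_value_def rat_const_def to_fract_def
  by (rule exI[of _ "[:a:]"], rule exI[of _ 1]) simp

lemma rat_value_var: "rat_value rat_var x x"
  unfolding rat_value_def rat_var_def to_fract_def
  by (rule exI[of _ "[:0, 1:]"], rule exI[of _ 1]) simp

lemma rat_value_1: "rat_value 1 x 1"
  unfolding rat_value_def One_fract_def
  by (rule exI[of _ 1], rule exI[of _ 1]) simp

lemma rat_value_add:
  assumes "rat_value r x v" "rat_value r' x v'"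
  shows "rat_value (r + r') x (v + v')"
proof -
  from assms obtain p q p' q' where *: "r = Fract p q" "poly q x \<noteq> 0" "v = poly p x / poly q x"
    "r' = Fract p' q'" "poly q' x \<noteq> 0" "v' = poly p' x / poly q' x"
    unfolding rat_value_def by blast
  then have "q \<noteq> 0" "q' \<noteq> 0" by auto
  with * show ?thesis unfolding rat_value_def
    by (intro exI[of _ "p * q' + p' * q"] exI[of _ "q * q'"]) (simp add: add_frac_eq)
qed

lemma rat_value_uminus:
  assumes "rat_value r x v"
  shows "rat_value (- r) x (- v)"
proof -
  from assms obtain p q where "r = Fract p q" "poly q x \<noteq> 0" "v = poly p x / poly q x"
    unfolding rat_value_def by blast
  then show ?thesis unfolding rat_value_def
    by (intro exI[of _ "- p"] exI[of _ q]) simp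
qed

lemma rat_value_diff:
  assumes "rat_value r x v" "rat_value r' x v'"
  shows "rat_value (r - r') x (v - v')"
  using rat_value_add[OF assms(1) rat_value_uminus[OF assms(2)]] by simp

lemma rat_value_mult:
  assumes "rat_value r x v" "rat_value r' x v'"
  shows "rat_value (r * r') x (v * v')"
proof -
  from assms obtain p q p' q' where *: "r = Fract p q" "poly q x \<noteq> 0" "v = poly p x / poly q x"
    "r' = Fract p' q'" "poly q' x \<noteq> 0" "v' = poly p' x / poly q' x"
    unfolding rat_value_def by blast
  then show ?thesis unfolding rat_value_def
    by (intro exI[of _ "p * p'"] exI[of _ "q * q'"]) simp
qed

lemma rat_value_divide:
  assumes "rat_value r x v" "rat_value r' x v'" "v' \<noteq> 0"
  shows "rat_value (r / r') x (v / v')"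
proof -
  from assms obtain p q p' q' where *: "r = Fract p q" "poly q x \<noteq> 0" "v = poly p x / poly q x"
    "r' = Fract p' q'" "poly q' x \<noteq> 0" "v' = poly p' x / poly q' x"
    unfolding rat_value_def by blast
  with assms(3) have "poly p' x \<noteq> 0" by auto
  with * show ?thesis unfolding rat_value_def
    by (intro exI[of _ "p * q'"] exI[of _ "q * p'"]) simp
qed

lemma rat_value_power2:
  assumes "rat_value r x v"
  shows "rat_value (r\<^sup>2) x (v\<^sup>2)"
  using rat_value_mult[OF assms assms] by (simp add: power2_eq_square)

lemma rat_value_numeral: "rat_value (numeral k) x (numeral k)"
proof (induction k)
  case One
  then show ?case using rat_value_1 by simp
next
  case (Bit0 k)
  then show ?case unfolding numeral_Bit0 by (intro rat_value_add)
next
  case (Bit1 k)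
  then show ?case unfolding numeral_Bit1 by (intro rat_value_add rat_value_1)
qed

lemmas rat_value_intros = rat_value_const rat_value_var rat_value_1 rat_value_add rat_value_uminus
  rat_value_diff rat_value_mult rat_value_divide rat_value_power2 rat_value_numeral

lemma Re_pos_neq_0: "0 < Re z \<Longrightarrow> z \<noteq> 0"
  by auto

section \<open>Families with an affine diagonal\<close>

lemma l2_entries_tendsto_0:
  assumes "summable (\<lambda>m. (h m)\<^sup>2)"
  shows "(\<lambda>m. complex_of_real (h m)) \<longlonglongrightarrow> 0"
proof -
  have "(\<lambda>m. (h m)\<^sup>2) \<longlonglongrightarrow> 0" by (rule summable_LIMSEQ_zero[OF assms])
  then have "(\<lambda>m. sqrt ((h m)\<^sup>2)) \<longlonglongrightarrow> sqrt 0" by (rule tendsto_real_sqrt)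
  then have "h \<longlonglongrightarrow> 0" by (simp add: tendsto_rabs_zero_iff)
  from tendsto_of_real[OF this, where 'a = complex] show ?thesis by simp
qed

text \<open>
  For \<alpha>_n^2 = A_n C_{n+1} and b_n = A_n + C_n + d the linear terms of y_n + y_{n+1} and b_n agree: the
  coefficient in \<alpha>_n is the mean of those in A_n and C_{n+1}. So this combination converges, as
  required for off-diagonal entries of quadratic growth.
\<close>

lemma wilson_type:
  fixes H :: "nat \<Rightarrow> real"
  defines "h \<equiv> \<lambda>k. complex_of_real (H k)"
  assumes comm: "commuting h (case_nat 0 \<alpha>) b"
    and ng: "\<not> geometric h" and h0: "h \<longlonglongrightarrow> 0"
    and A: "quad_asymp A (of_real \<kappa>) a" and C: "quad_asymp C (of_real \<kappa>) c" and \<kappa>: "\<kappa> > 0"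
    and \<alpha>: "\<And>n. n \<ge> 1 \<Longrightarrow> \<alpha> n = csqrt (A n * C (Suc n))"
    and b: "\<And>n. n \<ge> 1 \<Longrightarrow> b n = A n + C n + d"
    and nz: "\<And>n. n \<ge> 1 \<Longrightarrow> A n * C (Suc n) \<noteq> 0"
    and rat: "rational_seq (\<lambda>n. A n * C (Suc n))"
  shows "\<exists>t c. t \<notin> \<int>\<^sub>\<le>\<^sub>0 \<and> (\<forall>k. H k = c * (-1) ^ k / (real k + t))"
proof -
  define y where "y = case_nat 0 \<alpha>"
  define \<pi> where "\<pi> = (a + (c + 2 * complex_of_real \<kappa>)) / 2"
  have y_Suc: "y (Suc n) = \<alpha> n" for n by (simp add: y_def)
  have \<alpha>_asymp: "quad_asymp \<alpha> (of_real \<kappa>) \<pi>"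
    unfolding \<pi>_def by (rule quad_asymp_cong[OF quad_asymp_csqrt[OF A quad_asymp_Suc[OF C] \<kappa>]]) (simp add: \<alpha>)
  then obtain q where q: "(\<lambda>n. \<alpha> n - of_real \<kappa> * (of_nat n)\<^sup>2 - \<pi> * of_nat n) \<longlonglongrightarrow> q"
    unfolding quad_asymp_def by blast
  have Y: "(\<lambda>n. y n - of_real \<kappa> * (of_nat n)\<^sup>2 - (\<pi> - 2 * of_real \<kappa>) * of_nat n) \<longlonglongrightarrow> q + (of_real \<kappa> - \<pi>)"
  proof (rule LIMSEQ_imp_Suc)
    show "(\<lambda>n. y (Suc n) - of_real \<kappa> * (of_nat (Suc n))\<^sup>2 - (\<pi> - 2 * of_real \<kappa>) * of_nat (Suc n)) \<longlonglongrightarrow> q + (of_real \<kappa> - \<pi>)"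
      using tendsto_add[OF q tendsto_const[of "of_real \<kappa> - \<pi>"]]
      by (simp add: y_Suc power2_eq_square algebra_simps)
  qed
  have "quad_asymp (\<lambda>n. \<alpha> n + \<alpha> (Suc n) + - (A (Suc n) + C (Suc n)))
     (of_real \<kappa> + of_real \<kappa> + - (of_real \<kappa> + of_real \<kappa>))
     (\<pi> + (\<pi> + 2 * of_real \<kappa>) + - ((a + 2 * of_real \<kappa>) + (c + 2 * of_real \<kappa>)))"
    by (intro quad_asymp_add quad_asymp_uminus \<alpha>_asymp quad_asymp_Suc A C)
  then have "quad_asymp (\<lambda>n. \<alpha> n + \<alpha> (Suc n) - (A (Suc n) + C (Suc n))) 0 0"
    by (simp add: \<pi>_def field_simps)
  then obtain s where s: "(\<lambda>n. \<alpha> n + \<alpha> (Suc n) - (A (Suc n) + C (Suc n))) \<longlonglongrightarrow> s"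
    unfolding quad_asymp_def by auto
  have E: "(\<lambda>n. y n + y (Suc n) - b n) \<longlonglongrightarrow> s - d"
  proof (rule LIMSEQ_imp_Suc)
    show "(\<lambda>n. y (Suc n) + y (Suc (Suc n)) - b (Suc n)) \<longlonglongrightarrow> s - d"
      using tendsto_diff[OF s tendsto_const[of d]] by (simp add: y_Suc b algebra_simps)
  qed
  have ynz: "y n \<noteq> 0" if "n \<ge> 2" for n
  proof -
    from that obtain m where "n = Suc m" "m \<ge> 1" by (cases n) auto
    then show ?thesis using \<alpha>[of m] nz[of m] by (simp add: y_Suc)
  qed
  have ysq: "rational_seq (\<lambda>n. (y n)\<^sup>2)"
    by (rule rational_seq_from_Suc, rule rational_seq_cong[OF rat]) (simp add: y_Suc \<alpha>)
  show ?thesis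
    by (rule quadratic_offdiagonal[OF comm[folded y_def, unfolded h_def] _ ynz ng[unfolded h_def]
          h0[unfolded h_def] ysq _ Y E]) (use \<kappa> in \<open>simp_all add: y_def\<close>)
qed

text \<open>
  Laguerre, Meixner and Meixner-Pollaczek at once. The squared off-diagonal entries are
  l^2 n (n + g), and rigidity leaves g = 0; the remaining recurrence has characteristic
  roots r and s = 1 / r, and a root with |s| \<ge> 1 contributes no null solution.
\<close>

lemma linear_family:
  fixes h :: "nat \<Rightarrow> complex"
  assumes ng: "\<not> geometric h" and h0: "h \<longlonglongrightarrow> 0" and comm: "commuting h y b"
    and y: "\<And>n. y n = of_real (l * sqrt (real n * (real n + g)))" and l: "l > 0" and g: "g > -1"
    and b: "\<And>n. b n = - (of_real l * (r + s)) * of_nat n + c"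
    and rs: "r * s = 1" and s: "norm s \<ge> 1"
  shows False
proof -
  have nn: "0 \<le> real n * (real n + g)" for n using g by (cases n) auto
  have y2: "(y n)\<^sup>2 = of_real (l\<^sup>2) * (of_nat n)\<^sup>2 + of_real (l\<^sup>2 * g) * of_nat n" for n
  proof -
    have "(l * sqrt (real n * (real n + g)))\<^sup>2 = l\<^sup>2 * (real n)\<^sup>2 + l\<^sup>2 * g * real n"
      using nn[of n] by (simp add: power_mult_distrib power2_eq_square algebra_simps)
    then have "complex_of_real ((l * sqrt (real n * (real n + g)))\<^sup>2) = of_real (l\<^sup>2 * (real n)\<^sup>2 + l\<^sup>2 * g * real n)"
      by (simp only:)
    then show ?thesis unfolding y by simp
  qed
  have "(\<lambda>j. sqrt (real (Suc (Suc j)) * (real (Suc (Suc j)) + g)) - 2 * sqrt (real (Suc j) * (real (Suc j) + g))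
      + sqrt (real j * (real j + g))) \<longlonglongrightarrow> 0"
    by real_asymp
  from tendsto_mult[OF tendsto_const[of l] this]
  have "(\<lambda>j. l * sqrt (real (Suc (Suc j)) * (real (Suc (Suc j)) + g)) - 2 * (l * sqrt (real (Suc j) * (real (Suc j) + g)))
      + l * sqrt (real j * (real j + g))) \<longlonglongrightarrow> 0"
    by (simp add: algebra_simps)
  from tendsto_of_real[OF this, where 'a = complex]
  have lim: "second_diff y \<longlonglongrightarrow> 0"
    unfolding second_diff_def[abs_def] y by simp
  have y0: "y 0 = 0" by (simp add: y)
  have ynz: "y n \<noteq> 0" if "n \<ge> 2" for n
    using that l g by (simp add: y)
  note aff = affine_diagonal[OF comm y0 ynz ng b y2 lim]
  from aff(1) have "l\<^sup>2 * g = 0" by (simp only: of_real_eq_0_iff)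
  then have g0: "g = 0" using l by simp
  have y_lin: "y n = of_real l * of_nat n" for n
    by (simp add: y g0)
  have rec: "h (Suc (Suc k)) = (r + s) * h (Suc k) - r * s * h k" for k
  proof -
    have "of_real l * h (Suc (Suc k)) = of_real l * ((r + s) * h (Suc k) - h k)"
      using linear_offdiagonal_recurrence[OF comm y_lin b, of k] by (simp add: algebra_simps)
    then show ?thesis using l rs by simp
  qed
  have "geometric h" by (rule two_term_recurrence_geometric[OF rec s h0])
  with ng show False ..
qed

text \<open>
  Charlier and Hermite: here the squared off-diagonal entries l^2 n are linear in n, whereas
  rigidity requires a pure quadratic.
\<close>

lemma square_root_family:
  fixes h :: "nat \<Rightarrow> complex"
  assumes ng: "\<not> geometric h" and comm: "commuting h y b"
    and y: "\<And>n. y n = of_real (l * sqrt (real n))" and l: "l > 0"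
    and b: "\<And>n. b n = \<mu> * of_nat n + c"
  shows False
proof -
  have y2: "(y n)\<^sup>2 = 0 * (of_nat n)\<^sup>2 + of_real (l\<^sup>2) * of_nat n" for n
  proof -
    have "(l * sqrt (real n))\<^sup>2 = l\<^sup>2 * real n"
      by (simp add: power_mult_distrib)
    then have "complex_of_real ((l * sqrt (real n))\<^sup>2) = of_real (l\<^sup>2 * real n)"
      by (simp only:)
    then show ?thesis unfolding y by simp
  qed
  have "(\<lambda>j. sqrt (real (Suc (Suc j))) - 2 * sqrt (real (Suc j)) + sqrt (real j)) \<longlonglongrightarrow> 0"
    by real_asymp
  from tendsto_mult[OF tendsto_const[of l] this]
  have "(\<lambda>j. l * sqrt (real (Suc (Suc j))) - 2 * (l * sqrt (real (Suc j))) + l * sqrt (real j)) \<longlonglongrightarrow> 0"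
    by (simp add: algebra_simps)
  from tendsto_of_real[OF this, where 'a = complex]
  have lim: "second_diff y \<longlonglongrightarrow> 0"
    unfolding second_diff_def[abs_def] y by simp
  have y0: "y 0 = 0" by (simp add: y)
  have ynz: "y n \<noteq> 0" if "n \<ge> 2" for n
    using that l by (simp add: y)
  from affine_diagonal(1)[OF comm y0 ynz ng b y2 lim] l show False by simp
qed

lemma case_nat_eqI:
  assumes "f 0 = 0" "\<And>n. f (Suc n) = a n"
  shows "case_nat 0 a n = f n"
  using assms by (cases n) simp_all

lemma laguerre_no_commuting:
  assumes ng: "\<not> geometric h" and h0: "h \<longlonglongrightarrow> 0" and a: "a > -1"
    and comm: "commuting h (case_nat 0 (\<lambda>n. of_real (laguerre_alpha a n))) (\<lambda>n. of_real (laguerre_beta a n))"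
  shows False
proof (rule linear_family[OF ng h0 comm, of 1 a "-1" "-1" "of_real (a + 1)"])
  show "case_nat 0 (\<lambda>n. complex_of_real (laguerre_alpha a n)) n = of_real (1 * sqrt (real n * (real n + a)))" for n
    by (rule case_nat_eqI) (simp_all add: laguerre_alpha_def algebra_simps)
qed (use a in \<open>simp_all add: laguerre_beta_def\<close>)

lemma meixner_no_commuting:
  assumes ng: "\<not> geometric h" and h0: "h \<longlonglongrightarrow> 0" and \<beta>: "\<beta> > 0" and c: "0 < c" "c < 1"
    and comm: "commuting h (case_nat 0 (\<lambda>n. of_real (meixner_alpha \<beta> c n))) (\<lambda>n. of_real (meixner_beta \<beta> c n))"
  shows False
proof (rule linear_family[OF ng h0 comm, of "sqrt c / (1 - c)" "\<beta> - 1" "of_real (- sqrt c)"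
      "of_real (- (1 / sqrt c))" "of_real (\<beta> * c / (1 - c))"])
  show "case_nat 0 (\<lambda>n. complex_of_real (meixner_alpha \<beta> c n)) n
      = of_real (sqrt c / (1 - c) * sqrt (real n * (real n + (\<beta> - 1))))" for n
  proof (rule case_nat_eqI[where f = "\<lambda>n. of_real (sqrt c / (1 - c) * sqrt (real n * (real n + (\<beta> - 1))))"])
    fix n
    have "c * (real n + 1) * (real n + \<beta>) = c * (real (Suc n) * (real (Suc n) + (\<beta> - 1)))"
      by (simp add: algebra_simps)
    then have "meixner_alpha \<beta> c n = sqrt c / (1 - c) * sqrt (real (Suc n) * (real (Suc n) + (\<beta> - 1)))"
      unfolding meixner_alpha_def by (simp only: real_sqrt_mult[of c] times_divide_eq_left)
    then show "of_real (sqrt c / (1 - c) * sqrt (real (Suc n) * (real (Suc n) + (\<beta> - 1))))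
      = complex_of_real (meixner_alpha \<beta> c n)"
      by (simp only:)
  qed simp
  show "complex_of_real (meixner_beta \<beta> c n) =
      - (complex_of_real (sqrt c / (1 - c)) * (of_real (- sqrt c) + of_real (- (1 / sqrt c)))) * of_nat n
      + of_real (\<beta> * c / (1 - c))" for n
  proof -
    have "sqrt c * (- sqrt c + - (1 / sqrt c)) = - (1 + c)"
      using c by (simp add: right_diff_distrib)
    then have "sqrt c / (1 - c) * (- sqrt c + - (1 / sqrt c)) = - (1 + c) / (1 - c)"
      by (simp only: times_divide_eq_left)
    then have "meixner_beta \<beta> c n = - (sqrt c / (1 - c) * (- sqrt c + - (1 / sqrt c))) * real n + \<beta> * c / (1 - c)"
      by (simp only:) (simp add: meixner_beta_def add_divide_distrib[symmetric] algebra_simps)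
    then have "complex_of_real (meixner_beta \<beta> c n) =
      of_real (- (sqrt c / (1 - c) * (- sqrt c + - (1 / sqrt c))) * real n + \<beta> * c / (1 - c))"
      by (simp only:)
    then show ?thesis by simp
  qed
  show "complex_of_real (- sqrt c) * of_real (- (1 / sqrt c)) = 1"
    using c by (simp flip: of_real_mult)
  show "1 \<le> norm (complex_of_real (- (1 / sqrt c)))"
    using c unfolding norm_of_real by simp
qed (use \<beta> c in simp_all)

lemma meixner_pollaczek_no_commuting:
  assumes ng: "\<not> geometric h" and h0: "h \<longlonglongrightarrow> 0" and l: "l > 0" and \<phi>: "0 < \<phi>" "\<phi> < pi"
    and comm: "commuting h (case_nat 0 (\<lambda>n. of_real (meixner_pollaczek_alpha l \<phi> n)))
       (\<lambda>n. of_real (meixner_pollaczek_beta l \<phi> n))"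
  shows False
proof (rule linear_family[OF ng h0 comm, of "1 / (2 * sin \<phi>)" "2 * l - 1" "cis \<phi>" "cis (- \<phi>)"
      "of_real (- l * cos \<phi> / sin \<phi>)"])
  have sin: "sin \<phi> > 0" using \<phi> by (rule sin_gt_zero)
  then show "1 / (2 * sin \<phi>) > 0" by simp
  show "case_nat 0 (\<lambda>n. complex_of_real (meixner_pollaczek_alpha l \<phi> n)) n
      = of_real (1 / (2 * sin \<phi>) * sqrt (real n * (real n + (2 * l - 1))))" for n
    by (rule case_nat_eqI) (simp_all add: meixner_pollaczek_alpha_def algebra_simps)
  show "complex_of_real (meixner_pollaczek_beta l \<phi> n) =
      - (of_real (1 / (2 * sin \<phi>)) * (cis \<phi> + cis (- \<phi>))) * of_nat n + of_real (- l * cos \<phi> / sin \<phi>)" for n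
  proof -
    have "meixner_pollaczek_beta l \<phi> n = - (1 / (2 * sin \<phi>) * (2 * cos \<phi>)) * real n + - l * cos \<phi> / sin \<phi>"
    proof (cases "\<phi> = pi / 2")
      case True
      then have "cos \<phi> = 0" by (simp only: cos_pi_half)
      with True show ?thesis by (simp only: meixner_pollaczek_beta_def) simp
    next
      case False
      have "- ((real n + l) / tan \<phi>) = - (1 / (2 * sin \<phi>) * (2 * cos \<phi>)) * real n + - l * cos \<phi> / sin \<phi>"
        by (simp add: tan_def add_divide_distrib[symmetric] algebra_simps)
      with False show ?thesis by (simp add: meixner_pollaczek_beta_def)
    qed
    then have "complex_of_real (meixner_pollaczek_beta l \<phi> n) =
        of_real (- (1 / (2 * sin \<phi>) * (2 * cos \<phi>)) * real n + - l * cos \<phi> / sin \<phi>)"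
      by (simp only:)
    moreover have "cis \<phi> + cis (- \<phi>) = of_real (2 * cos \<phi>)"
      by (simp add: complex_eq_iff)
    ultimately show ?thesis by simp
  qed
qed (use l in \<open>simp_all add: cis_mult\<close>)

lemma charlier_no_commuting:
  assumes ng: "\<not> geometric h" and a: "a > 0"
    and comm: "commuting h (case_nat 0 (\<lambda>n. of_real (charlier_alpha a n))) (\<lambda>n. of_real (charlier_beta a n))"
  shows False
proof (rule square_root_family[OF ng comm, of "sqrt a" 1 "of_real a"])
  show "case_nat 0 (\<lambda>n. complex_of_real (charlier_alpha a n)) n = of_real (sqrt a * sqrt (real n))" for n
    by (rule case_nat_eqI) (simp_all add: charlier_alpha_def real_sqrt_mult add.commute)
qed (use a in \<open>simp_all add: charlier_beta_def\<close>)

lemma hermite_no_commuting: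
  assumes ng: "\<not> geometric h"
    and comm: "commuting h (case_nat 0 (\<lambda>n. of_real (hermite_alpha n))) (\<lambda>n. of_real (hermite_beta n))"
  shows False
proof (rule square_root_family[OF ng comm, of "sqrt (1 / 2)" 0 0])
  show "case_nat 0 (\<lambda>n. complex_of_real (hermite_alpha n)) n = of_real (sqrt (1 / 2) * sqrt (real n))" for n
    by (rule case_nat_eqI) (simp_all add: hermite_alpha_def real_sqrt_divide add.commute)
qed (simp_all add: hermite_beta_def)

section \<open>Wilson and continuous dual Hahn\<close>

text \<open>
  All factors in the coefficients involve only sums of two parameters, and both alternatives
  of admissibility make the real parts of these sums positive: for a < 0 one has
  b + c = (a + b) + (a + c) - 2 a.
\<close>

lemma admissible_pair_sums_4:
  assumes "positive_or_conj_pairs {#a, b, c, d#} \<or>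
     (\<exists>a' b' c' d'. {#a', b', c', d'#} = {#a, b, c, d#} \<and> a' \<in> \<real> \<and> Re a' < 0 \<and>
        positive_or_conj_pairs {#a' + b', a' + c', a' + d'#})"
  shows "0 < Re (a + b) \<and> 0 < Re (a + c) \<and> 0 < Re (a + d) \<and> 0 < Re (b + c) \<and> 0 < Re (b + d) \<and> 0 < Re (c + d)"
  using assms
proof
  assume "positive_or_conj_pairs {#a, b, c, d#}"
  then show ?thesis by (simp add: positive_or_conj_pairs_def)
next
  define P where "P M \<longleftrightarrow> (\<forall>x\<in>#M. \<forall>y\<in>#M - {#x#}. 0 < Re (x + y))" for M
  assume "\<exists>a' b' c' d'. {#a', b', c', d'#} = {#a, b, c, d#} \<and> a' \<in> \<real> \<and> Re a' < 0 \<and>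
        positive_or_conj_pairs {#a' + b', a' + c', a' + d'#}"
  then obtain a' b' c' d' where eq: "{#a', b', c', d'#} = {#a, b, c, d#}" and neg: "Re a' < 0"
    and pos: "0 < Re (a' + b')" "0 < Re (a' + c')" "0 < Re (a' + d')"
    by (auto simp: positive_or_conj_pairs_def)
  have "P {#a', b', c', d'#}"
    using neg pos by (auto simp: P_def split: if_splits)
  then have "P {#a, b, c, d#}" by (simp only: eq)
  then show ?thesis by (simp add: P_def)
qed

lemma admissible_pair_sums_3:
  assumes "positive_or_conj_pairs {#a, b, c#} \<or>
     (\<exists>a' b' c'. {#a', b', c'#} = {#a, b, c#} \<and> a' \<in> \<real> \<and> Re a' < 0 \<and>
        positive_or_conj_pairs {#a' + b', a' + c'#})"
  shows "0 < Re (a + b) \<and> 0 < Re (a + c) \<and> 0 < Re (b + c)"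
  using assms
proof
  assume "positive_or_conj_pairs {#a, b, c#}"
  then show ?thesis by (simp add: positive_or_conj_pairs_def)
next
  define P where "P M \<longleftrightarrow> (\<forall>x\<in>#M. \<forall>y\<in>#M - {#x#}. 0 < Re (x + y))" for M
  assume "\<exists>a' b' c'. {#a', b', c'#} = {#a, b, c#} \<and> a' \<in> \<real> \<and> Re a' < 0 \<and>
        positive_or_conj_pairs {#a' + b', a' + c'#}"
  then obtain a' b' c' where eq: "{#a', b', c'#} = {#a, b, c#}" and neg: "Re a' < 0"
    and pos: "0 < Re (a' + b')" "0 < Re (a' + c')"
    by (auto simp: positive_or_conj_pairs_def)
  have "P {#a', b', c'#}"
    using neg pos by (auto simp: P_def split: if_splits)
  then have "P {#a, b, c#}" by (simp only: eq)
  then show ?thesis by (simp add: P_def)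
qed

lemma rat_value_wilson_A:
  assumes "rat_value N x n" "2 * n + (a + b + c + d) - 1 \<noteq> 0" "2 * n + (a + b + c + d) \<noteq> 0"
  shows "rat_value (wilson_A (rat_const a) (rat_const b) (rat_const c) (rat_const d) N) x (wilson_A a b c d n)"
  unfolding wilson_A_def Let_def
  by (intro rat_value_intros assms(1)) (use assms(2,3) in simp)

lemma rat_value_wilson_C:
  assumes "rat_value N x n" "2 * n + (a + b + c + d) - 2 \<noteq> 0" "2 * n + (a + b + c + d) - 1 \<noteq> 0"
  shows "rat_value (wilson_C (rat_const a) (rat_const b) (rat_const c) (rat_const d) N) x (wilson_C a b c d n)"
  unfolding wilson_C_def Let_def
  by (intro rat_value_intros assms(1)) (use assms(2,3) in simp)

lemma rat_value_chahn_A: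
  assumes "rat_value N x n" "2 * n + (a + b + c + d) - 1 \<noteq> 0" "2 * n + (a + b + c + d) \<noteq> 0"
  shows "rat_value (chahn_A (rat_const a) (rat_const b) (rat_const c) (rat_const d) N) x (chahn_A a b c d n)"
  unfolding chahn_A_def Let_def
  by (intro rat_value_intros assms(1)) (use assms(2,3) in simp)

lemma rat_value_chahn_C:
  assumes "rat_value N x n" "2 * n + (a + b + c + d) - 2 \<noteq> 0" "2 * n + (a + b + c + d) - 1 \<noteq> 0"
  shows "rat_value (chahn_C (rat_const a) (rat_const b) (rat_const c) (rat_const d) N) x (chahn_C a b c d n)"
  unfolding chahn_C_def Let_def
  by (intro rat_value_intros assms(1)) (use assms(2,3) in simp)

text \<open>
  At n = 0 the denominators may vanish (for s = 1 or s = 2), so only indices n \<ge> 1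
  are evaluated.
\<close>

lemma denominators_neq_0:
  fixes s :: complex
  assumes "0 < Re s" "n \<ge> 1"
  shows "2 * of_nat n + s - 2 \<noteq> 0" "2 * of_nat n + s - 1 \<noteq> 0" "2 * of_nat n + s \<noteq> 0"
    "2 * (of_nat n + 1) + s - 2 \<noteq> 0" "2 * (of_nat n + 1) + s - 1 \<noteq> 0" "2 * (of_nat n + 1) + s \<noteq> 0"
    "of_nat n + s - 1 \<noteq> 0"
proof -
  have "real n \<ge> 1" using assms(2) by simp
  then show "2 * of_nat n + s - 2 \<noteq> 0" "2 * of_nat n + s - 1 \<noteq> 0" "2 * of_nat n + s \<noteq> 0"
    "2 * (of_nat n + 1) + s - 2 \<noteq> 0" "2 * (of_nat n + 1) + s - 1 \<noteq> 0" "2 * (of_nat n + 1) + s \<noteq> 0"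
    "of_nat n + s - 1 \<noteq> 0"
    using assms(1) by - (rule Re_pos_neq_0, simp)+
qed

lemma factor_form_4_2:
  fixes n :: complex
  assumes "n \<noteq> 0"
  shows "p1 * p2 * p3 * p4 / ((2 * w1) * (2 * w2)) =
    n\<^sup>2 * (1 / 4 * (p1 / n) * (p2 / n) * (p3 / n) * (p4 / n) * (n / w1) * (n / w2))"
  using assms by (cases "w1 = 0"; cases "w2 = 0") (simp_all add: field_simps power2_eq_square)

lemma expands_factor_form_4_2:
  "\<exists>p. expands (\<lambda>n. 1 / 4 * ((of_nat n + u1) / of_nat n) * ((of_nat n + u2) / of_nat n)
      * ((of_nat n + u3) / of_nat n) * ((of_nat n + u4) / of_nat n)
      * (of_nat n / (of_nat n + w1)) * (of_nat n / (of_nat n + w2))) (1 / 4) p"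
  using expands_mult[OF expands_mult[OF expands_mult[OF expands_mult[OF expands_mult[OF expands_mult[OF
      expands_const[of "1 / 4"] expands_linear[of u1]] expands_linear[of u2]] expands_linear[of u3]]
      expands_linear[of u4]] expands_inverse_linear[of w1]] expands_inverse_linear[of w2]]
  by auto

lemma wilson_A_factor_form:
  "wilson_A a b c d n = (n + (a + b)) * (n + (a + c)) * (n + (a + d)) * (n + (a + b + c + d - 1))
     / ((2 * (n + (a + b + c + d - 1) / 2)) * (2 * (n + (a + b + c + d) / 2)))" for n :: complex
proof -
  have "2 * n + (a + b + c + d) - 1 = 2 * (n + (a + b + c + d - 1) / 2)"
    "2 * n + (a + b + c + d) = 2 * (n + (a + b + c + d) / 2)"
    "n + a + b = n + (a + b)" "n + a + c = n + (a + c)" "n + a + d = n + (a + d)"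
    "n + (a + b + c + d) - 1 = n + (a + b + c + d - 1)"
    by (simp_all add: field_simps)
  then show ?thesis unfolding wilson_A_def Let_def by (simp only:)
qed

lemma wilson_C_factor_form:
  "wilson_C a b c d n = (n + 0) * (n + (b + c - 1)) * (n + (b + d - 1)) * (n + (c + d - 1))
     / ((2 * (n + (a + b + c + d - 2) / 2)) * (2 * (n + (a + b + c + d - 1) / 2)))" for n :: complex
proof -
  have "2 * n + (a + b + c + d) - 2 = 2 * (n + (a + b + c + d - 2) / 2)"
    "2 * n + (a + b + c + d) - 1 = 2 * (n + (a + b + c + d - 1) / 2)"
    "n + b + c - 1 = n + (b + c - 1)" "n + b + d - 1 = n + (b + d - 1)" "n + c + d - 1 = n + (c + d - 1)"
    by (simp_all add: field_simps)
  then show ?thesis unfolding wilson_C_def Let_def by (simp only: add_0_right)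
qed

lemma rational_seq_factor_form_4_2:
  "rational_seq (\<lambda>n. (of_nat n + u1) * (of_nat n + u2) * (of_nat n + u3) * (of_nat n + u4)
     / ((2 * (of_nat n + w1)) * (2 * (of_nat n + w2))))"
proof -
  have "rational_seq (\<lambda>n. (1 / 4) * ((of_nat n + u1) * (of_nat n + u2) * (of_nat n + u3) * (of_nat n + u4)
     * inverse (of_nat n + w1) * inverse (of_nat n + w2)))"
    by (intro rational_seq_mult rational_seq_const rational_seq_linear rational_seq_inverse_linear)
  then show ?thesis by (simp add: field_simps)
qed

lemma rational_seq_wilson_A: "rational_seq (\<lambda>n. wilson_A a b c d (of_nat n))"
  unfolding wilson_A_factor_form by (rule rational_seq_factor_form_4_2)

lemma rational_seq_wilson_C_Suc: "rational_seq (\<lambda>n. wilson_C a b c d (of_nat (Suc n)))"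
proof -
  have "of_nat (Suc n) + u = of_nat n + (1 + u)" for n and u :: complex by simp
  then show ?thesis
    unfolding wilson_C_factor_form by (simp only: rational_seq_factor_form_4_2)
qed

lemma quad_asymp_factor_form_4_2:
  "\<exists>p. quad_asymp (\<lambda>n. (of_nat n + u1) * (of_nat n + u2) * (of_nat n + u3) * (of_nat n + u4)
     / ((2 * (of_nat n + w1)) * (2 * (of_nat n + w2)))) (1 / 4) p"
proof -
  obtain p where p: "expands (\<lambda>n. 1 / 4 * ((of_nat n + u1) / of_nat n) * ((of_nat n + u2) / of_nat n)
      * ((of_nat n + u3) / of_nat n) * ((of_nat n + u4) / of_nat n)
      * (of_nat n / (of_nat n + w1)) * (of_nat n / (of_nat n + w2))) (1 / 4) p"
    using expands_factor_form_4_2 ..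
  show ?thesis
    by (rule exI, rule quad_asymp_from_expands[OF p], rule factor_form_4_2) simp
qed

lemma quad_asymp_wilson_A: "\<exists>p. quad_asymp (\<lambda>n. wilson_A a b c d (of_nat n)) (1 / 4) p"
  unfolding wilson_A_factor_form by (rule quad_asymp_factor_form_4_2)

lemma quad_asymp_wilson_C: "\<exists>p. quad_asymp (\<lambda>n. wilson_C a b c d (of_nat n)) (1 / 4) p"
  unfolding wilson_C_factor_form by (rule quad_asymp_factor_form_4_2)

lemma wilson_commuting:
  fixes H :: "nat \<Rightarrow> real"
  defines "h \<equiv> \<lambda>k. complex_of_real (H k)"
  assumes adm: "wilson_admissible a b c d"
    and comm: "commuting h (case_nat 0 (wilson_alpha a b c d)) (wilson_beta a b c d)"
    and ng: "\<not> geometric h" and h0: "h \<longlonglongrightarrow> 0"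
  shows "\<exists>t c. t \<notin> \<int>\<^sub>\<le>\<^sub>0 \<and> (\<forall>k. H k = c * (-1) ^ k / (real k + t))"
proof -
  note pos = admissible_pair_sums_4[OF adm[unfolded wilson_admissible_def]]
  define s where "s = a + b + c + d"
  have s: "0 < Re s" using pos by (simp add: s_def)
  note den = denominators_neq_0[OF s, unfolded s_def]
  define A where "A n = wilson_A a b c d (of_nat n)" for n
  define C where "C n = wilson_C a b c d (of_nat n)" for n
  obtain p q where p: "quad_asymp A (1 / 4) p" and q: "quad_asymp C (1 / 4) q"
    using quad_asymp_wilson_A[of a b c d] quad_asymp_wilson_C[of a b c d]
    unfolding A_def[abs_def] C_def[abs_def] by blast
  have alpha: "wilson_alpha a b c d n = csqrt (A n * C (Suc n))" if n: "n \<ge> 1" for n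
  proof -
    have "eval_rat (wilson_A (rat_const a) (rat_const b) (rat_const c) (rat_const d) rat_var
        * wilson_C (rat_const a) (rat_const b) (rat_const c) (rat_const d) (rat_var + 1)) (of_nat n)
      = wilson_A a b c d (of_nat n) * wilson_C a b c d (of_nat n + 1)"
      by (intro eval_rat_eq rat_value_mult rat_value_wilson_A rat_value_wilson_C rat_value_var
          rat_value_add rat_value_1 den[OF n])
    then show ?thesis by (simp add: wilson_alpha_def A_def C_def add.commute)
  qed
  have beta: "wilson_beta a b c d n = A n + C n + - a\<^sup>2" if n: "n \<ge> 1" for n
  proof -
    have "eval_rat (wilson_A (rat_const a) (rat_const b) (rat_const c) (rat_const d) rat_var
        + wilson_C (rat_const a) (rat_const b) (rat_const c) (rat_const d) rat_var
        - (rat_const a)\<^sup>2) (of_nat n)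
      = wilson_A a b c d (of_nat n) + wilson_C a b c d (of_nat n) - a\<^sup>2"
      by (intro eval_rat_eq rat_value_add rat_value_diff rat_value_wilson_A rat_value_wilson_C rat_value_var
          rat_value_power2 rat_value_const den[OF n])
    then show ?thesis by (simp add: wilson_beta_def A_def C_def)
  qed
  have nz: "A n * C (Suc n) \<noteq> 0" if n: "n \<ge> 1" for n
  proof -
    have "of_nat n + a + b \<noteq> 0" "of_nat n + a + c \<noteq> 0" "of_nat n + a + d \<noteq> 0"
      "of_nat n + 1 + b + c - 1 \<noteq> 0" "of_nat n + 1 + b + d - 1 \<noteq> 0" "of_nat n + 1 + c + d - 1 \<noteq> 0"
      "of_nat n + 1 \<noteq> (0 :: complex)"
      using pos by - (rule Re_pos_neq_0, simp)+
    moreover have "of_nat (Suc n) = of_nat n + (1 :: complex)" by simp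
    ultimately show ?thesis
      using den[OF n] by (simp only: A_def C_def wilson_A_def wilson_C_def Let_def) simp
  qed
  have rat: "rational_seq (\<lambda>n. A n * C (Suc n))"
    unfolding A_def C_def by (intro rational_seq_mult rational_seq_wilson_A rational_seq_wilson_C_Suc)
  show ?thesis
    by (rule wilson_type[OF comm[unfolded h_def] ng[unfolded h_def] h0[unfolded h_def], of A "1 / 4" p C q "- a\<^sup>2"])
      (use p q alpha beta nz rat in simp_all)
qed

lemma cdhahn_commuting:
  fixes H :: "nat \<Rightarrow> real"
  defines "h \<equiv> \<lambda>k. complex_of_real (H k)"
  assumes adm: "cdhahn_admissible a b c"
    and comm: "commuting h (case_nat 0 (cdhahn_alpha a b c)) (cdhahn_beta a b c)"
    and ng: "\<not> geometric h" and h0: "h \<longlonglongrightarrow> 0"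
  shows "\<exists>t c. t \<notin> \<int>\<^sub>\<le>\<^sub>0 \<and> (\<forall>k. H k = c * (-1) ^ k / (real k + t))"
proof -
  note pos = admissible_pair_sums_3[OF adm[unfolded cdhahn_admissible_def]]
  define A where "A n = (of_nat n + (a + b)) * (of_nat n + (a + c))" for n
  define C where "C n = (of_nat n + 0) * (of_nat n + (b + c - 1))" for n
  have prod: "quad_asymp (\<lambda>n. (of_nat n + u) * (of_nat n + v)) 1 (v + u)" for u v
  proof (rule quad_asymp_from_expands)
    show "expands (\<lambda>n. ((of_nat n + u) / of_nat n) * ((of_nat n + v) / of_nat n)) 1 (v + u)"
      using expands_mult[OF expands_linear[of u] expands_linear[of v]] by (simp only: mult_1 mult_1_right)
  qed (simp add: power2_eq_square)
  have alpha: "cdhahn_alpha a b c n = csqrt (A n * C (Suc n))" for n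
    by (simp add: cdhahn_alpha_def A_def C_def add_ac mult_ac)
  have beta: "cdhahn_beta a b c n = A n + C n + - a\<^sup>2" for n
    by (simp add: cdhahn_beta_def A_def C_def power2_eq_square algebra_simps)
  have nz: "A n * C (Suc n) \<noteq> 0" for n
  proof -
    have "of_nat n + (a + b) \<noteq> 0" "of_nat n + (a + c) \<noteq> 0" "of_nat n + (b + c) \<noteq> 0"
      "of_nat n + 1 \<noteq> (0 :: complex)"
      using pos by - (rule Re_pos_neq_0, simp)+
    then show ?thesis by (simp add: A_def C_def add_ac)
  qed
  have rat: "rational_seq (\<lambda>n. A n * C (Suc n))"
  proof -
    have "A n * C (Suc n) = (of_nat n + (a + b)) * (of_nat n + (a + c)) * ((of_nat n + 1) * (of_nat n + (b + c)))" for n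
      by (simp add: A_def C_def add_ac)
    then show ?thesis by (simp only:) (intro rational_seq_mult rational_seq_linear)
  qed
  show ?thesis
    by (rule wilson_type[OF comm[unfolded h_def] ng[unfolded h_def] h0[unfolded h_def],
          of A 1 "a + c + (a + b)" C "b + c - 1 + 0" "- a\<^sup>2"])
      (use prod[of "a + b" "a + c"] prod[of 0 "b + c - 1"] alpha beta nz rat in
        \<open>simp_all add: A_def[abs_def] C_def[abs_def]\<close>)
qed

section \<open>Continuous Hahn and Jacobi\<close>

text \<open>
  The relations are linear in the matrix entries and h is real, so the real parts of the
  entries satisfy them as well. This avoids showing that the entries are real.
\<close>

lemma commuting_Re:
  fixes H :: "nat \<Rightarrow> real"
  assumes "commuting (\<lambda>k. complex_of_real (H k)) y b"
  shows "commuting (\<lambda>k. complex_of_real (H k)) (\<lambda>n. of_real (Re (y n))) (\<lambda>n. of_real (Re (b n)))"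
  unfolding commuting_def
proof (intro allI impI)
  fix m n k :: nat
  assume "m + n = Suc k"
  from arg_cong[OF commutingD[OF assms this], of Re]
  have "(Re (y n) - Re (y m)) * H k + (Re (b n) - Re (b m)) * H (Suc k)
      + (Re (y (Suc n)) - Re (y (Suc m))) * H (Suc (Suc k)) = 0"
    by simp
  from arg_cong[OF this, of complex_of_real]
  show "(complex_of_real (Re (y n)) - of_real (Re (y m))) * of_real (H k)
      + (of_real (Re (b n)) - of_real (Re (b m))) * of_real (H (Suc k))
      + (of_real (Re (y (Suc n))) - of_real (Re (y (Suc m)))) * of_real (H (Suc (Suc k))) = 0"
    by simp
qed

lemma chahn_neg_A_factor_form:
  "n * (- chahn_A a b c d n) = (n + 0) * (n + (a + b + c + d - 1)) * (n + (a + c)) * (n + (a + d))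
     / ((2 * (n + (a + b + c + d - 1) / 2)) * (2 * (n + (a + b + c + d) / 2)))" for n :: complex
proof -
  have "2 * n + (a + b + c + d) - 1 = 2 * (n + (a + b + c + d - 1) / 2)"
    "2 * n + (a + b + c + d) = 2 * (n + (a + b + c + d) / 2)"
    "n + a + c = n + (a + c)" "n + a + d = n + (a + d)"
    "n + (a + b + c + d) - 1 = n + (a + b + c + d - 1)"
    by (simp_all add: field_simps)
  then show ?thesis unfolding chahn_A_def Let_def
    by (simp only: add_0_right minus_minus times_divide_eq_right mult.assoc)
qed

lemma chahn_C_factor_form:
  "n * chahn_C a b c d n = (n + 0) * (n + 0) * (n + (b + c - 1)) * (n + (b + d - 1))
     / ((2 * (n + (a + b + c + d - 2) / 2)) * (2 * (n + (a + b + c + d - 1) / 2)))" for n :: complex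
proof -
  have "2 * n + (a + b + c + d) - 2 = 2 * (n + (a + b + c + d - 2) / 2)"
    "2 * n + (a + b + c + d) - 1 = 2 * (n + (a + b + c + d - 1) / 2)"
    "n + b + c - 1 = n + (b + c - 1)" "n + b + d - 1 = n + (b + d - 1)"
    by (simp_all add: field_simps)
  then show ?thesis unfolding chahn_C_def Let_def
    by (simp only: add_0_right times_divide_eq_right mult.assoc)
qed

lemma chahn_C_Suc_factor_form:
  "n * chahn_C a b c d (n + 1) = (n + 0) * (n + 1) * (n + (b + c)) * (n + (b + d))
     / ((2 * (n + (a + b + c + d) / 2)) * (2 * (n + (a + b + c + d + 1) / 2)))" for n :: complex
proof -
  have "2 * (n + 1) + (a + b + c + d) - 2 = 2 * (n + (a + b + c + d) / 2)"
    "2 * (n + 1) + (a + b + c + d) - 1 = 2 * (n + (a + b + c + d + 1) / 2)"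
    "n + 1 + b + c - 1 = n + (b + c)" "n + 1 + b + d - 1 = n + (b + d)"
    by (simp_all add: field_simps)
  then show ?thesis unfolding chahn_C_def Let_def
    by (simp only: add_0_right times_divide_eq_right mult.assoc)
qed

text \<open>
  The factor n turns the coefficients, which grow linearly, into the shape of the Wilson
  coefficients. The linear parts of A and C cancel in the diagonal.
\<close>

lemma chahn_no_commuting:
  fixes H :: "nat \<Rightarrow> real"
  defines "h \<equiv> \<lambda>k. complex_of_real (H k)"
  assumes adm: "chahn_admissible a b c d"
    and comm: "commuting h (case_nat 0 (chahn_alpha a b c d)) (chahn_beta a b c d)"
    and ng: "\<not> geometric h" and h0: "h \<longlonglongrightarrow> 0"
  shows False
proof -
  have pos: "0 < Re (a + c)" "0 < Re (a + d)" "0 < Re (b + c)" "0 < Re (b + d)"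
    using adm by (auto simp: chahn_admissible_def)
  have s: "0 < Re (a + b + c + d)" using pos by simp
  note den = denominators_neq_0[OF s]
  define A where "A n = chahn_A a b c d (of_nat n)" for n
  define C where "C n = chahn_C a b c d (of_nat n)" for n
  define y where "y = case_nat 0 (chahn_alpha a b c d)"
  have alpha: "chahn_alpha a b c d n = csqrt (- (A n * C (Suc n)))" if n: "n \<ge> 1" for n
  proof -
    have "eval_rat (- (chahn_A (rat_const a) (rat_const b) (rat_const c) (rat_const d) rat_var
        * chahn_C (rat_const a) (rat_const b) (rat_const c) (rat_const d) (rat_var + 1))) (of_nat n)
      = - (chahn_A a b c d (of_nat n) * chahn_C a b c d (of_nat n + 1))"
      by (intro eval_rat_eq rat_value_uminus rat_value_mult rat_value_chahn_A rat_value_chahn_C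
          rat_value_var rat_value_add rat_value_1 den[OF n])
    then show ?thesis by (simp add: chahn_alpha_def A_def C_def add.commute)
  qed
  have beta: "chahn_beta a b c d n = \<i> * (A n + C n + a)" if n: "n \<ge> 1" for n
  proof -
    have "eval_rat (chahn_A (rat_const a) (rat_const b) (rat_const c) (rat_const d) rat_var
        + chahn_C (rat_const a) (rat_const b) (rat_const c) (rat_const d) rat_var
        + rat_const a) (of_nat n)
      = chahn_A a b c d (of_nat n) + chahn_C a b c d (of_nat n) + a"
      by (intro eval_rat_eq rat_value_add rat_value_chahn_A rat_value_chahn_C rat_value_var
          rat_value_const den[OF n])
    then show ?thesis by (simp add: chahn_beta_def A_def C_def)
  qed
  have nz: "- (A n * C (Suc n)) \<noteq> 0" if n: "n \<ge> 1" for n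
  proof -
    have "of_nat n + a + c \<noteq> 0" "of_nat n + a + d \<noteq> 0"
      "of_nat n + 1 + b + c - 1 \<noteq> 0" "of_nat n + 1 + b + d - 1 \<noteq> 0" "of_nat n + 1 \<noteq> (0 :: complex)"
      using pos by - (rule Re_pos_neq_0, simp)+
    moreover have "of_nat (Suc n) = of_nat n + (1 :: complex)" by simp
    ultimately show ?thesis
      using den[OF n] by (simp only: A_def C_def chahn_A_def chahn_C_def Let_def) simp
  qed
  have ynz: "y n \<noteq> 0" if "n \<ge> 2" for n
  proof -
    from that obtain m where "n = Suc m" "m \<ge> 1" by (cases n) auto
    then show ?thesis using alpha[of m] nz[of m] by (simp add: y_def)
  qed
  have y0: "y 0 = 0" by (simp add: y_def)
  have "\<exists>K. \<forall>k\<ge>K. h k \<noteq> 0 \<or> h (Suc k) \<noteq> 0"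
    by (rule no_consecutive_zeros[OF comm[folded y_def] y0 ynz ng])
  then obtain K where K: "\<And>k. k \<ge> K \<Longrightarrow> h k \<noteq> 0 \<or> h (Suc k) \<noteq> 0" by blast
  obtain p1 where p1: "quad_asymp (\<lambda>n. of_nat n * - A n) (1 / 4) p1"
    unfolding A_def chahn_neg_A_factor_form using quad_asymp_factor_form_4_2 by blast
  obtain p2 where p2: "quad_asymp (\<lambda>n. of_nat n * C n) (1 / 4) p2"
    unfolding C_def chahn_C_factor_form using quad_asymp_factor_form_4_2 by blast
  obtain p3 where p3: "quad_asymp (\<lambda>n. of_nat n * C (Suc n)) (1 / 4) p3"
  proof -
    have C_Suc: "C (Suc n) = chahn_C a b c d (of_nat n + 1)" for n by (simp add: C_def add.commute)
    show thesis using that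
      unfolding C_Suc chahn_C_Suc_factor_form using quad_asymp_factor_form_4_2 by blast
  qed
  have "quad_asymp (\<lambda>n. csqrt ((of_nat n * - A n) * (of_nat n * C (Suc n)))) (of_real (1 / 4)) ((p1 + p3) / 2)"
    by (rule quad_asymp_csqrt) (use p1 p3 in simp_all)
  then have "quad_asymp (\<lambda>n. of_nat n * y (Suc n)) (of_real (1 / 4)) ((p1 + p3) / 2)"
  proof (rule quad_asymp_cong)
    fix n :: nat
    assume n: "n \<ge> 1"
    have "csqrt ((of_nat n * - A n) * (of_nat n * C (Suc n))) = csqrt ((of_nat n)\<^sup>2 * (- (A n * C (Suc n))))"
      by (rule arg_cong[of _ _ csqrt]) (simp add: power2_eq_square)
    also have "\<dots> = of_nat n * csqrt (- (A n * C (Suc n)))"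
      by (rule csqrt_of_nat_square_mult[OF n])
    finally show "csqrt ((of_nat n * - A n) * (of_nat n * C (Suc n))) = of_nat n * y (Suc n)"
      by (simp add: y_def alpha[OF n])
  qed
  from tendsto_Re[OF quad_asymp_linear_tendsto[OF this]]
  have lim: "(\<lambda>n. Re (y (Suc n)) - 1 / 4 * real n) \<longlonglongrightarrow> Re ((p1 + p3) / 2)"
    by simp
  have Y: "(\<lambda>n. Re (y n) - 1 / 4 * real n) \<longlonglongrightarrow> Re ((p1 + p3) / 2) - 1 / 4"
  proof (rule LIMSEQ_imp_Suc)
    show "(\<lambda>n. Re (y (Suc n)) - 1 / 4 * real (Suc n)) \<longlonglongrightarrow> Re ((p1 + p3) / 2) - 1 / 4"
      using tendsto_diff[OF lim tendsto_const[of "1 / 4"]] by (simp add: algebra_simps add_divide_distrib)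
  qed
  have "quad_asymp (\<lambda>n. of_nat n * (A n + C n)) 0 (- p1 + p2)"
    using quad_asymp_add[OF quad_asymp_uminus[OF p1] p2] by (simp add: algebra_simps)
  from quad_asymp_linear_tendsto[OF this]
  have AC: "(\<lambda>n. A n + C n) \<longlonglongrightarrow> - p1 + p2" by simp
  have "(\<lambda>n. \<i> * (A n + C n + a)) \<longlonglongrightarrow> \<i> * (- p1 + p2 + a)"
    by (rule tendsto_mult[OF tendsto_const tendsto_add[OF AC tendsto_const]])
  moreover have "\<forall>\<^sub>F n in sequentially. \<i> * (A n + C n + a) = chahn_beta a b c d n"
    using eventually_ge_at_top[of 1] by eventually_elim (simp add: beta)
  ultimately have "chahn_beta a b c d \<longlonglongrightarrow> \<i> * (- p1 + p2 + a)"
    by (rule Lim_transform_eventually)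
  from tendsto_Re[OF this]
  have B: "(\<lambda>n. Re (chahn_beta a b c d n)) \<longlonglongrightarrow> Re (\<i> * (- p1 + p2 + a))" .
  show False
    by (rule bounded_diagonal[OF commuting_Re[OF comm[folded y_def, unfolded h_def]] _ K[unfolded h_def]
          ng[unfolded h_def] h0[unfolded h_def] Y _ B]) (simp_all add: y0)
qed

lemma jacobi_alpha_eq:
  assumes "2 * real n + a + b + 1 \<noteq> 0" "2 * real n + a + b + 2 \<noteq> 0" "2 * real n + a + b + 3 \<noteq> 0"
  shows "jacobi_alpha a b n = sqrt ((4 * (real n + 1) * (real n + a + 1) * (real n + b + 1) * (real n + a + b + 1))
     / ((2 * real n + a + b + 1) * (2 * real n + a + b + 2)\<^sup>2 * (2 * real n + a + b + 3)))"
  unfolding jacobi_alpha_def Let_def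
  by (rule arg_cong[of _ _ sqrt], intro eval_rat_eq rat_value_intros) (use assms in simp)

lemma jacobi_beta_eq:
  assumes "2 * real n + a + b \<noteq> 0" "2 * real n + a + b + 2 \<noteq> 0"
  shows "jacobi_beta a b n = (b\<^sup>2 - a\<^sup>2) / ((2 * real n + a + b) * (2 * real n + a + b + 2))"
  unfolding jacobi_beta_def Let_def
  by (intro eval_rat_eq rat_value_intros) (use assms in simp)

lemma rat_var_plus_neq_0: "rat_var + rat_const a \<noteq> (0 :: real poly fract)"
  by (simp add: rat_var_def rat_const_def flip: to_fract_add)

text \<open>
  For a + b = -1 the factor n + a + b + 1 in the numerator cancels against
  2 n + a + b + 1, and the reduced fraction has to be computed.
\<close>

lemma jacobi_alpha_0:
  assumes "a > -1" "b > -1"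
  shows "jacobi_alpha a b 0 \<noteq> 0"
proof (cases "a + b = -1")
  case False
  with assms show ?thesis by (subst jacobi_alpha_eq) auto
next
  case True
  define N where "N = (rat_var :: real poly fract)"
  define A where "A = rat_const a"
  define B where "B = rat_const b"
  have N: "N \<noteq> 0" "N + 1 \<noteq> 0"
    using rat_var_plus_neq_0[of 0] rat_var_plus_neq_0[of 1]
    by (simp_all add: N_def rat_const_def one_pCons[symmetric])
  have AB: "A + B = - 1"
    using True by (simp add: A_def B_def rat_const_def one_pCons flip: to_fract_add to_fract_1 to_fract_uminus)
  have "(4 * (N + 1) * (N + A + 1) * (N + B + 1) * (N + A + B + 1))
      / ((2 * N + A + B + 1) * (2 * N + A + B + 2)\<^sup>2 * (2 * N + A + B + 3))
    = (4 * (N + 1) * (N + A + 1) * (N + B + 1) * N) / ((2 * N) * (2 * N + 1)\<^sup>2 * (2 * (N + 1)))"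
  proof -
    have "N + A + B + 1 = N + (A + B) + 1" "2 * N + A + B + 1 = 2 * N + (A + B) + 1"
      "2 * N + A + B + 2 = 2 * N + (A + B) + 2" "2 * N + A + B + 3 = 2 * N + (A + B) + 3"
      by (simp_all only: add.assoc)
    moreover have "N + - 1 + 1 = N" "2 * N + - 1 + 1 = 2 * N" "2 * N + - 1 + 2 = 2 * N + 1"
      "2 * N + - 1 + 3 = 2 * (N + 1)"
      by (simp_all add: algebra_simps)
    ultimately show ?thesis by (simp only: AB)
  qed
  also have "\<dots> = ((4 * N * (N + 1)) * ((N + A + 1) * (N + B + 1))) / ((4 * N * (N + 1)) * (2 * N + 1)\<^sup>2)"
  proof -
    have "4 * (N + 1) * (N + A + 1) * (N + B + 1) * N = (4 * N * (N + 1)) * ((N + A + 1) * (N + B + 1))"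
      by (simp only: mult_ac)
    moreover have "(2 * N) * (2 * N + 1)\<^sup>2 * (2 * (N + 1)) = (4 * N * (N + 1)) * (2 * N + 1)\<^sup>2"
      by (simp add: power2_eq_square algebra_simps)
    ultimately show ?thesis by (simp only:)
  qed
  also have "\<dots> = ((N + A + 1) * (N + B + 1)) / (2 * N + 1)\<^sup>2"
    using N by (intro mult_divide_mult_cancel_left) simp
  finally have "jacobi_alpha a b 0 = sqrt (eval_rat (((N + A + 1) * (N + B + 1)) / (2 * N + 1)\<^sup>2) 0)"
    by (simp add: jacobi_alpha_def Let_def N_def A_def B_def)
  also have "eval_rat (((N + A + 1) * (N + B + 1)) / (2 * N + 1)\<^sup>2) 0
      = ((0 + a + 1) * (0 + b + 1)) / (2 * 0 + 1)\<^sup>2"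
    unfolding N_def A_def B_def by (intro eval_rat_eq rat_value_intros) simp
  finally show ?thesis using assms by simp
qed

text \<open>
  Rigidity leaves \<alpha>_n = 1/2. With S = a + b, T = a - b and N = 2 n + S + 2 one has
  4 \<alpha>_n^2 = (N^2 - S^2)(N^2 - T^2) / (N^2 (N^2 - 1)), hence S^2 + T^2 = 1 and S T = 0. Then the diagonal
  vanishes and the relation with m = 0 reduces to h_k = 0.
\<close>

lemma jacobi_no_commuting:
  assumes a: "a > -1" and b: "b > -1" and ng: "\<not> geometric h"
    and comm: "commuting h (case_nat 0 (\<lambda>n. of_real (jacobi_alpha a b n))) (\<lambda>n. of_real (jacobi_beta a b n))"
  shows False
proof -
  define E where "E n = (4 * (real n + 1) * (real n + a + 1) * (real n + b + 1) * (real n + a + b + 1))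
     / ((2 * real n + a + b + 1) * (2 * real n + a + b + 2)\<^sup>2 * (2 * real n + a + b + 3))" for n
  define y where "y = case_nat 0 (\<lambda>n. complex_of_real (jacobi_alpha a b n))"
  have y_Suc: "y (Suc n) = of_real (jacobi_alpha a b n)" for n by (simp add: y_def)
  have y0: "y 0 = 0" by (simp add: y_def)
  have alpha: "jacobi_alpha a b n = sqrt (E n)" and E_pos: "E n > 0" if n: "n \<ge> 1" for n
  proof -
    have "real n \<ge> 1" using n by simp
    with a b have "real n + 1 > 0" "real n + a + 1 > 0" "real n + b + 1 > 0" "real n + a + b + 1 > 0"
      "2 * real n + a + b + 1 > 0" "2 * real n + a + b + 2 > 0" "2 * real n + a + b + 3 > 0"
      by linarith+
    note pos = this
    show "jacobi_alpha a b n = sqrt (E n)"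
      unfolding E_def by (rule jacobi_alpha_eq) (use pos in linarith)+
    show "E n > 0"
      unfolding E_def
      by (intro divide_pos_pos mult_pos_pos zero_less_power pos) (simp add: pos)+
  qed
  have ynz: "y n \<noteq> 0" if "n \<ge> 1" for n
  proof (cases "n = 1")
    case True
    then show ?thesis using jacobi_alpha_0[OF a b] by (simp add: y_def)
  next
    case False
    with that obtain m where "n = Suc m" "m \<ge> 1" by (cases n) auto
    then show ?thesis using alpha[of m] E_pos[of m] by (simp add: y_Suc)
  qed
  have "E \<longlonglongrightarrow> 1 / 4"
    unfolding E_def[abs_def] by real_asymp
  from tendsto_real_sqrt[OF this]
  have "(\<lambda>n. sqrt (E n)) \<longlonglongrightarrow> 1 / 2"
    by (simp add: real_sqrt_divide)
  moreover have "\<forall>\<^sub>F n in sequentially. sqrt (E n) = jacobi_alpha a b n"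
    using eventually_ge_at_top[of 1] by eventually_elim (simp add: alpha)
  ultimately have "jacobi_alpha a b \<longlonglongrightarrow> 1 / 2" by (rule Lim_transform_eventually)
  from tendsto_of_real[OF this, where 'a = complex]
  have lim: "y \<longlonglongrightarrow> 1 / 2"
    by (intro LIMSEQ_imp_Suc[of y]) (simp add: y_Suc)
  have beta_pos: "2 * real n + a + b \<noteq> 0 \<and> 2 * real n + a + b + 2 \<noteq> 0" if "n \<ge> 1" for n
  proof -
    have "real n \<ge> 1" using that by simp
    with a b show ?thesis by linarith
  qed
  have "(\<lambda>n. (b\<^sup>2 - a\<^sup>2) / ((2 * real n + a + b) * (2 * real n + a + b + 2))) \<longlonglongrightarrow> 0"
    by real_asymp
  moreover have "\<forall>\<^sub>F n in sequentially. (b\<^sup>2 - a\<^sup>2) / ((2 * real n + a + b) * (2 * real n + a + b + 2)) = jacobi_beta a b n"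
    using eventually_ge_at_top[of 1] by eventually_elim (use beta_pos in \<open>simp add: jacobi_beta_eq\<close>)
  ultimately have "jacobi_beta a b \<longlonglongrightarrow> 0" by (rule Lim_transform_eventually)
  from tendsto_of_real[OF this, where 'a = complex]
  have beta_lim: "(\<lambda>n. complex_of_real (jacobi_beta a b n)) \<longlonglongrightarrow> 0" by simp
  have rat: "rational_seq (\<lambda>n. (y n)\<^sup>2)"
  proof (rule rational_seq_from_Suc, rule rational_seq_cong)
    let ?s = "complex_of_real ((a + b + 1) / 2)" and ?t = "complex_of_real ((a + b + 2) / 2)"
      and ?u = "complex_of_real ((a + b + 3) / 2)"
    show "rational_seq (\<lambda>n. (1 / 4) * ((of_nat n + 1) * (of_nat n + of_real (a + 1)) * (of_nat n + of_real (b + 1))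
       * (of_nat n + of_real (a + b + 1)) * inverse (of_nat n + ?s) * inverse (of_nat n + ?t)
       * inverse (of_nat n + ?t) * inverse (of_nat n + ?u)))"
      by (intro rational_seq_mult rational_seq_const rational_seq_linear rational_seq_inverse_linear)
    fix n :: nat
    assume n: "n \<ge> 1"
    have "2 * real n + a + b + 1 = 2 * (real n + (a + b + 1) / 2)"
      "2 * real n + a + b + 2 = 2 * (real n + (a + b + 2) / 2)"
      "2 * real n + a + b + 3 = 2 * (real n + (a + b + 3) / 2)"
      "real n + a + 1 = real n + (a + 1)" "real n + b + 1 = real n + (b + 1)"
      "real n + a + b + 1 = real n + (a + b + 1)"
      by (simp_all add: field_simps)
    then have "E n = (4 * (real n + 1) * (real n + (a + 1)) * (real n + (b + 1)) * (real n + (a + b + 1)))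
      / ((2 * (real n + (a + b + 1) / 2)) * (2 * (real n + (a + b + 2) / 2))\<^sup>2 * (2 * (real n + (a + b + 3) / 2)))"
      unfolding E_def by (simp only:)
    also have "\<dots> = (1 / 4) * ((real n + 1) * (real n + (a + 1)) * (real n + (b + 1)) * (real n + (a + b + 1))
       * inverse (real n + (a + b + 1) / 2) * inverse (real n + (a + b + 2) / 2)
       * inverse (real n + (a + b + 2) / 2) * inverse (real n + (a + b + 3) / 2))"
    proof -
      have gen: "(4 * p1 * p2 * p3 * p4) / ((2 * w1) * (2 * w2)\<^sup>2 * (2 * w3)) =
          (1 / 4) * (p1 * p2 * p3 * p4 * inverse w1 * inverse w2 * inverse w2 * inverse w3)"
        if "w1 \<noteq> 0" "w2 \<noteq> 0" "w3 \<noteq> 0" for p1 p2 p3 p4 w1 w2 w3 :: real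
        using that by (simp add: field_simps power2_eq_square)
      have "real n \<ge> 1" using n by simp
      with a b have "real n + (a + b + 1) / 2 > 0" "real n + (a + b + 2) / 2 > 0" "real n + (a + b + 3) / 2 > 0"
        by (simp_all add: field_simps)
      then show ?thesis by (intro gen) simp_all
    qed
    finally have E_eq: "E n = \<dots>" .
    have y_sq: "(y (Suc n))\<^sup>2 = of_real (E n)"
      using E_pos[OF n] by (simp add: y_Suc alpha[OF n] flip: of_real_power)
    show "(1 / 4) * ((of_nat n + 1) * (of_nat n + of_real (a + 1)) * (of_nat n + of_real (b + 1))
       * (of_nat n + of_real (a + b + 1)) * inverse (of_nat n + ?s) * inverse (of_nat n + ?t)
       * inverse (of_nat n + ?t) * inverse (of_nat n + ?u)) = (y (Suc n))\<^sup>2"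
      unfolding y_sq E_eq by simp
  qed
  have half: "y n = 1 / 2" if "n \<ge> 1" for n
    by (rule convergent_offdiagonal[OF comm[folded y_def] y0 ynz ng rat lim _ beta_lim that]) simp_all
  have quarter: "4 * (real n + 1) * (real n + a + 1) * (real n + b + 1) * (real n + a + b + 1) * 4
     = (2 * real n + a + b + 1) * (2 * real n + a + b + 2)\<^sup>2 * (2 * real n + a + b + 3)" if n: "n \<ge> 1" for n
  proof -
    have "complex_of_real (sqrt (E n)) = of_real (1 / 2)"
      using half[of "Suc n"] n by (simp add: y_Suc alpha)
    then have "sqrt (E n) = 1 / 2" by (simp only: of_real_eq_iff)
    then have "(sqrt (E n))\<^sup>2 = (1 / 2)\<^sup>2" by (simp only:)
    then have "E n = 1 / 4" using E_pos[OF n] by (simp add: power2_eq_square)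
    moreover have "real n \<ge> 1" using n by simp
    with a b have "2 * real n + a + b + 1 \<noteq> 0" "2 * real n + a + b + 2 \<noteq> 0" "2 * real n + a + b + 3 \<noteq> 0"
      by linarith+
    ultimately show ?thesis unfolding E_def by (simp add: divide_eq_eq)
  qed
  define S where "S = a + b"
  define T where "T = a - b"
  have ST: "a = (S + T) / 2" "b = (S - T) / 2" by (simp_all add: S_def T_def)
  have q: "(1 - S\<^sup>2 - T\<^sup>2) * (2 * real n + S + 2)\<^sup>2 + S\<^sup>2 * T\<^sup>2 = 0" if "n \<ge> 1" for n
    using quarter[OF that] unfolding ST by (simp add: field_simps power2_eq_square)
  have "S > -2" using a b by (simp add: S_def)
  have "(1 - S\<^sup>2 - T\<^sup>2) * ((S + 6)\<^sup>2 - (S + 4)\<^sup>2) = 0"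
    using q[of 1] q[of 2] by (simp add: algebra_simps)
  moreover have "(S + 6)\<^sup>2 - (S + 4)\<^sup>2 \<noteq> 0"
    using \<open>S > -2\<close> by (simp add: power2_eq_square algebra_simps)
  ultimately have "1 - S\<^sup>2 - T\<^sup>2 = 0" by simp
  with q[of 1] have "S * T = 0" by simp
  then have sq: "b\<^sup>2 = a\<^sup>2" by (simp add: S_def T_def power2_eq_square algebra_simps)
  have beta0: "jacobi_beta a b n = 0" for n
  proof -
    have "(rat_const b)\<^sup>2 - (rat_const a)\<^sup>2 = (0 :: real poly fract)"
      using sq by (simp add: rat_const_def power2_eq_square flip: to_fract_mult)
    then show ?thesis by (simp add: jacobi_beta_def Let_def eval_rat_def)
  qed
  have "h k = 0" for k
    using commutingD[OF comm[folded y_def], of 0 "Suc k" k]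
    by (simp add: y0 half beta0)
  then have "geometric h" by (simp add: geometric_def)
  with ng show False ..
qed

lemma complex_matrix_jacobi_matrix:
  "complex_matrix (jacobi_matrix \<alpha> \<beta>) = jacobi_matrix (\<lambda>n. of_real (\<alpha> n)) (\<lambda>n. of_real (\<beta> n))"
  by (auto simp: complex_matrix_def jacobi_matrix_def fun_eq_iff)

theorem mainTheorem2:
  fixes H :: "nat \<Rightarrow> nat \<Rightarrow> real" and J :: "nat \<Rightarrow> nat \<Rightarrow> complex"
  assumes "hankel_matrix H"
    and "l2_columns H"
    and "matrix_rank H > 1"
    and "askey_jacobi_matrix J"
    and "mat_mult (complex_matrix H) J = mat_mult J (complex_matrix H)"
  shows "\<exists>t c :: real. t \<notin> \<int>\<^sub>\<le>\<^sub>0 \<and> (\<forall>m n. H m n = c * hilbert_tilde t m n)"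
proof -
  from assms(1) obtain h where H: "\<And>m n. H m n = h (m + n)"
    unfolding hankel_matrix_def by blast
  have ng: "\<not> geometric (\<lambda>k. complex_of_real (h k))"
    by (rule geometric_hankel_rank[OF H assms(3)])
  have "summable (\<lambda>m. (H m 0)\<^sup>2)" using assms(2) unfolding l2_columns_def by blast
  then have "summable (\<lambda>m. (h m)\<^sup>2)" by (simp add: H)
  then have h0: "(\<lambda>k. complex_of_real (h k)) \<longlonglongrightarrow> 0" by (rule l2_entries_tendsto_0)
  note from_matrices = commuting_from_matrices[of H h, OF H]
  have "\<exists>t c. t \<notin> \<int>\<^sub>\<le>\<^sub>0 \<and> (\<forall>k. h k = c * (-1) ^ k / (real k + t))"
    using assms(4,5)
  proof (cases rule: askey_jacobi_matrix.cases)
    case (Wilson a b c d)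
    with assms(5) show ?thesis
      using wilson_commuting[OF Wilson(2) from_matrices ng h0] by simp
  next
    case (Continuous_dual_Hahn a b c)
    with assms(5) show ?thesis
      using cdhahn_commuting[OF Continuous_dual_Hahn(2) from_matrices ng h0] by simp
  next
    case (Continuous_Hahn a b c d)
    with assms(5) show ?thesis
      using chahn_no_commuting[OF Continuous_Hahn(2) from_matrices ng h0] by simp
  next
    case (Jacobi \<alpha> \<beta>)
    with assms(5) show ?thesis
      using jacobi_no_commuting[OF Jacobi(2,3) ng from_matrices]
      by (simp add: complex_matrix_jacobi_matrix)
  next
    case (Meixner_Pollaczek l \<phi>)
    with assms(5) show ?thesis
      using meixner_pollaczek_no_commuting[OF ng h0 Meixner_Pollaczek(2,3,4) from_matrices]
      by (simp add: complex_matrix_jacobi_matrix)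
  next
    case (Meixner \<beta> c)
    with assms(5) show ?thesis
      using meixner_no_commuting[OF ng h0 Meixner(2,3,4) from_matrices]
      by (simp add: complex_matrix_jacobi_matrix)
  next
    case (Laguerre \<alpha>)
    with assms(5) show ?thesis
      using laguerre_no_commuting[OF ng h0 Laguerre(2) from_matrices]
      by (simp add: complex_matrix_jacobi_matrix)
  next
    case (Charlier a)
    with assms(5) show ?thesis
      using charlier_no_commuting[OF ng Charlier(2) from_matrices]
      by (simp add: complex_matrix_jacobi_matrix)
  next
    case Hermite
    with assms(5) show ?thesis
      using hermite_no_commuting[OF ng from_matrices]
      by (simp add: complex_matrix_jacobi_matrix)
  qed
  then obtain t c where t: "t \<notin> \<int>\<^sub>\<le>\<^sub>0" and h: "\<And>k. h k = c * (-1) ^ k / (real k + t)" by blast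
  have "H m n = c * hilbert_tilde t m n" for m n
    by (simp add: H h hilbert_tilde_def)
  with t show ?thesis by blast
qed

end
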